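(* Suppose that the finitely generated group $G$ satisfies Property $( * )$. Then a central extension of $G$ by a finitely generated abelian group $Z$ is quasi-isometrically trivial if and only if its Euler class has finite order in $H^2(G,Z)$. Moreover, if $Z$ is torsion-free then this happens if and only if the extension is virtually trivial.
   Context: For a group $G$, a class $\alpha\in H_2(G,\mathbb{R})$ is amenable if there exist an amenable group $A$ and a homomorphism $f\colon A\to G$ such that $\alpha$ lies in the image of $f_*\colon H_2(A,\mathbb{R})\to H_2(G,\mathbb{R})$. $H_2^{\mathrm{am}}(G,\mathbb{R})$ is the linear subspace of $H_2(G,\mathbb{R})$ generated by amenable classes. $G$ has Property $( * )$ if $H_2^{\mathrm{am}}(G,\mathbb{R})=H_2(G,\mathbb{R})$. Euler class: given a central extension $1\to Z\xrightarrow{i} E\xrightarrow{\pi} G\to 1$ and a set-theoretic section $s\colon G\to E$ of $\pi$, the map $\omega_s(g_1,g_2)=s(g_1)s(g_2)s(g_1g_2)^{-1}\in i(Z)\cong Z$ is a 2-cocycle, whose class in $H^2(G,Z)$ does not depend on $s$ and is called the Euler class of the extension. Finitely generated groups carry word metrics. A central extension $1\to Z\to E\xrightarrow{\pi} G\to 1$ with $G,Z$ (hence $E$) finitely generated is quasi-isometrically trivial if there is a quasi-isometry $f\colon E\to Z\times G$ such that $\sup_{h\in E} d_G(\pi(h),\pi_2(f(h)))<+\infty$, where $d_G$ is a word metric on $G$ and $\pi_2\colon Z\times G\to G$ is the projection on the second factor. It is virtually trivial if there exists a finite-index subgroup $G'$ of $G$ such that the induced central extension $1\to Z\to\pi^{-1}(G')\to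 G'\to 1$ is trivial, i.e. isomorphic as a central extension to the product extension (equivalently, its Euler class in $H^2(G',Z)$ vanishes). *)

theory Defs
  imports Complex_Main "HOL-Library.Poly_Mapping" "HOL-Algebra.Algebra"
begin

section \<open>Second group homology with real coefficients\<close>

text \<open>
  Inhomogeneous bar complex of a group: a real n-chain is a finitely supported real function on
  n-tuples of elements of the group.  Only the degrees 1, 2, 3 occur in the second homology.
  Chains over a group whose carrier is not the whole type are those whose support consists of
  tuples of elements of the carrier.
\<close>

definition chain_scale :: "real \<Rightarrow> ('x \<Rightarrow>\<^sub>0 real) \<Rightarrow> ('x \<Rightarrow>\<^sub>0 real)" where
  "chain_scale r c = Poly_Mapping.map ((*) r) c"

definition lin_extend :: "('x \<Rightarrow> ('y \<Rightarrow>\<^sub>0 real)) \<Rightarrow> ('x \<Rightarrow>\<^sub>0 real) \<Rightarrow> ('y \<Rightarrow>\<^sub>0 real)" where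
  "lin_extend F c = (\<Sum>x\<in>Poly_Mapping.keys c. chain_scale (Poly_Mapping.lookup c x) (F x))"

definition boundary2 :: "('g, 'm) monoid_scheme \<Rightarrow> ('g \<times> 'g \<Rightarrow>\<^sub>0 real) \<Rightarrow> ('g \<Rightarrow>\<^sub>0 real)" where
  "boundary2 G = lin_extend (\<lambda>(g, h).
     Poly_Mapping.single h 1 - Poly_Mapping.single (g \<otimes>\<^bsub>G\<^esub> h) 1 + Poly_Mapping.single g 1)"

definition boundary3 ::
    "('g, 'm) monoid_scheme \<Rightarrow> ('g \<times> 'g \<times> 'g \<Rightarrow>\<^sub>0 real) \<Rightarrow> ('g \<times> 'g \<Rightarrow>\<^sub>0 real)" where
  "boundary3 G = lin_extend (\<lambda>(g, h, k).
     Poly_Mapping.single (h, k) 1 - Poly_Mapping.single (g \<otimes>\<^bsub>G\<^esub> h, k) 1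
     + Poly_Mapping.single (g, h \<otimes>\<^bsub>G\<^esub> k) 1 - Poly_Mapping.single (g, h) 1)"

definition cycles2 :: "('g, 'm) monoid_scheme \<Rightarrow> ('g \<times> 'g \<Rightarrow>\<^sub>0 real) set" where
  "cycles2 G = {c. Poly_Mapping.keys c \<subseteq> carrier G \<times> carrier G \<and> boundary2 G c = 0}"

definition boundaries2 :: "('g, 'm) monoid_scheme \<Rightarrow> ('g \<times> 'g \<Rightarrow>\<^sub>0 real) set" where
  "boundaries2 G = boundary3 G ` {c. Poly_Mapping.keys c \<subseteq> carrier G \<times> carrier G \<times> carrier G}"

definition homology_class ::
    "('g, 'm) monoid_scheme \<Rightarrow> ('g \<times> 'g \<Rightarrow>\<^sub>0 real) \<Rightarrow> ('g \<times> 'g \<Rightarrow>\<^sub>0 real) set" where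
  "homology_class G c = {c + b | b. b \<in> boundaries2 G}"

definition real_ring :: "real ring" where
  "real_ring = \<lparr>carrier = UNIV, monoid.mult = (*), monoid.one = 1, ring.zero = 0, ring.add = (+)\<rparr>"

text \<open>
  The real vector space of cosets of \<open>boundaries2 G\<close> in \<open>cycles2 G\<close>.  The record type of modules
  extends that of rings; the fields \<open>mult\<close> and \<open>one\<close> play no role for a module.
\<close>

definition H2_real ::
    "('g, 'm) monoid_scheme \<Rightarrow> (real, ('g \<times> 'g \<Rightarrow>\<^sub>0 real) set) module" where
  "H2_real G = \<lparr>carrier = homology_class G ` cycles2 G,
     monoid.mult = undefined, monoid.one = undefined,
     ring.zero = boundaries2 G,
     ring.add = (\<lambda>U V. {x + y | x y. x \<in> U \<and> y \<in> V}),
     smult = (\<lambda>r U. \<Union>x\<in>U. homology_class G (chain_scale r x))\<rparr>"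

definition chain_map ::
    "('a \<Rightarrow> 'g) \<Rightarrow> ('a \<times> 'a \<Rightarrow>\<^sub>0 real) \<Rightarrow> ('g \<times> 'g \<Rightarrow>\<^sub>0 real)" where
  "chain_map f = lin_extend (\<lambda>(a, b). Poly_Mapping.single (f a, f b) 1)"

definition H2_real_map ::
    "('g, 'm) monoid_scheme \<Rightarrow> ('a \<Rightarrow> 'g) \<Rightarrow>
     ('a \<times> 'a \<Rightarrow>\<^sub>0 real) set \<Rightarrow> ('g \<times> 'g \<Rightarrow>\<^sub>0 real) set" where
  "H2_real_map G f U = (\<Union>c\<in>U. homology_class G (chain_map f c))"


section \<open>Amenable classes and Property (*)\<close>

text \<open>
  Existence of a left-invariant mean on the bounded real functions on the group.  Linearity and
  positivity force \<open>\<mu> f\<close> to depend only on the restriction of \<open>f\<close> to the carrier.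
\<close>

definition amenable :: "('a, 'm) monoid_scheme \<Rightarrow> bool" where
  "amenable A \<longleftrightarrow> group A \<and>
     (let bdd = {f :: 'a \<Rightarrow> real. \<exists>B. \<forall>x\<in>carrier A. \<bar>f x\<bar> \<le> B} in
      \<exists>\<mu> :: ('a \<Rightarrow> real) \<Rightarrow> real.
        (\<forall>f\<in>bdd. \<forall>f'\<in>bdd. \<mu> (\<lambda>x. f x + f' x) = \<mu> f + \<mu> f') \<and>
        (\<forall>f\<in>bdd. \<forall>r. \<mu> (\<lambda>x. r * f x) = r * \<mu> f) \<and>
        (\<forall>f\<in>bdd. (\<forall>x\<in>carrier A. 0 \<le> f x) \<longrightarrow> 0 \<le> \<mu> f) \<and>
        \<mu> (\<lambda>x. 1) = 1 \<and>
        (\<forall>f\<in>bdd. \<forall>a\<in>carrier A. \<mu> (\<lambda>x. f (a \<otimes>\<^bsub>A\<^esub> x)) = \<mu> f))"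

text \<open>
  The type argument is the type over which the elements of the amenable group range; it is needed
  because quantification over types is not available inside a definition.  A theorem assuming
  \<open>property_star TYPE('a) G\<close> with \<open>'a\<close> free covers amenable groups over arbitrary types.
\<close>

definition amenable_class ::
    "'a itself \<Rightarrow> ('g, 'm) monoid_scheme \<Rightarrow> ('g \<times> 'g \<Rightarrow>\<^sub>0 real) set \<Rightarrow> bool" where
  "amenable_class TA G \<alpha> \<longleftrightarrow> \<alpha> \<in> carrier (H2_real G) \<and>
     (\<exists>(A :: 'a monoid) f. amenable A \<and> f \<in> hom A G \<and>
        \<alpha> \<in> H2_real_map G f ` carrier (H2_real A))"

definition H2_am ::
    "'a itself \<Rightarrow> ('g, 'm) monoid_scheme \<Rightarrow> ('g \<times> 'g \<Rightarrow>\<^sub>0 real) set set" where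
  "H2_am TA G =
     \<Inter> {V. submodule V real_ring (H2_real G) \<and> {\<alpha>. amenable_class TA G \<alpha>} \<subseteq> V}"

definition property_star :: "'a itself \<Rightarrow> ('g, 'm) monoid_scheme \<Rightarrow> bool" where
  "property_star TA G \<longleftrightarrow> H2_am TA G = carrier (H2_real G)"


section \<open>Central extensions and the Euler class\<close>

locale central_extension =
  Z: comm_group Z + E: group E + G: group G
  for Z :: "('z, 'm) monoid_scheme" and E :: "('e, 'n) monoid_scheme"
    and G :: "('g, 'k) monoid_scheme" and i :: "'z \<Rightarrow> 'e" and \<pi> :: "'e \<Rightarrow> 'g" +
  assumes i_hom: "i \<in> hom Z E" and i_inj: "inj_on i (carrier Z)"
    and \<pi>_hom: "\<pi> \<in> hom E G" and \<pi>_surj: "\<pi> ` carrier E = carrier G"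
    and exact: "i ` carrier Z = kernel E G \<pi>"
    and central: "\<And>z e. z \<in> carrier Z \<Longrightarrow> e \<in> carrier E \<Longrightarrow> i z \<otimes>\<^bsub>E\<^esub> e = e \<otimes>\<^bsub>E\<^esub> i z"

text \<open>
  Second cohomology of \<open>G\<close> with coefficients in the trivial module \<open>Z\<close> (written multiplicatively),
  as a quotient of groups of inhomogeneous cochains.
\<close>

definition cocycles2 ::
    "('g, 'k) monoid_scheme \<Rightarrow> ('z, 'm) monoid_scheme \<Rightarrow> ('g \<times> 'g \<Rightarrow> 'z) set" where
  "cocycles2 G Z = {\<omega> \<in> (carrier G \<times> carrier G) \<rightarrow>\<^sub>E carrier Z.
     \<forall>g\<in>carrier G. \<forall>h\<in>carrier G. \<forall>k\<in>carrier G.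
       \<omega> (h, k) \<otimes>\<^bsub>Z\<^esub> \<omega> (g, h \<otimes>\<^bsub>G\<^esub> k) = \<omega> (g \<otimes>\<^bsub>G\<^esub> h, k) \<otimes>\<^bsub>Z\<^esub> \<omega> (g, h)}"

definition coboundaries2 ::
    "('g, 'k) monoid_scheme \<Rightarrow> ('z, 'm) monoid_scheme \<Rightarrow> ('g \<times> 'g \<Rightarrow> 'z) set" where
  "coboundaries2 G Z =
     (\<lambda>\<phi>. \<lambda>(g, h)\<in>carrier G \<times> carrier G.
        \<phi> h \<otimes>\<^bsub>Z\<^esub> inv\<^bsub>Z\<^esub> (\<phi> (g \<otimes>\<^bsub>G\<^esub> h)) \<otimes>\<^bsub>Z\<^esub> \<phi> g) ` (carrier G \<rightarrow>\<^sub>E carrier Z)"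

definition cocycle_group2 ::
    "('g, 'k) monoid_scheme \<Rightarrow> ('z, 'm) monoid_scheme \<Rightarrow> ('g \<times> 'g \<Rightarrow> 'z) monoid" where
  "cocycle_group2 G Z =
     (product_group (carrier G \<times> carrier G) (\<lambda>_. Z))\<lparr>carrier := cocycles2 G Z\<rparr>"

definition H2_cohom ::
    "('g, 'k) monoid_scheme \<Rightarrow> ('z, 'm) monoid_scheme \<Rightarrow> ('g \<times> 'g \<Rightarrow> 'z) set monoid" where
  "H2_cohom G Z = cocycle_group2 G Z Mod coboundaries2 G Z"

definition finite_order :: "('h, 'm) monoid_scheme \<Rightarrow> 'h \<Rightarrow> bool" where
  "finite_order H x \<longleftrightarrow> (\<exists>n::nat. n > 0 \<and> x [^]\<^bsub>H\<^esub> n = \<one>\<^bsub>H\<^esub>)"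

definition sections ::
    "('e, 'n) monoid_scheme \<Rightarrow> ('g, 'k) monoid_scheme \<Rightarrow> ('e \<Rightarrow> 'g) \<Rightarrow> ('g \<Rightarrow> 'e) set" where
  "sections E G \<pi> = {s \<in> carrier G \<rightarrow> carrier E. \<forall>g\<in>carrier G. \<pi> (s g) = g}"

definition section_cocycle ::
    "('z, 'm) monoid_scheme \<Rightarrow> ('e, 'n) monoid_scheme \<Rightarrow> ('g, 'k) monoid_scheme \<Rightarrow>
     ('z \<Rightarrow> 'e) \<Rightarrow> ('g \<Rightarrow> 'e) \<Rightarrow> 'g \<times> 'g \<Rightarrow> 'z" where
  "section_cocycle Z E G i s = (\<lambda>(g, h)\<in>carrier G \<times> carrier G.
     inv_into (carrier Z) i (s g \<otimes>\<^bsub>E\<^esub> s h \<otimes>\<^bsub>E\<^esub> inv\<^bsub>E\<^esub> (s (g \<otimes>\<^bsub>G\<^esub> h))))"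

text \<open>
  For a central extension the class of \<open>section_cocycle Z E G i s\<close> is the same for all sections
  \<open>s\<close>, so the description below determines a unique element of \<open>H2_cohom G Z\<close>.
\<close>

definition euler_class ::
    "('z, 'm) monoid_scheme \<Rightarrow> ('e, 'n) monoid_scheme \<Rightarrow> ('g, 'k) monoid_scheme \<Rightarrow>
     ('z \<Rightarrow> 'e) \<Rightarrow> ('e \<Rightarrow> 'g) \<Rightarrow> ('g \<times> 'g \<Rightarrow> 'z) set" where
  "euler_class Z E G i \<pi> = (THE \<epsilon>. \<exists>s\<in>sections E G \<pi>.
     \<epsilon> = coboundaries2 G Z #>\<^bsub>cocycle_group2 G Z\<^esub> section_cocycle Z E G i s)"


section \<open>Word metrics and quasi-isometries\<close>

definition finitely_generated :: "('g, 'm) monoid_scheme \<Rightarrow> bool" where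
  "finitely_generated G \<longleftrightarrow> (\<exists>S. finite S \<and> S \<subseteq> carrier G \<and> generate G S = carrier G)"

definition word_length :: "('g, 'm) monoid_scheme \<Rightarrow> 'g set \<Rightarrow> 'g \<Rightarrow> nat" where
  "word_length G S g = (LEAST n. \<exists>xs. length xs = n \<and> set xs \<subseteq> S \<union> m_inv G ` S \<and>
     foldr (\<otimes>\<^bsub>G\<^esub>) xs \<one>\<^bsub>G\<^esub> = g)"

definition word_metric :: "('g, 'm) monoid_scheme \<Rightarrow> ('g \<Rightarrow> 'g \<Rightarrow> real) \<Rightarrow> bool" where
  "word_metric G d \<longleftrightarrow> (\<exists>S. finite S \<and> S \<subseteq> carrier G \<and> generate G S = carrier G \<and>
     d = (\<lambda>g h. real (word_length G S (inv\<^bsub>G\<^esub> g \<otimes>\<^bsub>G\<^esub> h))))"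

definition quasi_isometry ::
    "'x set \<Rightarrow> ('x \<Rightarrow> 'x \<Rightarrow> real) \<Rightarrow> 'y set \<Rightarrow> ('y \<Rightarrow> 'y \<Rightarrow> real) \<Rightarrow> ('x \<Rightarrow> 'y) \<Rightarrow> bool" where
  "quasi_isometry A dA B dB f \<longleftrightarrow> f \<in> A \<rightarrow> B \<and>
     (\<exists>k\<ge>1. \<exists>c\<ge>0.
        (\<forall>x\<in>A. \<forall>x'\<in>A. dA x x' / k - c \<le> dB (f x) (f x') \<and> dB (f x) (f x') \<le> k * dA x x' + c) \<and>
        (\<forall>y\<in>B. \<exists>x\<in>A. dB (f x) y \<le> c))"

text \<open>
  Any two word metrics on a finitely generated group are bi-Lipschitz equivalent, so the choice
  of the three word metrics does not matter.
\<close>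

definition qi_trivial ::
    "('z, 'm) monoid_scheme \<Rightarrow> ('e, 'n) monoid_scheme \<Rightarrow> ('g, 'k) monoid_scheme \<Rightarrow>
     ('e \<Rightarrow> 'g) \<Rightarrow> bool" where
  "qi_trivial Z E G \<pi> \<longleftrightarrow>
     (\<exists>dE dP dG f. word_metric E dE \<and> word_metric (Z \<times>\<times> G) dP \<and> word_metric G dG \<and>
        quasi_isometry (carrier E) dE (carrier (Z \<times>\<times> G)) dP f \<and>
        bdd_above ((\<lambda>h. dG (\<pi> h) (snd (f h))) ` carrier E))"


section \<open>Virtually trivial extensions\<close>

definition trivial_extension ::
    "('z, 'm) monoid_scheme \<Rightarrow> ('e, 'n) monoid_scheme \<Rightarrow> ('g, 'k) monoid_scheme \<Rightarrow>
     ('z \<Rightarrow> 'e) \<Rightarrow> ('e \<Rightarrow> 'g) \<Rightarrow> bool" where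
  "trivial_extension Z E G i \<pi> \<longleftrightarrow> (\<exists>\<Phi>\<in>iso E (Z \<times>\<times> G).
     (\<forall>z\<in>carrier Z. \<Phi> (i z) = (z, \<one>\<^bsub>G\<^esub>)) \<and> (\<forall>e\<in>carrier E. snd (\<Phi> e) = \<pi> e))"

definition virtually_trivial ::
    "('z, 'm) monoid_scheme \<Rightarrow> ('e, 'n) monoid_scheme \<Rightarrow> ('g, 'k) monoid_scheme \<Rightarrow>
     ('z \<Rightarrow> 'e) \<Rightarrow> ('e \<Rightarrow> 'g) \<Rightarrow> bool" where
  "virtually_trivial Z E G i \<pi> \<longleftrightarrow> (\<exists>G'. subgroup G' G \<and> finite (rcosets\<^bsub>G\<^esub> G') \<and>
     trivial_extension Z (E\<lparr>carrier := {e \<in> carrier E. \<pi> e \<in> G'}\<rparr>) (G\<lparr>carrier := G'\<rparr>) i \<pi>)"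

definition torsion_free :: "('z, 'm) monoid_scheme \<Rightarrow> bool" where
  "torsion_free Z \<longleftrightarrow> (\<forall>z\<in>carrier Z. \<forall>n::nat. n > 0 \<longrightarrow> z [^]\<^bsub>Z\<^esub> n = \<one>\<^bsub>Z\<^esub> \<longrightarrow> z = \<one>\<^bsub>Z\<^esub>)"

end

theory Submission
  imports Defs
begin

text \<open>
  The common reformulation of all three conditions is the existence of a section \<open>s\<close> of \<open>\<pi>\<close> that is
  Lipschitz for word metrics, i.e. whose cocycle \<open>\<omega>\<close> takes finitely many values for each fixed second
  argument. Restricting a quasi-inverse of \<open>E \<rightarrow> Z \<times> G\<close> to \<open>1 \<times> G\<close> gives such a section, and conversely
  \<open>(z, g) \<mapsto> z s(g)\<close> is then bi-Lipschitz.

  If \<open>s\<close> is Lipschitz and \<open>\<chi> : Z \<rightarrow> \<int>\<close> is a character, the pullback of the real cocycle \<open>\<chi> \<circ> \<omega>\<close> to an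
  amenable group is the coboundary of its mean over the first variable, so \<open>\<chi> \<circ> \<omega>\<close> vanishes on amenable
  classes, by Property (*) on all of \<open>H\<^sub>2\<close>, and is a real coboundary. Hence \<open>\<chi>\<close> extends to a real
  character of \<open>E\<close> and vanishes on \<open>Z \<inter> [E, E]\<close>. As \<open>\<chi>\<close> was arbitrary, \<open>Z \<inter> [E, E]\<close> is torsion, so some
  power map of \<open>Z\<close> extends to a homomorphism \<open>\<psi> : E \<rightarrow> Z\<close>, which says that the Euler class has finite
  order. Conversely, such a \<open>\<psi>\<close> yields a section on which \<open>\<psi>\<close> takes finitely many values and, if \<open>Z\<close> is
  torsion-free, a splitting over the finite-index image of \<open>{e. \<psi> e \<in> Z\<^sup>n}\<close>; a splitting over a
  finite-index subgroup extends to a Lipschitz section by coset representatives.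
\<close>

section \<open>Evaluating cochains on chains\<close>

text \<open>Finiteness for each fixed second argument is the middle condition because it serves both
  sides: balls of word metrics are finite, which turns metric estimates into it, and averaging over
  the first variable needs one bound per second argument rather than a uniform one.
  \<open>property_star\<close> then controls real cocycles only, and torsion escapes it twice.
  Torsion of \<open>Z\<close> is invisible to integer characters, so the intersection of
  \<open>Z\<close> with \<open>[E, E]\<close> is shown to be torsion but may be nontrivial. And a
  homomorphism defined on the image of \<open>Z\<close> in the abelianization of \<open>E\<close>
  may fail to extend, since the quotient by that image can have torsion. Each defect is repaired by
  raising to a power, and finite generation keeps the exponent finite; hence
  \<open>power_retract\<close> asks for a power map on \<open>Z\<close> instead of the identity. On
  the way back the exponent \<open>n\<close> does no harm, because in a finitely generated abelian
  group both the quotient by the n-th powers and the fibres of the n-th power map are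
  finite.\<close>

definition eval_chain :: "('x \<Rightarrow> real) \<Rightarrow> ('x \<Rightarrow>\<^sub>0 real) \<Rightarrow> real" where
  "eval_chain c x = (\<Sum>k\<in>Poly_Mapping.keys x. Poly_Mapping.lookup x k * c k)"

lemma eval_chain_superset:
  assumes "finite S" "Poly_Mapping.keys x \<subseteq> S"
  shows "eval_chain c x = (\<Sum>k\<in>S. Poly_Mapping.lookup x k * c k)"
  unfolding eval_chain_def
  by (rule sum.mono_neutral_left) (use assms in \<open>auto simp: in_keys_iff\<close>)

lemma eval_chain_cong:
  assumes "\<And>k. k \<in> Poly_Mapping.keys x \<Longrightarrow> c k = d k"
  shows "eval_chain c x = eval_chain d x"
  unfolding eval_chain_def using assms by (intro sum.cong) auto

lemma eval_chain_add: "eval_chain c (x + y) = eval_chain c x + eval_chain c y"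
proof -
  let ?S = "Poly_Mapping.keys x \<union> Poly_Mapping.keys y"
  have "eval_chain c z = (\<Sum>k\<in>?S. Poly_Mapping.lookup z k * c k)" if "z \<in> {x, y, x + y}" for z
    using that keys_add[of x y] by (intro eval_chain_superset) auto
  then show ?thesis
    by (simp add: lookup_add distrib_right sum.distrib)
qed

lemma eval_chain_zero [simp]: "eval_chain c 0 = 0"
  by (simp add: eval_chain_def)

lemma eval_chain_minus: "eval_chain c (- x) = - eval_chain c x"
  using eval_chain_add[of c x "- x"] by simp

lemma eval_chain_diff: "eval_chain c (x - y) = eval_chain c x - eval_chain c y"
  using eval_chain_add[of c x "- y"] by (simp add: eval_chain_minus)

lemma eval_chain_sum: "eval_chain c (sum f A) = (\<Sum>a\<in>A. eval_chain c (f a))"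
  by (induction A rule: infinite_finite_induct) (auto simp: eval_chain_add)

lemma eval_chain_single [simp]: "eval_chain c (Poly_Mapping.single k r) = r * c k"
  by (cases "r = 0") (auto simp: eval_chain_def)

lemma lookup_chain_scale [simp]:
  "Poly_Mapping.lookup (chain_scale r x) k = r * Poly_Mapping.lookup x k"
  unfolding chain_scale_def by (simp add: Poly_Mapping.map.rep_eq when_def)

lemma keys_chain_scale: "Poly_Mapping.keys (chain_scale r x) \<subseteq> Poly_Mapping.keys x"
  by (auto simp: in_keys_iff)

lemma eval_chain_scale: "eval_chain c (chain_scale r x) = r * eval_chain c x"
  using keys_chain_scale[of r x]
  by (simp add: eval_chain_superset[of "Poly_Mapping.keys x"] sum_distrib_left mult.assoc)

text \<open>A coefficient of a linear extension is itself the pairing of the chain with a cochain,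
  so linearity of \<open>lin_extend\<close> is inherited from that of
  \<open>eval_chain\<close>.\<close>

lemma lookup_lin_extend:
  "Poly_Mapping.lookup (lin_extend F x) y = eval_chain (\<lambda>k. Poly_Mapping.lookup (F k) y) x"
  by (simp add: lin_extend_def eval_chain_def lookup_sum)

text \<open>Boundary and coboundary are adjoint: when \<open>F\<close> gives the boundaries of the
  generators, the right side pairs \<open>x\<close> with the coboundary of \<open>c\<close>.\<close>

lemma eval_chain_lin_extend: "eval_chain c (lin_extend F x) = eval_chain (\<lambda>k. eval_chain c (F k)) x"
  by (simp add: lin_extend_def eval_chain_sum eval_chain_scale) (simp add: eval_chain_def)

lemma lin_extend_add: "lin_extend F (x + y) = lin_extend F x + lin_extend F y"
  by (rule poly_mapping_eqI) (simp add: lookup_lin_extend lookup_add eval_chain_add)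

lemma lin_extend_scale: "lin_extend F (chain_scale r x) = chain_scale r (lin_extend F x)"
  by (rule poly_mapping_eqI) (simp add: lookup_lin_extend eval_chain_scale)

lemma lin_extend_zero [simp]: "lin_extend F 0 = 0"
  by (simp add: lin_extend_def)

text \<open>Opens chains to linear algebra over the reals, from which the partial inverse of the
  boundary below is taken.\<close>

lemma vector_space_chain_scale: "vector_space chain_scale"
  by unfold_locales (auto intro!: poly_mapping_eqI simp: lookup_add algebra_simps)

text \<open>A functional vanishing on the kernel of \<^term>\<open>boundary2 G\<close> factors through it.\<close>

lemma eval_chain_eq_0_on_cycles_imp_coboundary:
  assumes "\<And>x. x \<in> cycles2 G \<Longrightarrow> eval_chain c x = 0"
  obtains \<phi> where "\<And>g h. g \<in> carrier G \<Longrightarrow> h \<in> carrier G \<Longrightarrow> c (g, h) = \<phi> h - \<phi> (g \<otimes>\<^bsub>G\<^esub> h) + \<phi> g"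
proof -
  interpret C2: vector_space "chain_scale :: real \<Rightarrow> ('a \<times> 'a \<Rightarrow>\<^sub>0 real) \<Rightarrow> _"
    by (rule vector_space_chain_scale)
  interpret C1: vector_space "chain_scale :: real \<Rightarrow> ('a \<Rightarrow>\<^sub>0 real) \<Rightarrow> _"
    by (rule vector_space_chain_scale)
  interpret P: vector_space_pair "chain_scale :: real \<Rightarrow> ('a \<times> 'a \<Rightarrow>\<^sub>0 real) \<Rightarrow> _"
    "chain_scale :: real \<Rightarrow> ('a \<Rightarrow>\<^sub>0 real) \<Rightarrow> _" ..
  define V where "V = {x :: 'a \<times> 'a \<Rightarrow>\<^sub>0 real. Poly_Mapping.keys x \<subseteq> carrier G \<times> carrier G}"
  have lin: "Vector_Spaces.linear chain_scale chain_scale (boundary2 G)"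
    by unfold_locales (auto simp: boundary2_def lin_extend_add lin_extend_scale)
  interpret b: Vector_Spaces.linear chain_scale chain_scale "boundary2 G" by (rule lin)
  have V: "C2.subspace V"
    by (auto simp: C2.subspace_def V_def dest: subsetD[OF keys_add] subsetD[OF keys_chain_scale])
  \<comment> \<open>\<open>r\<close> inverts the boundary on its image, choosing chains over
    \<open>G\<close>. It is linear on all 1-chains, so it may be applied to a single generator even
    if that is no boundary; the cochain \<phi> is \<open>c\<close> paired with \<open>r\<close> of a
    generator.\<close>
  obtain r where r: "range r \<subseteq> V" "Vector_Spaces.linear chain_scale chain_scale r"
      "\<And>x. x \<in> V \<Longrightarrow> boundary2 G (r (boundary2 G x)) = boundary2 G x"
    using P.linear_exists_right_inverse_on[OF lin V] by (auto simp: image_iff)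
  interpret r: Vector_Spaces.linear chain_scale chain_scale r by fact
  have c: "eval_chain c x = eval_chain c (r (boundary2 G x))" if "x \<in> V" for x
  proof -
    have "x - r (boundary2 G x) \<in> cycles2 G"
      using that r C2.subspace_diff[OF V, of x "r (boundary2 G x)"]
      by (auto simp: cycles2_def V_def b.diff)
    from assms[OF this] show ?thesis by (simp add: eval_chain_diff)
  qed
  show ?thesis
  proof
    fix g h assume gh: "g \<in> carrier G" "h \<in> carrier G"
    have "c (g, h) = eval_chain c (Poly_Mapping.single (g, h) 1)" by simp
    also have "\<dots> = eval_chain c (r (boundary2 G (Poly_Mapping.single (g, h) 1)))"
      using gh by (intro c) (auto simp: V_def)
    also have "boundary2 G (Poly_Mapping.single (g, h) 1) =
        Poly_Mapping.single h 1 - Poly_Mapping.single (g \<otimes>\<^bsub>G\<^esub> h) 1 + Poly_Mapping.single g 1"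
      by (simp add: boundary2_def lin_extend_def)
    finally show "c (g, h) = eval_chain c (r (Poly_Mapping.single h 1))
        - eval_chain c (r (Poly_Mapping.single (g \<otimes>\<^bsub>G\<^esub> h) 1)) + eval_chain c (r (Poly_Mapping.single g 1))"
      by (simp add: r.add r.diff eval_chain_add eval_chain_diff)
  qed
qed

definition real_cocycle2 :: "('g, 'm) monoid_scheme \<Rightarrow> ('g \<times> 'g \<Rightarrow> real) \<Rightarrow> bool" where
  "real_cocycle2 G c \<longleftrightarrow> (\<forall>g\<in>carrier G. \<forall>h\<in>carrier G. \<forall>k\<in>carrier G.
     c (h, k) + c (g, h \<otimes>\<^bsub>G\<^esub> k) = c (g \<otimes>\<^bsub>G\<^esub> h, k) + c (g, h))"

lemma eval_chain_boundary:
  assumes "real_cocycle2 G c" "b \<in> boundaries2 G"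
  shows "eval_chain c b = 0"
proof -
  obtain w where w: "b = boundary3 G w" "Poly_Mapping.keys w \<subseteq> carrier G \<times> carrier G \<times> carrier G"
    using assms(2) by (auto simp: boundaries2_def)
  have "eval_chain c b = eval_chain (\<lambda>_. 0) w"
    unfolding w boundary3_def eval_chain_lin_extend
  proof (rule eval_chain_cong)
    fix x assume "x \<in> Poly_Mapping.keys w"
    then obtain g h k where "x = (g, h, k)" "g \<in> carrier G" "h \<in> carrier G" "k \<in> carrier G"
      using w by blast
    then show "eval_chain c (case x of (g, h, k) \<Rightarrow> Poly_Mapping.single (h, k) 1
        - Poly_Mapping.single (g \<otimes>\<^bsub>G\<^esub> h, k) 1 + Poly_Mapping.single (g, h \<otimes>\<^bsub>G\<^esub> k) 1
        - Poly_Mapping.single (g, h) 1) = 0"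
      using assms(1) by (simp add: real_cocycle2_def eval_chain_add eval_chain_diff algebra_simps)
  qed
  then show ?thesis by (simp add: eval_chain_def)
qed

lemma eval_chain_coboundary:
  assumes "\<And>g h. g \<in> carrier G \<Longrightarrow> h \<in> carrier G \<Longrightarrow> c (g, h) = \<phi> h - \<phi> (g \<otimes>\<^bsub>G\<^esub> h) + \<phi> g"
    and "x \<in> cycles2 G"
  shows "eval_chain c x = 0"
proof -
  have "eval_chain c x = eval_chain \<phi> (boundary2 G x)"
    unfolding boundary2_def eval_chain_lin_extend
    by (rule eval_chain_cong)
       (use assms in \<open>auto simp: cycles2_def eval_chain_add eval_chain_diff\<close>)
  then show ?thesis using assms(2) by (simp add: cycles2_def)
qed

section \<open>Amenable classes\<close>

text \<open>Averaging the cocycle identity over its first variable.\<close>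

lemma amenable_coboundary:
  assumes "amenable A" "real_cocycle2 A c"
    and bounded: "\<And>h. h \<in> carrier A \<Longrightarrow> \<exists>B. \<forall>g\<in>carrier A. \<bar>c (g, h)\<bar> \<le> B"
  obtains \<phi> where "\<And>g h. g \<in> carrier A \<Longrightarrow> h \<in> carrier A \<Longrightarrow> c (g, h) = \<phi> h - \<phi> (g \<otimes>\<^bsub>A\<^esub> h) + \<phi> g"
proof -
  interpret group A using assms(1) by (simp add: amenable_def)
  define bdd where "bdd = {f :: 'a \<Rightarrow> real. \<exists>B. \<forall>x\<in>carrier A. \<bar>f x\<bar> \<le> B}"
  obtain \<mu> :: "('a \<Rightarrow> real) \<Rightarrow> real" where
    add: "\<And>f f'. f \<in> bdd \<Longrightarrow> f' \<in> bdd \<Longrightarrow> \<mu> (\<lambda>x. f x + f' x) = \<mu> f + \<mu> f'" and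
    scale: "\<And>f r. f \<in> bdd \<Longrightarrow> \<mu> (\<lambda>x. r * f x) = r * \<mu> f" and
    pos: "\<And>f. f \<in> bdd \<Longrightarrow> (\<And>x. x \<in> carrier A \<Longrightarrow> 0 \<le> f x) \<Longrightarrow> 0 \<le> \<mu> f" and
    one: "\<mu> (\<lambda>x. 1) = 1" and
    inv: "\<And>f a. f \<in> bdd \<Longrightarrow> a \<in> carrier A \<Longrightarrow> \<mu> (\<lambda>x. f (a \<otimes>\<^bsub>A\<^esub> x)) = \<mu> f"
    using assms(1) unfolding amenable_def Let_def bdd_def[symmetric] by blast
  have minus: "(\<lambda>x. - f x) \<in> bdd" "\<mu> (\<lambda>x. - f x) = - \<mu> f" if "f \<in> bdd" for f
    using scale[OF that, of "-1"] that by (auto simp: bdd_def)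
  have bdd_add: "(\<lambda>x. f x + f' x) \<in> bdd" if "f \<in> bdd" "f' \<in> bdd" for f f'
  proof -
    from that obtain B B' where "\<forall>x\<in>carrier A. \<bar>f x\<bar> \<le> B" "\<forall>x\<in>carrier A. \<bar>f' x\<bar> \<le> B'"
      by (auto simp: bdd_def)
    then have "\<forall>x\<in>carrier A. \<bar>f x + f' x\<bar> \<le> B + B'" by force
    then show ?thesis by (auto simp: bdd_def)
  qed
  \<comment> \<open>Positivity applied to \<open>f\<close> and to \<open>- f\<close> squeezes the
    mean to zero. Hence the mean sees only values on the carrier, which is where the cocycle
    identity is available.\<close>
  have null: "\<mu> f = 0" if "\<And>x. x \<in> carrier A \<Longrightarrow> f x = 0" for f
  proof -
    have f: "f \<in> bdd" using that by (auto simp: bdd_def)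
    from pos[OF f] pos[OF minus(1)[OF f]] minus(2)[OF f] that show ?thesis by auto
  qed
  have cong: "\<mu> f = \<mu> f'" if "f \<in> bdd" "f' \<in> bdd" "\<And>x. x \<in> carrier A \<Longrightarrow> f x = f' x" for f f'
  proof -
    have "\<mu> (\<lambda>x. f x + - f' x) = 0" using that by (intro null) auto
    with add[OF that(1) minus(1)[OF that(2)]] minus(2)[OF that(2)] show ?thesis by simp
  qed
  \<comment> \<open>The mean is invariant under left translation, while the cocycle identity
    multiplies the first argument on the right. Substituting the inverse of \<open>x\<close>
    converts one into the other: \<open>inv x \<otimes> h\<close> is the inverse of
    \<open>inv h \<otimes> x\<close>.\<close>
  define F where "F h = (\<lambda>x. c (inv\<^bsub>A\<^esub> x, h))" for h
  have F: "F h \<in> bdd" if "h \<in> carrier A" for h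
    using bounded[OF that] by (auto simp: bdd_def F_def)
  define \<phi> where "\<phi> h = \<mu> (F h)" for h
  show ?thesis
  proof
    fix h k assume hk: "h \<in> carrier A" "k \<in> carrier A"
    let ?T = "\<lambda>x. F k (inv\<^bsub>A\<^esub> h \<otimes>\<^bsub>A\<^esub> x)"
    have T: "?T \<in> bdd"
      using F[OF hk(2)] hk by (auto simp: bdd_def)
    have const: "(\<lambda>x. c (h, k)) \<in> bdd" by (auto simp: bdd_def)
    have "\<mu> (\<lambda>x. c (h, k)) = c (h, k)"
      using scale[of "\<lambda>_. 1" "c (h, k)"] one by (auto simp: bdd_def)
    moreover have "\<mu> (\<lambda>x. c (h, k) + F (h \<otimes>\<^bsub>A\<^esub> k) x) = \<mu> (\<lambda>x. ?T x + F h x)"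
    proof (rule cong)
      fix x assume x: "x \<in> carrier A"
      show "c (h, k) + F (h \<otimes>\<^bsub>A\<^esub> k) x = ?T x + F h x"
        using assms(2) hk x by (simp add: F_def real_cocycle2_def inv_mult_group)
    qed (use bdd_add F T const hk in auto)
    moreover have "\<mu> ?T = \<phi> k"
      using inv[OF F[OF hk(2)], of "inv\<^bsub>A\<^esub> h"] hk by (simp add: \<phi>_def)
    ultimately show "c (h, k) = \<phi> k - \<phi> (h \<otimes>\<^bsub>A\<^esub> k) + \<phi> h"
      using add[OF T F[OF hk(1)]] add[OF const F[of "h \<otimes>\<^bsub>A\<^esub> k"]] hk
      by (simp add: \<phi>_def)
  qed
qed

section \<open>The linear structure on cosets of boundaries\<close>

lemma boundaries2_zero: "0 \<in> boundaries2 G"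
  unfolding boundaries2_def boundary3_def by (rule image_eqI[of _ _ 0]) auto

lemma boundaries2_add:
  assumes "b \<in> boundaries2 G" "b' \<in> boundaries2 G"
  shows "b + b' \<in> boundaries2 G"
proof -
  obtain w w' where "b = boundary3 G w" "Poly_Mapping.keys w \<subseteq> carrier G \<times> carrier G \<times> carrier G"
    "b' = boundary3 G w'" "Poly_Mapping.keys w' \<subseteq> carrier G \<times> carrier G \<times> carrier G"
    using assms by (auto simp: boundaries2_def)
  then show ?thesis unfolding boundaries2_def boundary3_def
    using keys_add[of w w'] by (intro image_eqI[of _ _ "w + w'"]) (auto simp: lin_extend_add)
qed

lemma boundaries2_scale:
  assumes "b \<in> boundaries2 G"
  shows "chain_scale r b \<in> boundaries2 G"
proof -
  obtain w where "b = boundary3 G w" "Poly_Mapping.keys w \<subseteq> carrier G \<times> carrier G \<times> carrier G"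
    using assms by (auto simp: boundaries2_def)
  then show ?thesis unfolding boundaries2_def boundary3_def
    using keys_chain_scale[of r w]
    by (intro image_eqI[of _ _ "chain_scale r w"]) (auto simp: lin_extend_scale)
qed

lemma chain_scale_minus_one: "chain_scale (- 1) x = - x"
  by (rule poly_mapping_eqI) simp

lemma boundaries2_diff:
  assumes "b \<in> boundaries2 G" "b' \<in> boundaries2 G"
  shows "b - b' \<in> boundaries2 G"
  using boundaries2_add[OF assms(1) boundaries2_scale[OF assms(2), of "-1"]]
  by (simp add: chain_scale_minus_one)

lemma mem_homology_class_iff: "x \<in> homology_class G c \<longleftrightarrow> x - c \<in> boundaries2 G"
  by (force simp: homology_class_def algebra_simps)

lemma homology_class_self: "x \<in> homology_class G x"
  by (simp add: mem_homology_class_iff boundaries2_zero)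

lemma homology_class_eq:
  assumes "x - y \<in> boundaries2 G"
  shows "homology_class G x = homology_class G y"
proof (rule Set.set_eqI)
  fix z
  show "z \<in> homology_class G x \<longleftrightarrow> z \<in> homology_class G y"
    using boundaries2_add[of "z - x" G "x - y"] boundaries2_diff[of "z - y" G "x - y"] assms
    by (auto simp: mem_homology_class_iff)
qed

lemma homology_class_add:
  "{x + y | x y. x \<in> homology_class G c \<and> y \<in> homology_class G d} = homology_class G (c + d)"
proof (intro Set.set_eqI iffI)
  fix z assume "z \<in> {x + y | x y. x \<in> homology_class G c \<and> y \<in> homology_class G d}"
  then obtain x y where "z = x + y" "x - c \<in> boundaries2 G" "y - d \<in> boundaries2 G"
    by (auto simp: mem_homology_class_iff)
  then show "z \<in> homology_class G (c + d)"
    using boundaries2_add[of "x - c" G "y - d"] by (simp add: mem_homology_class_iff algebra_simps)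
next
  fix z assume "z \<in> homology_class G (c + d)"
  then have "z = (z - d) + d" "z - d \<in> homology_class G c" "d \<in> homology_class G d"
    by (auto simp: mem_homology_class_iff boundaries2_zero algebra_simps)
  then show "z \<in> {x + y | x y. x \<in> homology_class G c \<and> y \<in> homology_class G d}" by blast
qed

text \<open>\<open>smult\<close> of \<open>H2_real\<close> is a union over all representatives;
  scaling respects boundaries, so the members of the union coincide and it is a single
  coset.\<close>

lemma homology_class_scale:
  "(\<Union>x\<in>homology_class G c. homology_class G (chain_scale r x)) = homology_class G (chain_scale r c)"
proof -
  have "homology_class G (chain_scale r x) = homology_class G (chain_scale r c)"
    if "x \<in> homology_class G c" for x
  proof (rule homology_class_eq)
    have "chain_scale r x - chain_scale r c = chain_scale r (x - c)"
      by (rule poly_mapping_eqI) (simp add: lookup_minus algebra_simps)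
    then show "chain_scale r x - chain_scale r c \<in> boundaries2 G"
      using that boundaries2_scale by (simp add: mem_homology_class_iff)
  qed
  then have "(\<Union>x\<in>homology_class G c. homology_class G (chain_scale r x)) =
      (\<Union>x\<in>homology_class G c. homology_class G (chain_scale r c))"
    by (intro SUP_cong) simp_all
  then show ?thesis using homology_class_self[of c G] by blast
qed

lemma homology_class_zero: "homology_class G 0 = boundaries2 G"
  by (simp add: set_eq_iff mem_homology_class_iff)

lemma cycles2_zero: "0 \<in> cycles2 G"
  by (simp add: cycles2_def boundary2_def)

lemma cycles2_add: "x \<in> cycles2 G \<Longrightarrow> y \<in> cycles2 G \<Longrightarrow> x + y \<in> cycles2 G"
  using keys_add[of x y] by (auto simp: cycles2_def boundary2_def lin_extend_add)

lemma cycles2_scale: "x \<in> cycles2 G \<Longrightarrow> chain_scale r x \<in> cycles2 G"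
  using keys_chain_scale[of r x]
  by (auto simp: cycles2_def boundary2_def lin_extend_scale intro!: poly_mapping_eqI)

lemma cycles2_minus: "x \<in> cycles2 G \<Longrightarrow> - x \<in> cycles2 G"
  using cycles2_scale[of x G "-1"] by (simp add: chain_scale_minus_one)

text \<open>\<open>submodule\<close> includes closure under inverses of the additive monoid; the
  group structure allows them to be identified with classes of negated cycles.\<close>

lemma group_H2_real: "group (add_monoid (H2_real G))"
proof (rule groupI, goal_cases)
  case 1 then show ?case by (auto simp: H2_real_def homology_class_add cycles2_add)
next
  case 2 then show ?case
    using homology_class_zero cycles2_zero by (force simp: H2_real_def)
next
  case (3 x y z)
  then obtain a b c where "x = homology_class G a" "y = homology_class G b" "z = homology_class G c"
    by (auto simp: H2_real_def)
  then show ?case by (simp add: H2_real_def homology_class_add add.assoc)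
next
  case (4 x)
  then obtain a where "x = homology_class G a" by (auto simp: H2_real_def)
  then show ?case
    using homology_class_add[of G 0 a] by (simp add: H2_real_def homology_class_zero)
next
  case (5 x)
  then obtain c where c: "c \<in> cycles2 G" "x = homology_class G c" by (auto simp: H2_real_def)
  show ?case
    using c cycles2_minus by (intro bexI[of _ "homology_class G (- c)"])
      (auto simp: H2_real_def homology_class_add homology_class_zero)
qed

text \<open>The classes killed by \<open>c\<close> form a submodule, so by minimality of
  \<open>H2_am\<close> it suffices that they include the amenable ones. A bound in the first
  argument for each fixed second one survives pullback along any homomorphism, so
  \<open>amenable_coboundary\<close> applies to the pullback whatever the amenable group is.\<close>

lemma property_star_eval_chain_eq_0:
  assumes "group G" "property_star TYPE('a) G" "real_cocycle2 G c"
    and bounded: "\<And>h. h \<in> carrier G \<Longrightarrow> \<exists>B. \<forall>g\<in>carrier G. \<bar>c (g, h)\<bar> \<le> B"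
    and "x \<in> cycles2 G"
  shows "eval_chain c x = 0"
proof -
  interpret H: group "add_monoid (H2_real G)" by (rule group_H2_real)
  interpret G: group G by fact
  \<comment> \<open>\<open>V\<close> imposes the condition on every representative, which makes it
    independent of choices; \<open>eval_class\<close> shows that one representative decides, as
    cocycles vanish on boundaries.\<close>
  define V where "V = {\<alpha> \<in> carrier (H2_real G). \<forall>x\<in>\<alpha>. eval_chain c x = 0}"
  have eval_class: "(\<forall>x\<in>homology_class G y. eval_chain c x = 0) \<longleftrightarrow> eval_chain c y = 0" for y
    using eval_chain_boundary[OF assms(3)] homology_class_self[of y G]
    by (force simp: homology_class_def eval_chain_add)
  have V: "V = homology_class G ` {y \<in> cycles2 G. eval_chain c y = 0}"
    using eval_class by (auto simp: V_def H2_real_def)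
  have "submodule V real_ring (H2_real G)"
  proof (intro submodule.intro H.subgroupI submodule_axioms.intro, goal_cases)
    case 1 then show ?case by (auto simp: V H2_real_def)
  next
    case 2 then show ?case using cycles2_zero[of G] by (auto simp: V intro: exI[of _ 0])
  next
    case (3 a)
    then obtain y where y: "y \<in> cycles2 G" "eval_chain c y = 0" "a = homology_class G y"
      by (auto simp: V)
    have "inv\<^bsub>add_monoid (H2_real G)\<^esub> a = homology_class G (- y)"
      using y cycles2_minus[OF y(1)]
      by (intro H.inv_equality) (auto simp: H2_real_def homology_class_add homology_class_zero)
    then show ?case using y cycles2_minus[OF y(1)] by (auto simp: V eval_chain_minus)
  next
    case 4 then show ?case
      by (auto simp: V H2_real_def homology_class_add eval_chain_add intro!: imageI cycles2_add)
  next
    case 5 then show ?case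
      by (auto simp: V H2_real_def homology_class_scale eval_chain_scale intro!: imageI cycles2_scale)
  qed
  moreover have "\<alpha> \<in> V" if am: "amenable_class TYPE('a) G \<alpha>" for \<alpha>
  proof -
    obtain A :: "'a monoid" and f U where A: "amenable A" "f \<in> hom A G"
        "U \<in> carrier (H2_real A)" and \<alpha>: "\<alpha> \<in> carrier (H2_real G)" "\<alpha> = H2_real_map G f U"
      using am unfolding amenable_class_def by blast
    define d where "d = (\<lambda>(a, b). c (f a, f b))"
    have f: "f a \<in> carrier G" "f (a \<otimes>\<^bsub>A\<^esub> b) = f a \<otimes>\<^bsub>G\<^esub> f b" if "a \<in> carrier A" "b \<in> carrier A" for a b
      using A(2) that by (auto simp: hom_def)
    have d: "real_cocycle2 A d"
      using assms(3) by (simp add: real_cocycle2_def d_def f)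
    have "\<exists>B. \<forall>g\<in>carrier A. \<bar>d (g, h)\<bar> \<le> B" if h: "h \<in> carrier A" for h
    proof -
      obtain B where "\<forall>g\<in>carrier G. \<bar>c (g, f h)\<bar> \<le> B" using bounded[OF f(1)[OF h h]] by blast
      then show ?thesis by (intro exI[of _ B]) (auto simp: d_def f(1))
    qed
    then obtain \<phi> where \<phi>: "\<And>g h. g \<in> carrier A \<Longrightarrow> h \<in> carrier A \<Longrightarrow> d (g, h) = \<phi> h - \<phi> (g \<otimes>\<^bsub>A\<^esub> h) + \<phi> g"
      using amenable_coboundary[OF A(1) d] by metis
    obtain y where y: "y \<in> cycles2 A" "U = homology_class A y"
      using A(3) by (auto simp: H2_real_def)
    have "eval_chain c z = 0" if z: "z \<in> \<alpha>" for z
    proof -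
      obtain u where u: "u \<in> homology_class A y" "z \<in> homology_class G (chain_map f u)"
        using z \<alpha> y unfolding H2_real_map_def by blast
      have "eval_chain d y = 0" by (rule eval_chain_coboundary[OF \<phi> y(1)])
      then have "eval_chain d u = 0"
        using u(1) eval_chain_boundary[OF d] by (auto simp: homology_class_def eval_chain_add)
      moreover have "eval_chain c (chain_map f u) = eval_chain d u"
        unfolding chain_map_def eval_chain_lin_extend d_def
        by (intro eval_chain_cong) auto
      ultimately show ?thesis using u(2) eval_class[of "chain_map f u"] by auto
    qed
    then show ?thesis using \<alpha> by (auto simp: V_def)
  qed
  ultimately have "H2_am TYPE('a) G \<subseteq> V" by (auto simp: H2_am_def)
  then have "homology_class G x \<in> V"
    using assms(2,5) by (auto simp: property_star_def H2_real_def)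
  then show ?thesis using eval_class by (simp add: V_def)
qed

lemma property_star_coboundary:
  assumes "group G" "property_star TYPE('a) G" "real_cocycle2 G c"
    and "\<And>h. h \<in> carrier G \<Longrightarrow> \<exists>B. \<forall>g\<in>carrier G. \<bar>c (g, h)\<bar> \<le> B"
  obtains \<phi> where "\<And>g h. g \<in> carrier G \<Longrightarrow> h \<in> carrier G \<Longrightarrow> c (g, h) = \<phi> h - \<phi> (g \<otimes>\<^bsub>G\<^esub> h) + \<phi> g"
proof (rule eval_chain_eq_0_on_cycles_imp_coboundary)
  show "eval_chain c x = 0" if "x \<in> cycles2 G" for x
    using assms that by (rule property_star_eval_chain_eq_0)
qed (rule that)

section \<open>Finitely generated abelian groups\<close>

text \<open>By commutativity the products \<open>x \<otimes> b [^] k\<close> already form a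
  subgroup. The inductions over generators below all rest on this normal form.\<close>

lemma (in comm_group) generate_insert_subset:
  assumes "subgroup A G" "b \<in> carrier G"
  shows "generate G (insert b A) \<subseteq> {x \<otimes> b [^] k | x k. x \<in> A \<and> k \<in> (UNIV :: int set)}"
proof (rule generate_subgroup_incl)
  interpret A: subgroup A G by fact
  let ?H = "{x \<otimes> b [^] k | x k. x \<in> A \<and> k \<in> (UNIV :: int set)}"
  show "insert b A \<subseteq> ?H"
  proof
    fix a assume "a \<in> insert b A"
    then have "a = \<one> \<otimes> b [^] (1::int) \<or> a \<in> A \<and> a = a \<otimes> b [^] (0::int)"
      using assms(2) by auto
    then show "a \<in> ?H" using A.one_closed by blast
  qed
  show "subgroup ?H G"
  proof (rule subgroupI)
    show "?H \<noteq> {}" using A.one_closed by blast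
  next
    fix a assume "a \<in> ?H"
    then obtain x and k :: int where "x \<in> A" "a = x \<otimes> b [^] k" by blast
    then have "inv x \<in> A" "inv a = inv x \<otimes> b [^] (- k)"
      using assms(2) by (auto simp: inv_mult int_pow_neg)
    then show "inv a \<in> ?H" by blast
  next
    fix a a' assume "a \<in> ?H" "a' \<in> ?H"
    then obtain x x' and k k' :: int where
      "x \<in> A" "a = x \<otimes> b [^] k" "x' \<in> A" "a' = x' \<otimes> b [^] k'" by blast
    then have "x \<otimes> x' \<in> A" "a \<otimes> a' = (x \<otimes> x') \<otimes> b [^] (k + k')"
      using assms(2) by (auto simp: m_ac int_pow_mult[symmetric] add.commute)
    then show "a \<otimes> a' \<in> ?H" by blast
  qed (use assms in auto)
qed

lemma (in comm_group) mem_generate_insertE: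
  assumes "S \<subseteq> carrier G" "b \<in> carrier G" "a \<in> generate G (insert b S)"
  obtains x and k :: int where "x \<in> generate G S" "a = x \<otimes> b [^] k"
proof -
  have "insert b S \<subseteq> insert b (generate G S)" by (auto intro: generate.incl)
  then have "a \<in> generate G (insert b (generate G S))" using assms(3) mono_generate by blast
  with generate_insert_subset[OF generate_is_subgroup assms(2)] assms(1) show ?thesis
    using that by blast
qed

text \<open>The quotient by n-th powers is finite. In the induction the exponent of the new
  generator is divided by \<open>n\<close>: the quotient is absorbed into \<open>w\<close>, and the
  remainder leaves \<open>n\<close> possibilities for \<open>f\<close>.\<close>

lemma (in comm_group) finite_power_representatives:
  fixes n :: nat
  assumes "finitely_generated G" "n > 0"
  obtains F where "finite F" "F \<subseteq> carrier G" "\<And>a. a \<in> carrier G \<Longrightarrow> \<exists>w\<in>carrier G. \<exists>f\<in>F. a = w [^] n \<otimes> f"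
proof -
  have "\<exists>F. finite F \<and> F \<subseteq> carrier G \<and> (\<forall>a\<in>generate G S. \<exists>w\<in>carrier G. \<exists>f\<in>F. a = w [^] n \<otimes> f)"
    if "finite S" "S \<subseteq> carrier G" for S
    using that
  proof (induction S)
    case empty
    have "\<one> = \<one> [^] n \<otimes> \<one>" by simp
    then show ?case by (intro exI[of _ "{\<one>}"]) (auto simp: generate_empty intro!: bexI[of _ \<one>])
  next
    case (insert b S)
    then obtain F where F: "finite F" "F \<subseteq> carrier G"
      "\<forall>a\<in>generate G S. \<exists>w\<in>carrier G. \<exists>f\<in>F. a = w [^] n \<otimes> f" by auto
    have b: "b \<in> carrier G" and S: "S \<subseteq> carrier G" using insert.prems by auto
    show ?case
    proof (intro exI[of _ "(\<lambda>(f, r). f \<otimes> b [^] int r) ` (F \<times> {..<n})"] conjI ballI)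
      fix a assume "a \<in> generate G (insert b S)"
      from mem_generate_insertE[OF S b this]
      obtain x and k :: int where x: "x \<in> generate G S" "a = x \<otimes> b [^] k" .
      with F obtain w f where wf: "w \<in> carrier G" "f \<in> F" "x = w [^] n \<otimes> f" by blast
      define r where "r = nat (k mod int n)"
      have r: "r < n" "k = (k div int n) * int n + int r"
        using assms(2) by (auto simp: r_def nat_less_iff)
      have "b [^] k = (b [^] (k div int n)) [^] n \<otimes> b [^] int r"
      proof -
        have "b [^] k = b [^] (k div int n * int n) \<otimes> b [^] int r"
          using int_pow_mult[OF b, of "k div int n * int n" "int r"] r(2) by simp
        then show ?thesis using b by (simp add: int_pow_pow flip: int_pow_int)
      qed
      moreover have "f \<in> carrier G" using wf F by blast
      ultimately have "a = (w \<otimes> b [^] (k div int n)) [^] n \<otimes> (f \<otimes> b [^] int r)"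
        using x wf b by (simp add: nat_pow_distrib m_ac)
      then show "\<exists>w\<in>carrier G. \<exists>f\<in>(\<lambda>(f, r). f \<otimes> b [^] int r) ` (F \<times> {..<n}). a = w [^] n \<otimes> f"
        using wf r b by (intro bexI[of _ "w \<otimes> b [^] (k div int n)"] bexI[of _ "f \<otimes> b [^] int r"]) auto
    qed (use F b in auto)
  qed
  moreover obtain S where "finite S" "S \<subseteq> carrier G" "generate G S = carrier G"
    using assms(1) by (auto simp: finitely_generated_def)
  ultimately show ?thesis using that by metis
qed

text \<open>Induction on generators. Two torsion elements in one coset of the smaller subgroup
  differ by a torsion element of that subgroup, so each coset (\<open>C k\<close> below) contributes
  finitely many. Few cosets can contribute: if a positive power \<open>b [^] m\<close> lies in the
  subgroup, exponents modulo \<open>m\<close> suffice, and otherwise a torsion element has exponent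
  0, since a power of it would put a power of \<open>b\<close> into the subgroup.\<close>

lemma (in comm_group) finite_torsion:
  assumes "finitely_generated G"
  shows "finite {a \<in> carrier G. \<exists>n::nat. n > 0 \<and> a [^] n = \<one>}"
proof -
  let ?T = "\<lambda>H. {a \<in> H. \<exists>n::nat. n > 0 \<and> a [^] n = \<one>}"
  have T: "finite (?T (generate G S))" if "finite S" "S \<subseteq> carrier G" for S
    using that
  proof (induction S)
    case empty
    show ?case by (simp add: generate_empty)
  next
    case (insert b S)
    then have IH: "finite (?T (generate G S))" and b: "b \<in> carrier G" and S: "S \<subseteq> carrier G" by auto
    interpret H: subgroup "generate G S" G using S by (rule generate_is_subgroup)
    define C where "C k = {x \<otimes> b [^] k | x. x \<in> generate G S} \<inter> ?T (carrier G)" for k :: int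
    have C: "finite (C k)" for k
    proof (cases "C k = {}")
      case False
      then obtain t where t: "t \<in> C k" by blast
      have "C k \<subseteq> (\<lambda>x. x \<otimes> t) ` ?T (generate G S)"
      proof
        fix u assume u: "u \<in> C k"
        obtain x y where xy: "x \<in> generate G S" "u = x \<otimes> b [^] k" "y \<in> generate G S" "t = y \<otimes> b [^] k"
          using t u by (auto simp: C_def)
        obtain m n :: nat where mn: "m > 0" "u [^] m = \<one>" "n > 0" "t [^] n = \<one>"
          using t u by (auto simp: C_def)
        have ut: "u \<in> carrier G" "t \<in> carrier G" using xy b by auto
        have eq: "u \<otimes> inv t = x \<otimes> inv y"
          using xy b by (simp add: inv_mult m_ac)
        have "(u \<otimes> inv t) [^] (m * n) = (u [^] m) [^] n \<otimes> inv ((t [^] n) [^] m)"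
          using ut by (simp add: nat_pow_distrib nat_pow_pow nat_pow_inv mult.commute)
        then have "(u \<otimes> inv t) [^] (m * n) = \<one>" using mn by simp
        then have "u \<otimes> inv t \<in> ?T (generate G S)"
          using mn eq xy by (auto intro!: exI[of _ "m * n"])
        moreover have "u = (u \<otimes> inv t) \<otimes> t" using ut by (simp add: m_assoc)
        ultimately show "u \<in> (\<lambda>x. x \<otimes> t) ` ?T (generate G S)" by blast
      qed
      then show ?thesis using IH finite_surj by blast
    qed auto
    show ?case
    proof (cases "\<exists>m::nat. m > 0 \<and> b [^] m \<in> generate G S")
      case True
      then obtain m :: nat where m: "m > 0" "b [^] m \<in> generate G S" by blast
      have "?T (generate G (insert b S)) \<subseteq> (\<Union>k\<in>{0..<int m}. C k)"
      proof
        fix a assume a: "a \<in> ?T (generate G (insert b S))"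
        then obtain x and k :: int where x: "x \<in> generate G S" "a = x \<otimes> b [^] k"
          using mem_generate_insertE[OF S b] by blast
        have "b [^] k = b [^] (int m * (k div int m)) \<otimes> b [^] (k mod int m)"
          using int_pow_mult[OF b, of "int m * (k div int m)" "k mod int m"] by simp
        then have bk: "b [^] k = (b [^] m) [^] (k div int m) \<otimes> b [^] (k mod int m)"
          using b by (simp add: int_pow_pow flip: int_pow_int)
        have bm: "(b [^] m) [^] (k div int m) \<in> generate G S"
          using m(2) H.subgroup_axioms by (rule subgroup_int_pow_closed[rotated])
        then have "a = (x \<otimes> (b [^] m) [^] (k div int m)) \<otimes> b [^] (k mod int m)"
            "x \<otimes> (b [^] m) [^] (k div int m) \<in> generate G S" "a \<in> carrier G"
          using x b by (auto simp: bk m_assoc)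
        then have "a \<in> C (k mod int m)" using a by (auto simp: C_def)
        then show "a \<in> (\<Union>k\<in>{0..<int m}. C k)" using m(1) by (intro UN_I[of "k mod int m"]) auto
      qed
      then show ?thesis using C finite_subset by blast
    next
      case False
      have "?T (generate G (insert b S)) \<subseteq> C 0"
      proof
        fix a assume a: "a \<in> ?T (generate G (insert b S))"
        then obtain x and k :: int where x: "x \<in> generate G S" "a = x \<otimes> b [^] k"
          using mem_generate_insertE[OF S b] by blast
        obtain n :: nat where n: "n > 0" "a [^] n = \<one>" using a by blast
        have xc: "x \<in> carrier G" using x by simp
        have bkn: "b [^] (k * int n) \<in> generate G S"
        proof -
          have "x [^] n \<otimes> b [^] (k * int n) = \<one>"
            using n(2) x b xc by (simp add: nat_pow_distrib int_pow_pow[symmetric] int_pow_int)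
          then have "b [^] (k * int n) = inv (x [^] n)"
            using b xc by (metis inv_equality inv_inv int_pow_closed nat_pow_closed m_comm)
          moreover have "x [^] n \<in> generate G S"
            using subgroup_int_pow_closed[OF H.subgroup_axioms x(1), of "int n"] by (simp add: int_pow_int)
          ultimately show ?thesis by simp
        qed
        have "k = 0"
        proof (rule ccontr)
          assume "k \<noteq> 0"
          have "b [^] nat \<bar>k * int n\<bar> \<in> generate G S"
          proof (cases "k * int n \<ge> 0")
            case True
            then show ?thesis using bkn by (simp flip: int_pow_int)
          next
            case False
            then have "b [^] nat \<bar>k * int n\<bar> = inv (b [^] (k * int n))"
              using b by (simp flip: int_pow_int int_pow_neg)
            then show ?thesis using bkn by simp
          qed
          moreover have "nat \<bar>k * int n\<bar> > 0" using \<open>k \<noteq> 0\<close> n(1) by simp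
          ultimately show False using False by blast
        qed
        then have "a \<in> {x \<otimes> b [^] (0::int) | x. x \<in> generate G S}" using x by blast
        moreover have "a \<in> ?T (carrier G)" using a x b xc by auto
        ultimately show "a \<in> C 0" unfolding C_def by (rule IntI)
      qed
      then show ?thesis using C finite_subset by blast
    qed
  qed
  obtain S where S: "finite S" "S \<subseteq> carrier G" "generate G S = carrier G"
    using assms by (auto simp: finitely_generated_def)
  show ?thesis using T[OF S(1,2)] S(3) by simp
qed

text \<open>With finitely many torsion elements, the product of one annihilating exponent for each
  works for all; \<open>ord\<close> is any such exponent, minimal or not.\<close>

lemma (in comm_group) torsion_exponent:
  assumes "finitely_generated G"
  obtains N :: nat where "N > 0"
    "\<And>a (n::nat). a \<in> carrier G \<Longrightarrow> n > 0 \<Longrightarrow> a [^] n = \<one> \<Longrightarrow> a [^] N = \<one>"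
proof -
  define T where "T = {a \<in> carrier G. \<exists>n::nat. n > 0 \<and> a [^] n = \<one>}"
  have "finite T" unfolding T_def by (rule finite_torsion[OF assms])
  have "\<forall>a\<in>T. \<exists>n::nat. n > 0 \<and> a [^] n = \<one>" by (auto simp: T_def)
  then obtain ord where ord: "\<And>a. a \<in> T \<Longrightarrow> (ord a :: nat) > 0 \<and> a [^] ord a = \<one>" by metis
  show ?thesis
  proof
    show "(\<Prod>a\<in>T. ord a) > 0" using ord by (intro prod_pos) auto
    fix a and n :: nat assume "a \<in> carrier G" "n > 0" "a [^] n = \<one>"
    then have a: "a \<in> T" "a \<in> carrier G" by (auto simp: T_def)
    with \<open>finite T\<close> obtain m where "(\<Prod>a\<in>T. ord a) = ord a * m" by (metis dvd_prodI dvdE)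
    then show "a [^] (\<Prod>a\<in>T. ord a) = \<one>" using ord[OF a(1)] a(2) by (simp flip: nat_pow_pow)
  qed
qed

text \<open>A nonempty fibre of the power map lies in a translate of the torsion subgroup. This
  recovers finitely many \<open>z\<close> from finitely many values of
  \<open>z [^] n\<close>.\<close>

lemma (in comm_group) finite_nat_pow_eq:
  assumes "finitely_generated G" "(n::nat) > 0" "finite B"
  shows "finite {a \<in> carrier G. a [^] n \<in> B}"
proof -
  have "finite {a \<in> carrier G. a [^] n = c}" for c
  proof (cases "\<exists>a\<in>carrier G. a [^] n = c")
    case True
    then obtain a where a: "a \<in> carrier G" "a [^] n = c" by blast
    have "{b \<in> carrier G. b [^] n = c} \<subseteq> (\<lambda>t. t \<otimes> a) ` {t \<in> carrier G. \<exists>n::nat. n > 0 \<and> t [^] n = \<one>}"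
    proof
      fix b assume b: "b \<in> {b \<in> carrier G. b [^] n = c}"
      then have "(b \<otimes> inv a) [^] n = \<one>"
        using a by (auto simp: nat_pow_distrib nat_pow_inv)
      moreover have "b = (b \<otimes> inv a) \<otimes> a" using a b by (simp add: m_assoc)
      ultimately show "b \<in> (\<lambda>t. t \<otimes> a) ` {t \<in> carrier G. \<exists>n::nat. n > 0 \<and> t [^] n = \<one>}"
        using a b assms(2) by blast
    qed
    then show ?thesis using finite_torsion[OF assms(1)] finite_surj by blast
  next
    case False
    then have "{a \<in> carrier G. a [^] n = c} = {}" by blast
    then show ?thesis by (rule ssubst) simp
  qed
  moreover have "{a \<in> carrier G. a [^] n \<in> B} = (\<Union>c\<in>B. {a \<in> carrier G. a [^] n = c})" by blast
  ultimately show ?thesis using assms(3) by simp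
qed

text \<open>Extending \<open>h\<close> by \<open>b\<close> requires taking a power, since some power of \<open>b\<close> may already lie in \<open>A\<close>.\<close>

lemma (in comm_group) extend_hom_step:
  assumes A: "subgroup A G" and b: "b \<in> carrier G" and W: "comm_group W"
    and h: "h \<in> hom (G\<lparr>carrier := A\<rparr>) W"
  obtains n :: nat and h' where "n > 0" "h' \<in> hom (G\<lparr>carrier := generate G (insert b A)\<rparr>) W"
    "\<And>a. a \<in> A \<Longrightarrow> h' a = h a [^]\<^bsub>W\<^esub> n"
proof -
  interpret W: comm_group W by fact
  interpret A: subgroup A G by fact
  interpret h: group_hom "G\<lparr>carrier := A\<rparr>" W h
    using A.subgroup_is_group[OF is_group] W.is_group h by (simp add: group_hom_def group_hom_axioms_def)
  have hc: "h x \<in> carrier W" if "x \<in> A" for x using h.hom_closed that by simp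
  have hm: "h (x \<otimes> y) = h x \<otimes>\<^bsub>W\<^esub> h y" if "x \<in> A" "y \<in> A" for x y
    using h.hom_mult[of x y] that by simp
  have hp: "h (x [^] k) = h x [^]\<^bsub>W\<^esub> k" if "x \<in> A" for x and k :: int
    using h.hom_int_pow[of x k] that int_pow_consistent[OF A that] by simp
  \<comment> \<open>\<open>c\<close> is the prospective value at \<open>b\<close>. The condition
    says that it agrees with the n-th power of \<open>h\<close> wherever a power of \<open>b\<close>
    already lies in \<open>A\<close>. If \<open>b [^] m\<close> is in \<open>A\<close>, take
    \<open>n = m\<close> and \<open>c = h (b [^] m)\<close>; otherwise only exponent 0 occurs, and
    \<open>n = 1\<close> with trivial \<open>c\<close> works.\<close>
  have "\<exists>n c. (n::nat) > 0 \<and> c \<in> carrier W \<and> (\<forall>x\<in>A. \<forall>k::int. x = b [^] k \<longrightarrow> h x [^]\<^bsub>W\<^esub> n = c [^]\<^bsub>W\<^esub> k)"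
  proof (cases "\<exists>m::nat. m > 0 \<and> b [^] m \<in> A")
    case True
    then obtain m :: nat where m: "m > 0" "b [^] m \<in> A" by blast
    have "h x [^]\<^bsub>W\<^esub> m = h (b [^] m) [^]\<^bsub>W\<^esub> k" if "x \<in> A" "x = b [^] k" for x and k :: int
    proof -
      have "h x [^]\<^bsub>W\<^esub> m = h (x [^] int m)" using hp[OF that(1), of "int m"] by (simp add: int_pow_int)
      also have "x [^] int m = (b [^] m) [^] k"
        using b that by (simp add: int_pow_pow mult.commute flip: int_pow_int)
      finally show ?thesis using hp[OF m(2)] by simp
    qed
    then show ?thesis using m hc by blast
  next
    case False
    then have no_power: "b [^] m \<notin> A" if "m > 0" for m :: nat using that by metis
    have "h x [^]\<^bsub>W\<^esub> (1::nat) = \<one>\<^bsub>W\<^esub> [^]\<^bsub>W\<^esub> k" if "x \<in> A" "x = b [^] k" for x and k :: int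
    proof -
      have "b [^] nat \<bar>k\<bar> \<in> A"
      proof (cases "k \<ge> 0")
        case True
        then show ?thesis using that by (simp flip: int_pow_int)
      next
        case False
        then have "b [^] nat \<bar>k\<bar> = inv (b [^] k)"
          using b by (simp flip: int_pow_int int_pow_neg)
        then show ?thesis using that by simp
      qed
      then have "\<not> nat \<bar>k\<bar> > 0" using no_power by metis
      then have "k = 0" by simp
      then show ?thesis using that h.hom_one by simp
    qed
    then show ?thesis using W.one_closed by (meson zero_less_one)
  qed
  then obtain n :: nat and c where n: "n > 0" and c: "c \<in> carrier W"
    and nc: "\<And>x k. x \<in> A \<Longrightarrow> x = b [^] (k::int) \<Longrightarrow> h x [^]\<^bsub>W\<^esub> n = c [^]\<^bsub>W\<^esub> k" by blast
  define rep where "rep y = (SOME (x, k). x \<in> A \<and> y = x \<otimes> b [^] (k::int))" for y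
  define h' where "h' y = (case rep y of (x, k) \<Rightarrow> h x [^]\<^bsub>W\<^esub> n \<otimes>\<^bsub>W\<^esub> c [^]\<^bsub>W\<^esub> k)" for y
  \<comment> \<open>Independence of the chosen representation: two of them differ by
    \<open>inv x' \<otimes> x\<close>, an element of \<open>A\<close> that is also a power of
    \<open>b\<close>, so the compatibility \<open>nc\<close> applies to it.\<close>
  have h': "h' (x \<otimes> b [^] k) = h x [^]\<^bsub>W\<^esub> n \<otimes>\<^bsub>W\<^esub> c [^]\<^bsub>W\<^esub> k" if x: "x \<in> A" for x and k :: int
  proof -
    obtain x' k' where r: "rep (x \<otimes> b [^] k) = (x', k')" by (meson surj_pair)
    have x': "x' \<in> A \<and> x \<otimes> b [^] k = x' \<otimes> b [^] k'"
      using someI[of "\<lambda>(x', k'). x' \<in> A \<and> x \<otimes> b [^] k = x' \<otimes> b [^] (k'::int)" "(x, k)"] x r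
      by (simp add: rep_def)
    have xc: "x \<in> carrier G" "x' \<in> carrier G" using x x' by auto
    have "inv x' \<otimes> x \<otimes> b [^] k = inv x' \<otimes> (x' \<otimes> b [^] k')"
      using x' xc b by (simp add: m_assoc)
    also have "\<dots> = b [^] k'" using xc b by (simp add: m_assoc[symmetric])
    finally have "inv x' \<otimes> x \<otimes> b [^] k \<otimes> inv (b [^] k) = b [^] (k' - k)"
      using b by (simp add: int_pow_diff)
    then have "inv x' \<otimes> x = b [^] (k' - k)" using xc b by (simp add: m_assoc)
    then have "h (inv x' \<otimes> x) [^]\<^bsub>W\<^esub> n = c [^]\<^bsub>W\<^esub> (k' - k)"
      using x x' by (intro nc A.m_closed A.m_inv_closed) simp_all
    then have e: "c [^]\<^bsub>W\<^esub> (k' - k) = h (inv x' \<otimes> x) [^]\<^bsub>W\<^esub> n" by simp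
    have "h x = h x' \<otimes>\<^bsub>W\<^esub> h (inv x' \<otimes> x)"
      using x x' by (subst hm[symmetric]) (auto simp: m_assoc[symmetric])
    then have "h x [^]\<^bsub>W\<^esub> n \<otimes>\<^bsub>W\<^esub> c [^]\<^bsub>W\<^esub> k = h x' [^]\<^bsub>W\<^esub> n \<otimes>\<^bsub>W\<^esub> (c [^]\<^bsub>W\<^esub> (k' - k) \<otimes>\<^bsub>W\<^esub> c [^]\<^bsub>W\<^esub> k)"
      using x x' c hc by (simp add: W.nat_pow_distrib W.m_assoc e)
    also have "c [^]\<^bsub>W\<^esub> (k' - k) \<otimes>\<^bsub>W\<^esub> c [^]\<^bsub>W\<^esub> k = c [^]\<^bsub>W\<^esub> k'"
      using c by (simp add: W.int_pow_mult[symmetric])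
    finally show ?thesis by (simp add: h'_def r)
  qed
  show ?thesis
  proof
    show "h' \<in> hom (G\<lparr>carrier := generate G (insert b A)\<rparr>) W"
    proof (rule homI)
      fix y assume "y \<in> carrier (G\<lparr>carrier := generate G (insert b A)\<rparr>)"
      then obtain x and k :: int where x: "x \<in> A" "y = x \<otimes> b [^] k"
        using generate_insert_subset[OF A b] by auto
      then show "h' y \<in> carrier W" using h' hc c by simp
      fix y' assume "y' \<in> carrier (G\<lparr>carrier := generate G (insert b A)\<rparr>)"
      then obtain x' and k' :: int where x': "x' \<in> A" "y' = x' \<otimes> b [^] k'"
        using generate_insert_subset[OF A b] by auto
      have "y \<otimes> y' = (x \<otimes> x') \<otimes> b [^] (k + k')"
        using x x' b by (simp add: m_ac int_pow_mult[symmetric] add.commute)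
      then have "h' (y \<otimes> y') = h (x \<otimes> x') [^]\<^bsub>W\<^esub> n \<otimes>\<^bsub>W\<^esub> c [^]\<^bsub>W\<^esub> (k + k')"
        using x(1) x'(1) by (simp only: h' A.m_closed)
      also have "\<dots> = h' y \<otimes>\<^bsub>W\<^esub> h' y'"
        using x x' c hc by (simp add: h' hm W.nat_pow_distrib W.m_ac W.int_pow_mult)
      finally show "h' (y \<otimes>\<^bsub>G\<lparr>carrier := generate G (insert b A)\<rparr>\<^esub> y') = h' y \<otimes>\<^bsub>W\<^esub> h' y'"
        by simp
    qed
    show "h' a = h a [^]\<^bsub>W\<^esub> n" if "a \<in> A" for a
      using h'[OF that, of 0] that hc by simp
  qed (rule n)
qed

text \<open>Each generator adjoined to \<open>A\<close> costs one more power. The exponents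
  multiply, and finite generation keeps the product finite.\<close>

lemma (in comm_group) extend_hom_up_to_power:
  assumes "finitely_generated G" "subgroup A G" "comm_group W" "h \<in> hom (G\<lparr>carrier := A\<rparr>) W"
  obtains n :: nat and h' where "n > 0" "h' \<in> hom G W" "\<And>a. a \<in> A \<Longrightarrow> h' a = h a [^]\<^bsub>W\<^esub> n"
proof -
  interpret W: comm_group W by fact
  have hc: "h a \<in> carrier W" if "a \<in> A" for a using assms(4) that by (auto simp: hom_def)
  have Ac: "A \<subseteq> carrier G" using assms(2) by (rule subgroup.subset)
  have ext: "\<exists>n h'. (n::nat) > 0 \<and> h' \<in> hom (G\<lparr>carrier := generate G (A \<union> S)\<rparr>) W \<and> (\<forall>a\<in>A. h' a = h a [^]\<^bsub>W\<^esub> n)"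
    if "finite S" "S \<subseteq> carrier G" for S
    using that
  proof (induction S)
    case empty
    have "generate G A = A"
      using generate_subgroup_incl[OF subset_refl assms(2)] by (auto intro: generate.incl)
    then show ?case using assms(4) hc by (intro exI[of _ "1::nat"] exI[of _ h]) auto
  next
    case (insert b S)
    then obtain n :: nat and h' where h': "n > 0" "h' \<in> hom (G\<lparr>carrier := generate G (A \<union> S)\<rparr>) W"
      "\<And>a. a \<in> A \<Longrightarrow> h' a = h a [^]\<^bsub>W\<^esub> n" by auto
    have b: "b \<in> carrier G" and S: "A \<union> S \<subseteq> carrier G" using insert.prems Ac by auto
    obtain m :: nat and h'' where h'': "m > 0"
      "h'' \<in> hom (G\<lparr>carrier := generate G (insert b (generate G (A \<union> S)))\<rparr>) W"
      "\<And>a. a \<in> generate G (A \<union> S) \<Longrightarrow> h'' a = h' a [^]\<^bsub>W\<^esub> m"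
      using extend_hom_step[OF generate_is_subgroup[OF S] b assms(3) h'(2)] by metis
    have "A \<union> insert b S \<subseteq> insert b (generate G (A \<union> S))" by (auto intro: generate.incl)
    from mono_generate[OF this] have "h'' \<in> hom (G\<lparr>carrier := generate G (A \<union> insert b S)\<rparr>) W"
      using h''(2) by (auto simp: hom_def Pi_iff subset_iff)
    moreover have "h'' a = h a [^]\<^bsub>W\<^esub> (n * m)" if "a \<in> A" for a
      using h''(3)[of a] h'(3)[OF that] that hc by (simp add: W.nat_pow_pow generate.incl)
    ultimately show ?case using h' h'' by (intro exI[of _ "n * m"] exI[of _ h'']) auto
  qed
  obtain S where S: "finite S" "S \<subseteq> carrier G" "generate G S = carrier G"
    using assms(1) by (auto simp: finitely_generated_def)
  have "generate G (A \<union> S) = carrier G"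
    using S generate_incl[of "A \<union> S"] mono_generate[of S "A \<union> S"] Ac by auto
  then have "G\<lparr>carrier := generate G (A \<union> S)\<rparr> = G" by simp
  then show ?thesis using ext[OF S(1,2)] that by auto
qed

text \<open>On the infinite cyclic group generated by \<open>z\<close> the exponent is a
  homomorphism to the integers. Some positive multiple of it extends, and takes that positive
  multiple as value at \<open>z\<close>.\<close>

lemma (in comm_group) nontorsion_character:
  assumes "finitely_generated G" "z \<in> carrier G" "\<And>n::nat. n > 0 \<Longrightarrow> z [^] n \<noteq> \<one>"
  obtains \<chi> where "\<chi> \<in> hom G integer_group" "\<chi> z \<noteq> 0"
proof -
  have inj: "k = l" if "z [^] k = z [^] l" for k l :: int
  proof (rule ccontr)
    assume "k \<noteq> l"
    have "z [^] (k - l) = \<one>" "z [^] (l - k) = \<one>"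
      using that assms(2) by (auto simp: int_pow_diff)
    then have "z [^] nat \<bar>k - l\<bar> = \<one>"
      by (cases "k \<ge> l") (auto simp flip: int_pow_int)
    then show False using assms(3)[of "nat \<bar>k - l\<bar>"] \<open>k \<noteq> l\<close> by simp
  qed
  define h where "h a = (THE k. a = z [^] (k::int))" for a
  have h: "h (z [^] k) = k" for k :: int
    unfolding h_def by (rule the_equality) (use inj in auto)
  have "h \<in> hom (G\<lparr>carrier := generate G {z}\<rparr>) integer_group"
    using assms(2) by (auto simp: hom_def generate_pow h int_pow_mult[symmetric])
  from extend_hom_up_to_power[OF assms(1) generate_is_subgroup abelian_integer_group this] assms(2)
  obtain n :: nat and \<chi> where "n > 0" "\<chi> \<in> hom G integer_group"
    "\<And>a. a \<in> generate G {z} \<Longrightarrow> \<chi> a = h a [^]\<^bsub>integer_group\<^esub> n" by auto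
  moreover have "h z = 1" using h[of 1] assms(2) by simp
  ultimately show ?thesis using that[of \<chi>] by (simp add: generate.incl)
qed

section \<open>Word metrics\<close>

text \<open>Fixing the generators along with the group allows word lengths in several groups to be
  compared side by side.\<close>

locale generated_group = group G for G (structure) +
  fixes S
  assumes finite_gens: "finite S" and gens_subset: "S \<subseteq> carrier G"
    and generate_gens: "generate G S = carrier G"
begin

definition word :: "'a list \<Rightarrow> bool" where
  "word xs \<longleftrightarrow> set xs \<subseteq> S \<union> m_inv G ` S"

lemma letter_carrier: "x \<in> S \<union> m_inv G ` S \<Longrightarrow> x \<in> carrier G"
  using gens_subset by auto

lemma word_carrier: "word xs \<Longrightarrow> set xs \<subseteq> carrier G"
  unfolding word_def using letter_carrier by blast

lemma foldr_mult_closed: "set xs \<subseteq> carrier G \<Longrightarrow> foldr (\<otimes>) xs \<one> \<in> carrier G"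
  by (induction xs) auto

lemma foldr_mult_append:
  "set xs \<subseteq> carrier G \<Longrightarrow> set ys \<subseteq> carrier G \<Longrightarrow>
    foldr (\<otimes>) (xs @ ys) \<one> = foldr (\<otimes>) xs \<one> \<otimes> foldr (\<otimes>) ys \<one>"
  by (induction xs) (auto simp: foldr_mult_closed m_assoc simp del: foldr_append)

lemma foldr_mult_inv:
  "set xs \<subseteq> carrier G \<Longrightarrow> foldr (\<otimes>) (rev (map (m_inv G) xs)) \<one> = inv (foldr (\<otimes>) xs \<one>)"
proof (induction xs)
  case (Cons x xs)
  then show ?case
    using foldr_mult_append[of "rev (map (m_inv G) xs)" "[inv x]"]
    by (auto simp: inv_mult_group foldr_mult_closed simp del: foldr_append)
qed simp

lemma word_inv: "word xs \<Longrightarrow> word (rev (map (m_inv G) xs))"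
  using gens_subset by (force simp: word_def)

lemma word_exists:
  assumes "g \<in> carrier G"
  obtains xs where "word xs" "foldr (\<otimes>) xs \<one> = g"
proof -
  have "\<exists>xs. word xs \<and> foldr (\<otimes>) xs \<one> = g" if "g \<in> generate G S"
    using that
  proof induction
    case one
    then show ?case by (intro exI[of _ "[]"]) (auto simp: word_def)
  next
    case (incl h)
    then show ?case using gens_subset by (intro exI[of _ "[h]"]) (auto simp: word_def)
  next
    case (inv h)
    then show ?case using gens_subset by (intro exI[of _ "[inv h]"]) (auto simp: word_def)
  next
    case (eng h1 h2)
    then obtain xs ys where "word xs" "foldr (\<otimes>) xs \<one> = h1" "word ys" "foldr (\<otimes>) ys \<one> = h2" by blast
    then show ?case using foldr_mult_append[of xs ys] word_carrier[of xs] word_carrier[of ys]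
      by (intro exI[of _ "xs @ ys"]) (auto simp: word_def simp del: foldr_append)
  qed
  then show ?thesis using assms that by (auto simp: generate_gens)
qed

abbreviation len :: "'a \<Rightarrow> nat" where "len \<equiv> word_length G S"

lemma len_le: "word xs \<Longrightarrow> foldr (\<otimes>) xs \<one> = g \<Longrightarrow> len g \<le> length xs"
  unfolding word_length_def by (rule Least_le) (auto simp: word_def)

lemma shortest_word:
  assumes "g \<in> carrier G"
  obtains xs where "word xs" "foldr (\<otimes>) xs \<one> = g" "length xs = len g"
proof -
  have "\<exists>xs. length xs = len g \<and> set xs \<subseteq> S \<union> m_inv G ` S \<and> foldr (\<otimes>) xs \<one> = g"
    unfolding word_length_def
  proof (rule LeastI_ex)
    show "\<exists>n xs. length xs = n \<and> set xs \<subseteq> S \<union> m_inv G ` S \<and> foldr (\<otimes>) xs \<one> = g"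
      using word_exists[OF assms] unfolding word_def by metis
  qed
  then show ?thesis using that by (auto simp: word_def)
qed

lemma len_mult:
  assumes "g \<in> carrier G" "h \<in> carrier G"
  shows "len (g \<otimes> h) \<le> len g + len h"
proof -
  obtain xs where xs: "word xs" "foldr (\<otimes>) xs \<one> = g" "length xs = len g"
    using shortest_word[OF assms(1)] .
  obtain ys where ys: "word ys" "foldr (\<otimes>) ys \<one> = h" "length ys = len h"
    using shortest_word[OF assms(2)] .
  have "word (xs @ ys)" using xs ys by (simp add: word_def)
  moreover have "foldr (\<otimes>) (xs @ ys) \<one> = g \<otimes> h"
    using xs ys foldr_mult_append[OF word_carrier word_carrier, of xs ys]
    by (simp del: foldr_append)
  ultimately show ?thesis using len_le[of "xs @ ys"] xs ys by simp
qed

lemma len_inv: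
  assumes "g \<in> carrier G"
  shows "len (inv g) = len g"
proof -
  have le: "len (inv g) \<le> len g" if g: "g \<in> carrier G" for g
  proof -
    obtain xs where xs: "word xs" "foldr (\<otimes>) xs \<one> = g" "length xs = len g"
      using shortest_word[OF g] .
    then have "foldr (\<otimes>) (rev (map (m_inv G) xs)) \<one> = inv g"
      using foldr_mult_inv word_carrier by blast
    from len_le[OF word_inv[OF xs(1)] this] xs(3) show ?thesis by simp
  qed
  show ?thesis using le[OF assms] le[of "inv g"] assms by simp
qed

lemma len_one: "len \<one> = 0"
  using len_le[of "[]" \<one>] by (simp add: word_def)

text \<open>There are finitely many words of bounded length over finitely many letters. Through this
  fact a bound on distances becomes the finiteness of a set of increments.\<close>

lemma finite_len_ball: "finite {g \<in> carrier G. len g \<le> n}"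
proof (rule finite_subset)
  show "{g \<in> carrier G. len g \<le> n} \<subseteq>
      (\<lambda>xs. foldr (\<otimes>) xs \<one>) ` {xs. set xs \<subseteq> S \<union> m_inv G ` S \<and> length xs \<le> n}"
  proof
    fix g assume g: "g \<in> {g \<in> carrier G. len g \<le> n}"
    then obtain xs where "word xs" "foldr (\<otimes>) xs \<one> = g" "length xs = len g"
      using shortest_word by blast
    then show "g \<in> (\<lambda>xs. foldr (\<otimes>) xs \<one>) ` {xs. set xs \<subseteq> S \<union> m_inv G ` S \<and> length xs \<le> n}"
      using g by (intro image_eqI[of _ _ xs]) (auto simp: word_def)
  qed
  show "finite ((\<lambda>xs. foldr (\<otimes>) xs \<one>) ` {xs. set xs \<subseteq> S \<union> m_inv G ` S \<and> length xs \<le> n})"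
    using finite_gens by (intro finite_imageI finite_lists_length_le) auto
qed

lemma finite_real_len_ball: "finite {g \<in> carrier G. real (len g) \<le> r}"
proof (rule finite_subset)
  show "{g \<in> carrier G. real (len g) \<le> r} \<subseteq> {g \<in> carrier G. len g \<le> nat \<lceil>r\<rceil>}"
    by (auto simp: le_nat_iff) linarith
qed (rule finite_len_ball)

lemma len_diff_sym:
  assumes "g \<in> carrier G" "h \<in> carrier G"
  shows "len (inv g \<otimes> h) = len (inv h \<otimes> g)"
  using assms len_inv[of "inv g \<otimes> h"] by (simp add: inv_mult_group)

lemma len_diff_triangle:
  assumes "g \<in> carrier G" "h \<in> carrier G" "k \<in> carrier G"
  shows "len (inv g \<otimes> k) \<le> len (inv g \<otimes> h) + len (inv h \<otimes> k)"
proof -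
  have "inv g \<otimes> k = (inv g \<otimes> h) \<otimes> (inv h \<otimes> k)"
    using assms by (metis inv_closed m_assoc m_closed r_inv r_one)
  then show ?thesis using len_mult assms by simp
qed

text \<open>Follow a shortest word from \<open>g\<close> to \<open>h\<close>: at each letter the
  image moves by one of the increments belonging to that letter. There are finitely many letters,
  each with finitely many increments, and the longest of these bounds the speed.\<close>

lemma lipschitz_of_finite_increments:
  assumes H: "generated_group H T" and F: "F \<in> carrier G \<rightarrow> carrier H"
    and fin: "\<And>x. x \<in> carrier G \<Longrightarrow> finite ((\<lambda>g. inv\<^bsub>H\<^esub> (F g) \<otimes>\<^bsub>H\<^esub> F (g \<otimes> x)) ` carrier G)"
  obtains L where "\<And>g h. g \<in> carrier G \<Longrightarrow> h \<in> carrier G \<Longrightarrow>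
    word_length H T (inv\<^bsub>H\<^esub> (F g) \<otimes>\<^bsub>H\<^esub> F h) \<le> L * len (inv g \<otimes> h)"
proof -
  interpret H: generated_group H T by fact
  have Fc: "F g \<in> carrier H" if "g \<in> carrier G" for g using F that by auto
  define D where "D = (\<Union>x\<in>S \<union> m_inv G ` S. (\<lambda>g. inv\<^bsub>H\<^esub> (F g) \<otimes>\<^bsub>H\<^esub> F (g \<otimes> x)) ` carrier G)"
  have "finite D" unfolding D_def using finite_gens fin letter_carrier by blast
  \<comment> \<open>The inserted 0 keeps the maximum defined when the generating set, and with it
    \<open>D\<close>, is empty.\<close>
  define L where "L = Max (insert 0 (H.len ` D))"
  have L: "H.len d \<le> L" if "d \<in> D" for d
    unfolding L_def using \<open>finite D\<close> that by (intro Max_ge) auto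
  \<comment> \<open>The base point is left arbitrary because it advances to
    \<open>g \<otimes> x\<close> after the first letter.\<close>
  have words: "H.len (inv\<^bsub>H\<^esub> (F g) \<otimes>\<^bsub>H\<^esub> F (g \<otimes> foldr (\<otimes>) xs \<one>)) \<le> L * length xs"
    if "word xs" "g \<in> carrier G" for xs g
    using that
  proof (induction xs arbitrary: g)
    case Nil
    then show ?case using Fc by (simp add: H.len_one)
  next
    case (Cons x xs)
    then have x: "x \<in> S \<union> m_inv G ` S" and xs: "word xs" and xc: "x \<in> carrier G"
      using letter_carrier[of x] by (auto simp: word_def)
    let ?w = "foldr (\<otimes>) xs \<one>"
    have w: "?w \<in> carrier G" using xs word_carrier foldr_mult_closed by blast
    have "inv\<^bsub>H\<^esub> (F g) \<otimes>\<^bsub>H\<^esub> F (g \<otimes> x) \<in> D" unfolding D_def using x Cons.prems(2) by blast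
    from L[OF this] Cons.IH[OF xs, of "g \<otimes> x"]
      H.len_diff_triangle[OF Fc[of g] Fc[of "g \<otimes> x"] Fc[of "g \<otimes> x \<otimes> ?w"]]
    show ?case using xc w Cons.prems(2) by (simp add: m_assoc)
  qed
  show ?thesis
  proof
    fix g h assume gh: "g \<in> carrier G" "h \<in> carrier G"
    obtain xs where xs: "word xs" "foldr (\<otimes>) xs \<one> = inv g \<otimes> h" "length xs = len (inv g \<otimes> h)"
      using shortest_word[OF m_closed[OF inv_closed[OF gh(1)] gh(2)]] .
    have "g \<otimes> (inv g \<otimes> h) = h" using gh by (simp add: m_assoc[symmetric])
    then show "H.len (inv\<^bsub>H\<^esub> (F g) \<otimes>\<^bsub>H\<^esub> F h) \<le> L * len (inv g \<otimes> h)"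
      using words[OF xs(1) gh(1)] xs by simp
  qed
qed

lemma word_metric_len: "word_metric G (\<lambda>g h. real (len (inv g \<otimes> h)))"
  unfolding word_metric_def using finite_gens gens_subset generate_gens by blast

end

lemma word_metricE:
  assumes "group G" "word_metric G d"
  obtains S where "generated_group G S" "d = (\<lambda>g h. real (word_length G S (inv\<^bsub>G\<^esub> g \<otimes>\<^bsub>G\<^esub> h)))"
  using assms unfolding word_metric_def generated_group_def generated_group_axioms_def by blast

lemma finitely_generatedE:
  assumes "group G" "finitely_generated G"
  obtains S where "generated_group G S"
  using assms unfolding finitely_generated_def generated_group_def generated_group_axioms_def by blast

lemma finitely_generated_DirProd:
  assumes "group G" "group H" "finitely_generated G" "finitely_generated H"
  shows "finitely_generated (G \<times>\<times> H)"
proof -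
  interpret G: group G by fact
  interpret H: group H by fact
  interpret P: group "G \<times>\<times> H" by (rule DirProd_group) fact+
  obtain S T where S: "finite S" "S \<subseteq> carrier G" "generate G S = carrier G"
    and T: "finite T" "T \<subseteq> carrier H" "generate H T = carrier H"
    using assms by (auto simp: finitely_generated_def)
  let ?U = "(\<lambda>g. (g, \<one>\<^bsub>H\<^esub>)) ` S \<union> (\<lambda>h. (\<one>\<^bsub>G\<^esub>, h)) ` T"
  have U: "?U \<subseteq> carrier (G \<times>\<times> H)" using S T by auto
  interpret l: group_hom G "G \<times>\<times> H" "\<lambda>g. (g, \<one>\<^bsub>H\<^esub>)"
    by unfold_locales (auto simp: hom_def)
  interpret r: group_hom H "G \<times>\<times> H" "\<lambda>h. (\<one>\<^bsub>G\<^esub>, h)"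
    by unfold_locales (auto simp: hom_def)
  have "(g, h) \<in> generate (G \<times>\<times> H) ?U" if "g \<in> carrier G" "h \<in> carrier H" for g h
  proof -
    have "(g, \<one>\<^bsub>H\<^esub>) \<in> generate (G \<times>\<times> H) ((\<lambda>g. (g, \<one>\<^bsub>H\<^esub>)) ` S)"
      using l.generate_img[OF S(2)] S(3) that by auto
    moreover have "(\<one>\<^bsub>G\<^esub>, h) \<in> generate (G \<times>\<times> H) ((\<lambda>h. (\<one>\<^bsub>G\<^esub>, h)) ` T)"
      using r.generate_img[OF T(2)] T(3) that by auto
    ultimately have "(g, \<one>\<^bsub>H\<^esub>) \<otimes>\<^bsub>G \<times>\<times> H\<^esub> (\<one>\<^bsub>G\<^esub>, h) \<in> generate (G \<times>\<times> H) ?U"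
      by (intro generate.eng) (auto dest: subsetD[OF P.mono_generate[of _ ?U], rotated])
    then show ?thesis using that by simp
  qed
  then have "generate (G \<times>\<times> H) ?U = carrier (G \<times>\<times> H)"
    using P.generate_incl[OF U] by auto
  moreover have "finite ?U" using S T by simp
  ultimately show ?thesis using U unfolding finitely_generated_def by metis
qed

section \<open>Lipschitz sections\<close>

sublocale central_extension \<subseteq> i: group_hom Z E i
  using i_hom by unfold_locales

sublocale central_extension \<subseteq> \<pi>: group_hom E G \<pi>
  using \<pi>_hom by unfold_locales

context central_extension
begin

lemma \<pi>_i [simp]: "z \<in> carrier Z \<Longrightarrow> \<pi> (i z) = \<one>\<^bsub>G\<^esub>"
  using exact by (auto simp: kernel_def)

lemma same_fiberE:
  assumes "e \<in> carrier E" "e' \<in> carrier E" "\<pi> e = \<pi> e'"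
  obtains z where "z \<in> carrier Z" "e = i z \<otimes>\<^bsub>E\<^esub> e'"
proof -
  have "e \<otimes>\<^bsub>E\<^esub> inv\<^bsub>E\<^esub> e' \<in> kernel E G \<pi>" using assms by (simp add: kernel_def)
  then obtain z where "z \<in> carrier Z" "e \<otimes>\<^bsub>E\<^esub> inv\<^bsub>E\<^esub> e' = i z" using exact by auto
  moreover have "e = (e \<otimes>\<^bsub>E\<^esub> inv\<^bsub>E\<^esub> e') \<otimes>\<^bsub>E\<^esub> e'" using assms by (simp add: E.m_assoc)
  ultimately show ?thesis using that by metis
qed

lemma i_eq_iff: "z \<in> carrier Z \<Longrightarrow> z' \<in> carrier Z \<Longrightarrow> i z = i z' \<longleftrightarrow> z = z'"
  using i_inj by (auto dest: inj_onD)

text \<open>A central product \<open>a b\<close> commutes with \<open>a\<close>, and cancelling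
  \<open>a\<close> rotates it. This rewrites a cocycle value in terms of an increment of the
  section.\<close>

lemma central_conj:
  assumes "z \<in> carrier Z" "a \<in> carrier E" "b \<in> carrier E" "i z = a \<otimes>\<^bsub>E\<^esub> b"
  shows "i z = b \<otimes>\<^bsub>E\<^esub> a"
proof -
  have "a \<otimes>\<^bsub>E\<^esub> (b \<otimes>\<^bsub>E\<^esub> a) = a \<otimes>\<^bsub>E\<^esub> i z"
    using assms central[OF assms(1,2)] by (simp add: E.m_assoc[symmetric])
  then show ?thesis using assms E.l_cancel[of a "b \<otimes>\<^bsub>E\<^esub> a" "i z"] by simp
qed

lemma i_mult_mult:
  assumes "z \<in> carrier Z" "z' \<in> carrier Z" "e \<in> carrier E" "e' \<in> carrier E"
  shows "(i z \<otimes>\<^bsub>E\<^esub> e) \<otimes>\<^bsub>E\<^esub> (i z' \<otimes>\<^bsub>E\<^esub> e') = i (z \<otimes>\<^bsub>Z\<^esub> z') \<otimes>\<^bsub>E\<^esub> (e \<otimes>\<^bsub>E\<^esub> e')"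
proof -
  have "(i z \<otimes>\<^bsub>E\<^esub> e) \<otimes>\<^bsub>E\<^esub> (i z' \<otimes>\<^bsub>E\<^esub> e') = i z \<otimes>\<^bsub>E\<^esub> (e \<otimes>\<^bsub>E\<^esub> i z') \<otimes>\<^bsub>E\<^esub> e'"
    using assms by (simp add: E.m_assoc)
  also have "\<dots> = i z \<otimes>\<^bsub>E\<^esub> (i z' \<otimes>\<^bsub>E\<^esub> e) \<otimes>\<^bsub>E\<^esub> e'" using central assms by simp
  also have "\<dots> = i (z \<otimes>\<^bsub>Z\<^esub> z') \<otimes>\<^bsub>E\<^esub> (e \<otimes>\<^bsub>E\<^esub> e')"
    using assms by (simp add: E.m_assoc)
  finally show ?thesis .
qed

lemma inv_i_mult_mult:
  assumes "z \<in> carrier Z" "z' \<in> carrier Z" "e \<in> carrier E" "e' \<in> carrier E"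
  shows "inv\<^bsub>E\<^esub> (i z \<otimes>\<^bsub>E\<^esub> e) \<otimes>\<^bsub>E\<^esub> (i z' \<otimes>\<^bsub>E\<^esub> e') = i (inv\<^bsub>Z\<^esub> z \<otimes>\<^bsub>Z\<^esub> z') \<otimes>\<^bsub>E\<^esub> (inv\<^bsub>E\<^esub> e \<otimes>\<^bsub>E\<^esub> e')"
proof -
  have "inv\<^bsub>E\<^esub> (i z \<otimes>\<^bsub>E\<^esub> e) = i (inv\<^bsub>Z\<^esub> z) \<otimes>\<^bsub>E\<^esub> inv\<^bsub>E\<^esub> e"
    using assms central[of "inv\<^bsub>Z\<^esub> z" "inv\<^bsub>E\<^esub> e"] by (simp add: E.inv_mult_group)
  then show ?thesis using assms i_mult_mult[of "inv\<^bsub>Z\<^esub> z" z' "inv\<^bsub>E\<^esub> e" e'] by simp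
qed

lemma finite_i_preimage: "finite B \<Longrightarrow> finite {z \<in> carrier Z. i z \<in> B}"
  by (rule finite_subset[of _ "inv_into (carrier Z) i ` B"])
     (use i_inj in \<open>auto intro!: image_eqI[of _ _ "i _"] simp: inv_into_f_f\<close>)

lemma section_exists: obtains s where "s \<in> sections E G \<pi>"
proof -
  have "\<forall>g\<in>carrier G. \<exists>e\<in>carrier E. \<pi> e = g" using \<pi>_surj by (metis imageE)
  then obtain s where "\<forall>g\<in>carrier G. s g \<in> carrier E \<and> \<pi> (s g) = g" by metis
  then show ?thesis using that[of s] by (auto simp: sections_def)
qed

lemma section_closed: "s \<in> sections E G \<pi> \<Longrightarrow> g \<in> carrier G \<Longrightarrow> s g \<in> carrier E"
  and section_proj: "s \<in> sections E G \<pi> \<Longrightarrow> g \<in> carrier G \<Longrightarrow> \<pi> (s g) = g"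
  by (auto simp: sections_def)

lemma section_decomp:
  assumes "s \<in> sections E G \<pi>" "e \<in> carrier E"
  obtains z where "z \<in> carrier Z" "e = i z \<otimes>\<^bsub>E\<^esub> s (\<pi> e)"
  using same_fiberE[of e "s (\<pi> e)"] assms by (auto simp: section_closed section_proj)

lemma section_decomp_unique:
  assumes "s \<in> sections E G \<pi>" "z \<in> carrier Z" "z' \<in> carrier Z" "g \<in> carrier G" "g' \<in> carrier G"
    "i z \<otimes>\<^bsub>E\<^esub> s g = i z' \<otimes>\<^bsub>E\<^esub> s g'"
  shows "z = z' \<and> g = g'"
proof -
  have "\<pi> (i z \<otimes>\<^bsub>E\<^esub> s g) = \<pi> (i z' \<otimes>\<^bsub>E\<^esub> s g')" using assms(6) by simp
  then have "g = g'" using assms(1-5) by (simp add: section_closed section_proj)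
  then show ?thesis using assms by (simp add: section_closed i_eq_iff)
qed

text \<open>
  Balls of word metrics being finite, finiteness of the increments \<open>s(g)\<inverse> s(g x)\<close> says that \<open>s\<close> is
  Lipschitz, or equivalently that the cocycle of \<open>s\<close> is weakly bounded: it takes finitely many values
  for each fixed second argument.
\<close>

definition lipschitz_section :: "('g \<Rightarrow> 'e) \<Rightarrow> bool" where
  "lipschitz_section s \<longleftrightarrow> s \<in> sections E G \<pi> \<and>
     (\<forall>x\<in>carrier G. finite ((\<lambda>g. inv\<^bsub>E\<^esub> (s g) \<otimes>\<^bsub>E\<^esub> s (g \<otimes>\<^bsub>G\<^esub> x)) ` carrier G))"

text \<open>Images of generators of \<open>Z\<close> together with lifts of generators of
  \<open>G\<close> suffice: a word in the lifts matches any element up to a factor from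
  \<open>Z\<close>.\<close>

lemma finitely_generated_E:
  assumes "finitely_generated Z" "finitely_generated G"
  shows "finitely_generated E"
proof -
  obtain S T where S: "finite S" "S \<subseteq> carrier Z" "generate Z S = carrier Z"
    and T: "finite T" "T \<subseteq> carrier G" "generate G T = carrier G"
    using assms by (auto simp: finitely_generated_def)
  obtain s where s: "s \<in> sections E G \<pi>" by (rule section_exists)
  let ?U = "i ` S \<union> s ` T"
  have U: "?U \<subseteq> carrier E" using S T s by (auto simp: section_closed)
  have "i ` carrier Z \<subseteq> generate E ?U"
    using i.generate_img[OF S(2)] S(3) E.mono_generate[of "i ` S" ?U] by auto
  moreover have "carrier G \<subseteq> \<pi> ` generate E ?U"
  proof -
    have "carrier G = generate G (\<pi> ` s ` T)"
      using T s by (simp add: image_image section_proj subset_iff cong: image_cong_simp)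
    also have "\<dots> = \<pi> ` generate E (s ` T)"
      using T s by (intro \<pi>.generate_img) (auto simp: section_closed)
    also have "\<dots> \<subseteq> \<pi> ` generate E ?U" by (intro image_mono E.mono_generate) auto
    finally show ?thesis .
  qed
  ultimately have "e \<in> generate E ?U" if e: "e \<in> carrier E" for e
  proof -
    obtain e' where e': "e' \<in> generate E ?U" "\<pi> e = \<pi> e'"
      using \<open>carrier G \<subseteq> _\<close> \<pi>.hom_closed[OF e] by blast
    moreover have "e' \<in> carrier E" using e' E.generate_in_carrier[OF U] by blast
    ultimately obtain z where "z \<in> carrier Z" "e = i z \<otimes>\<^bsub>E\<^esub> e'"
      using same_fiberE[OF e] by metis
    then show ?thesis using e' \<open>i ` carrier Z \<subseteq> _\<close> by (auto intro: generate.eng)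
  qed
  then have "generate E ?U = carrier E" using E.generate_incl[OF U] by auto
  moreover have "finite ?U" using S T by simp
  ultimately show ?thesis using U unfolding finitely_generated_def by metis
qed

lemma DirProd_is_group: "group (Z \<times>\<times> G)"
  by (rule DirProd_group) (rule Z.is_group G.is_group)+

text \<open>The restriction of a quasi-inverse to \<open>1 \<times> G\<close> is corrected by a finite set to a section.\<close>

lemma qi_trivial_imp_lipschitz_section:
  assumes "qi_trivial Z E G \<pi>"
  obtains s where "lipschitz_section s"
proof -
  obtain dE dP dG f where d: "word_metric E dE" "word_metric (Z \<times>\<times> G) dP" "word_metric G dG"
    and qi: "quasi_isometry (carrier E) dE (carrier (Z \<times>\<times> G)) dP f"
    and bdd: "bdd_above ((\<lambda>h. dG (\<pi> h) (snd (f h))) ` carrier E)"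
    using assms unfolding qi_trivial_def by blast
  obtain SE where SE: "generated_group E SE" "dE = (\<lambda>g h. real (word_length E SE (inv\<^bsub>E\<^esub> g \<otimes>\<^bsub>E\<^esub> h)))"
    using word_metricE[OF E.is_group d(1)] .
  obtain SP where SP: "generated_group (Z \<times>\<times> G) SP"
      "dP = (\<lambda>g h. real (word_length (Z \<times>\<times> G) SP (inv\<^bsub>Z \<times>\<times> G\<^esub> g \<otimes>\<^bsub>Z \<times>\<times> G\<^esub> h)))"
    using word_metricE[OF DirProd_is_group d(2)] .
  obtain SG where SG: "generated_group G SG" "dG = (\<lambda>g h. real (word_length G SG (inv\<^bsub>G\<^esub> g \<otimes>\<^bsub>G\<^esub> h)))"
    using word_metricE[OF G.is_group d(3)] .
  interpret gE: generated_group E SE by fact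
  interpret gP: generated_group "Z \<times>\<times> G" SP by fact
  interpret gG: generated_group G SG by fact
  obtain C where C: "\<And>h. h \<in> carrier E \<Longrightarrow> dG (\<pi> h) (snd (f h)) \<le> C"
    using bdd unfolding bdd_above_def by auto
  obtain k c where k: "k \<ge> 1" and c: "c \<ge> 0" and
    lower: "\<And>x x'. x \<in> carrier E \<Longrightarrow> x' \<in> carrier E \<Longrightarrow> dE x x' / k - c \<le> dP (f x) (f x')" and
    dense: "\<And>y. y \<in> carrier (Z \<times>\<times> G) \<Longrightarrow> \<exists>x\<in>carrier E. dP (f x) y \<le> c"
    using qi unfolding quasi_isometry_def by metis
  have f: "f x \<in> carrier (Z \<times>\<times> G)" if "x \<in> carrier E" for x
    using qi that unfolding quasi_isometry_def by blast
  have "\<forall>g\<in>carrier G. \<exists>x\<in>carrier E. dP (f x) (\<one>\<^bsub>Z\<^esub>, g) \<le> c" using dense by simp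
  then obtain e where e: "\<And>g. g \<in> carrier G \<Longrightarrow> e g \<in> carrier E"
      "\<And>g. g \<in> carrier G \<Longrightarrow> dP (f (e g)) (\<one>\<^bsub>Z\<^esub>, g) \<le> c"
    by metis
  obtain t where t: "t \<in> sections E G \<pi>" by (rule section_exists)
  \<comment> \<open>\<open>N\<close> contains every correction \<open>\<nu> g\<close> taking
    \<open>\<pi> (e g)\<close> to \<open>g\<close>. The first factor is the gap between
    \<open>\<pi> (e g)\<close> and \<open>snd (f (e g))\<close>, of length at most \<open>C\<close>;
    the second is the \<open>G\<close>-component of the gap between \<open>f (e g)\<close> and
    \<open>(\<one>, g)\<close>, of length at most \<open>c\<close>. Multiplying \<open>e g\<close>
    by a lift of \<open>\<nu> g\<close> then gives an exact section.\<close>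
  define N where "N = (\<lambda>(a, b). a \<otimes>\<^bsub>G\<^esub> b) `
    ({x \<in> carrier G. real (gG.len x) \<le> C} \<times> snd ` {p \<in> carrier (Z \<times>\<times> G). real (gP.len p) \<le> c})"
  have "finite N" unfolding N_def
    using gG.finite_real_len_ball gP.finite_real_len_ball by (intro finite_imageI finite_cartesian_product)
  define \<nu> where "\<nu> g = inv\<^bsub>G\<^esub> (\<pi> (e g)) \<otimes>\<^bsub>G\<^esub> g" for g
  have \<nu>c: "\<nu> g \<in> carrier G" if "g \<in> carrier G" for g using that e by (simp add: \<nu>_def)
  have \<nu>: "\<nu> g \<in> N" if g: "g \<in> carrier G" for g
  proof -
    obtain a b where ab: "f (e g) = (a, b)" by (cases "f (e g)")
    have abc: "a \<in> carrier Z" "b \<in> carrier G" using f[OF e(1)[OF g]] ab by auto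
    have "inv\<^bsub>Z \<times>\<times> G\<^esub> (a, b) \<otimes>\<^bsub>Z \<times>\<times> G\<^esub> (\<one>\<^bsub>Z\<^esub>, g) = (inv\<^bsub>Z\<^esub> a, inv\<^bsub>G\<^esub> b \<otimes>\<^bsub>G\<^esub> g)"
      using abc by (simp add: inv_DirProd[OF Z.is_group G.is_group])
    then have "(inv\<^bsub>Z\<^esub> a, inv\<^bsub>G\<^esub> b \<otimes>\<^bsub>G\<^esub> g) \<in> {p \<in> carrier (Z \<times>\<times> G). real (gP.len p) \<le> c}"
      using e(2)[OF g] abc g by (simp add: SP(2) ab)
    then have "inv\<^bsub>G\<^esub> b \<otimes>\<^bsub>G\<^esub> g \<in> snd ` {p \<in> carrier (Z \<times>\<times> G). real (gP.len p) \<le> c}" by force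
    moreover have "inv\<^bsub>G\<^esub> (\<pi> (e g)) \<otimes>\<^bsub>G\<^esub> b \<in> {x \<in> carrier G. real (gG.len x) \<le> C}"
      using C[OF e(1)[OF g]] e(1)[OF g] abc by (simp add: SG(2) ab)
    moreover have "\<nu> g = (inv\<^bsub>G\<^esub> (\<pi> (e g)) \<otimes>\<^bsub>G\<^esub> b) \<otimes>\<^bsub>G\<^esub> (inv\<^bsub>G\<^esub> b \<otimes>\<^bsub>G\<^esub> g)"
    proof -
      have "b \<otimes>\<^bsub>G\<^esub> (inv\<^bsub>G\<^esub> b \<otimes>\<^bsub>G\<^esub> g) = g" using abc g by (simp add: G.m_assoc[symmetric])
      then show ?thesis using abc g e(1)[OF g] by (simp add: \<nu>_def G.m_assoc)
    qed
    ultimately show ?thesis unfolding N_def by (intro image_eqI[of _ _ "(_, _)"]) auto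
  qed
  define s where "s g = e g \<otimes>\<^bsub>E\<^esub> t (\<nu> g)" for g
  have "s \<in> sections E G \<pi>"
    using section_closed[OF t \<nu>c] section_proj[OF t \<nu>c] e(1)
    by (simp add: sections_def s_def) (simp add: \<nu>_def G.m_assoc[symmetric])
  moreover have "finite ((\<lambda>g. inv\<^bsub>E\<^esub> (s g) \<otimes>\<^bsub>E\<^esub> s (g \<otimes>\<^bsub>G\<^esub> x)) ` carrier G)" if x: "x \<in> carrier G" for x
  proof (rule finite_subset)
    \<comment> \<open>Triangle inequality through \<open>(\<one>, g)\<close> and
      \<open>(\<one>, g \<otimes> x)\<close>: two approximation errors \<open>c\<close>, the length
      of \<open>(\<one>, x)\<close>, and the additive constant \<open>c\<close> of the
      quasi-isometry, all scaled by \<open>k\<close>.\<close>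
    define K where "K = k * (2 * c + real (gP.len (\<one>\<^bsub>Z\<^esub>, x)) + c)"
    define B where "B = {b \<in> carrier E. real (gE.len b) \<le> K}"
    show "finite ((\<lambda>(y, b, y'). inv\<^bsub>E\<^esub> y \<otimes>\<^bsub>E\<^esub> b \<otimes>\<^bsub>E\<^esub> y') ` (t ` N \<times> B \<times> t ` N))"
      using \<open>finite N\<close> gE.finite_real_len_ball unfolding B_def
      by (intro finite_imageI finite_cartesian_product)
    show "(\<lambda>g. inv\<^bsub>E\<^esub> (s g) \<otimes>\<^bsub>E\<^esub> s (g \<otimes>\<^bsub>G\<^esub> x)) ` carrier G \<subseteq>
        (\<lambda>(y, b, y'). inv\<^bsub>E\<^esub> y \<otimes>\<^bsub>E\<^esub> b \<otimes>\<^bsub>E\<^esub> y') ` (t ` N \<times> B \<times> t ` N)"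
    proof (rule image_subsetI)
      fix g assume g: "g \<in> carrier G"
      let ?h = "g \<otimes>\<^bsub>G\<^esub> x"
      let ?b = "inv\<^bsub>E\<^esub> (e g) \<otimes>\<^bsub>E\<^esub> e ?h"
      have h: "?h \<in> carrier G" using g x by simp
      have pc: "(\<one>\<^bsub>Z\<^esub>, g) \<in> carrier (Z \<times>\<times> G)" "(\<one>\<^bsub>Z\<^esub>, ?h) \<in> carrier (Z \<times>\<times> G)" using g h by auto
      have fe: "f (e g) \<in> carrier (Z \<times>\<times> G)" "f (e ?h) \<in> carrier (Z \<times>\<times> G)" using f e g h by auto
      have "dP (\<one>\<^bsub>Z\<^esub>, g) (\<one>\<^bsub>Z\<^esub>, ?h) = real (gP.len (\<one>\<^bsub>Z\<^esub>, x))"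
        using g x by (simp add: SP(2) inv_DirProd[OF Z.is_group G.is_group] G.m_assoc[symmetric])
      moreover have "dP (\<one>\<^bsub>Z\<^esub>, ?h) (f (e ?h)) = dP (f (e ?h)) (\<one>\<^bsub>Z\<^esub>, ?h)"
        using gP.len_diff_sym[OF pc(2) fe(2)] by (simp add: SP(2))
      moreover have "dP (f (e g)) (f (e ?h)) \<le> dP (f (e g)) (\<one>\<^bsub>Z\<^esub>, g) + dP (\<one>\<^bsub>Z\<^esub>, g) (f (e ?h))"
        using gP.len_diff_triangle[OF fe(1) pc(1) fe(2)] unfolding SP(2) by linarith
      moreover have "dP (\<one>\<^bsub>Z\<^esub>, g) (f (e ?h)) \<le> dP (\<one>\<^bsub>Z\<^esub>, g) (\<one>\<^bsub>Z\<^esub>, ?h) + dP (\<one>\<^bsub>Z\<^esub>, ?h) (f (e ?h))"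
        using gP.len_diff_triangle[OF pc(1) pc(2) fe(2)] unfolding SP(2) by linarith
      ultimately have "dE (e g) (e ?h) / k \<le> 2 * c + real (gP.len (\<one>\<^bsub>Z\<^esub>, x)) + c"
        using lower[OF e(1)[OF g] e(1)[OF h]] e(2)[OF g] e(2)[OF h] by linarith
      then have "dE (e g) (e ?h) \<le> K" using k by (simp add: K_def divide_le_eq mult.commute)
      then have b: "?b \<in> B" using e(1) g h by (simp add: B_def SE(2))
      have tc: "t (\<nu> g) \<in> carrier E" "t (\<nu> ?h) \<in> carrier E"
        using \<nu>c[OF g] \<nu>c[OF h] section_closed[OF t] by auto
      have "inv\<^bsub>E\<^esub> (s g) \<otimes>\<^bsub>E\<^esub> s ?h = inv\<^bsub>E\<^esub> (t (\<nu> g)) \<otimes>\<^bsub>E\<^esub> ?b \<otimes>\<^bsub>E\<^esub> t (\<nu> ?h)"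
        using tc e(1)[OF g] e(1)[OF h] by (simp add: s_def E.inv_mult_group E.m_assoc)
      then show "inv\<^bsub>E\<^esub> (s g) \<otimes>\<^bsub>E\<^esub> s ?h \<in> (\<lambda>(y, b, y'). inv\<^bsub>E\<^esub> y \<otimes>\<^bsub>E\<^esub> b \<otimes>\<^bsub>E\<^esub> y') ` (t ` N \<times> B \<times> t ` N)"
        using b \<nu>[OF g] \<nu>[OF h] by (intro image_eqI[of _ _ "(t (\<nu> g), ?b, t (\<nu> ?h))"]) auto
    qed
  qed
  ultimately show ?thesis using that[of s] by (simp add: lipschitz_section_def)
qed

text \<open>In the coordinates given by the section both \<open>(z, g) \<mapsto> i z \<otimes> s g\<close> and its inverse are Lipschitz.\<close>

lemma lipschitz_section_imp_qi_trivial: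
  assumes "lipschitz_section s" "finitely_generated Z" "finitely_generated G"
  shows "qi_trivial Z E G \<pi>"
proof -
  have s: "s \<in> sections E G \<pi>"
    and fin: "\<And>x. x \<in> carrier G \<Longrightarrow> finite ((\<lambda>g. inv\<^bsub>E\<^esub> (s g) \<otimes>\<^bsub>E\<^esub> s (g \<otimes>\<^bsub>G\<^esub> x)) ` carrier G)"
    using assms(1) by (auto simp: lipschitz_section_def)
  have sc: "s g \<in> carrier E" if "g \<in> carrier G" for g using section_closed[OF s that] .
  obtain SE where SE: "generated_group E SE"
    using finitely_generatedE[OF E.is_group finitely_generated_E[OF assms(2,3)]] .
  obtain SP where SP: "generated_group (Z \<times>\<times> G) SP"
    using finitely_generatedE[OF DirProd_is_group]
      finitely_generated_DirProd[OF Z.is_group G.is_group assms(2,3)] by blast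
  obtain SG where SG: "generated_group G SG" using finitely_generatedE[OF G.is_group assms(3)] .
  interpret gE: generated_group E SE by fact
  interpret gP: generated_group "Z \<times>\<times> G" SP by fact
  interpret gG: generated_group G SG by fact
  define F where "F = (\<lambda>(z, g). i z \<otimes>\<^bsub>E\<^esub> s g)"
  define f where "f = inv_into (carrier (Z \<times>\<times> G)) F"
  have F: "F \<in> carrier (Z \<times>\<times> G) \<rightarrow> carrier E" using sc by (auto simp: F_def)
  have inj: "inj_on F (carrier (Z \<times>\<times> G))"
    using section_decomp_unique[OF s] by (auto simp: inj_on_def F_def)
  have surj: "F ` carrier (Z \<times>\<times> G) = carrier E"
  proof
    show "carrier E \<subseteq> F ` carrier (Z \<times>\<times> G)"
    proof
      fix e assume e: "e \<in> carrier E"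
      from section_decomp[OF s e] obtain z where "z \<in> carrier Z" "e = i z \<otimes>\<^bsub>E\<^esub> s (\<pi> e)" .
      then show "e \<in> F ` carrier (Z \<times>\<times> G)"
        using e by (intro image_eqI[of _ _ "(z, \<pi> e)"]) (auto simp: F_def)
    qed
  qed (use F in auto)
  have fF: "f (F p) = p" if "p \<in> carrier (Z \<times>\<times> G)" for p
    using inj that by (simp add: f_def)
  have Ff: "F (f e) = e" "f e \<in> carrier (Z \<times>\<times> G)" if "e \<in> carrier E" for e
    using that surj by (auto simp: f_def f_inv_into_f intro: inv_into_into)
  have f\<pi>: "snd (f e) = \<pi> e" if e: "e \<in> carrier E" for e
  proof -
    obtain z g where zg: "f e = (z, g)" by (cases "f e")
    then have "z \<in> carrier Z" "g \<in> carrier G" "e = i z \<otimes>\<^bsub>E\<^esub> s g"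
      using Ff[OF e] by (auto simp: F_def)
    then show ?thesis using zg sc by (simp add: section_proj[OF s])
  qed
  have "finite ((\<lambda>p. inv\<^bsub>E\<^esub> (F p) \<otimes>\<^bsub>E\<^esub> F (p \<otimes>\<^bsub>Z \<times>\<times> G\<^esub> q)) ` carrier (Z \<times>\<times> G))"
    if q: "q \<in> carrier (Z \<times>\<times> G)" for q
  proof -
    obtain w x where wx: "q = (w, x)" "w \<in> carrier Z" "x \<in> carrier G" using q by auto
    have "(\<lambda>p. inv\<^bsub>E\<^esub> (F p) \<otimes>\<^bsub>E\<^esub> F (p \<otimes>\<^bsub>Z \<times>\<times> G\<^esub> q)) ` carrier (Z \<times>\<times> G) \<subseteq>
      (\<lambda>d. i w \<otimes>\<^bsub>E\<^esub> d) ` (\<lambda>g. inv\<^bsub>E\<^esub> (s g) \<otimes>\<^bsub>E\<^esub> s (g \<otimes>\<^bsub>G\<^esub> x)) ` carrier G"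
    proof (rule image_subsetI)
      fix p assume "p \<in> carrier (Z \<times>\<times> G)"
      then obtain z g where p: "p = (z, g)" "z \<in> carrier Z" "g \<in> carrier G" by auto
      have "inv\<^bsub>Z\<^esub> z \<otimes>\<^bsub>Z\<^esub> (z \<otimes>\<^bsub>Z\<^esub> w) = w" using p wx by (simp add: Z.m_assoc[symmetric])
      then have "inv\<^bsub>E\<^esub> (F p) \<otimes>\<^bsub>E\<^esub> F (p \<otimes>\<^bsub>Z \<times>\<times> G\<^esub> q) = i w \<otimes>\<^bsub>E\<^esub> (inv\<^bsub>E\<^esub> (s g) \<otimes>\<^bsub>E\<^esub> s (g \<otimes>\<^bsub>G\<^esub> x))"
        using p wx sc inv_i_mult_mult[of z "z \<otimes>\<^bsub>Z\<^esub> w" "s g" "s (g \<otimes>\<^bsub>G\<^esub> x)"] by (simp add: F_def)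
      then show "inv\<^bsub>E\<^esub> (F p) \<otimes>\<^bsub>E\<^esub> F (p \<otimes>\<^bsub>Z \<times>\<times> G\<^esub> q) \<in>
        (\<lambda>d. i w \<otimes>\<^bsub>E\<^esub> d) ` (\<lambda>g. inv\<^bsub>E\<^esub> (s g) \<otimes>\<^bsub>E\<^esub> s (g \<otimes>\<^bsub>G\<^esub> x)) ` carrier G"
        using p(3) by blast
    qed
    then show ?thesis using fin[OF wx(3)] by (meson finite_imageI finite_subset)
  qed
  from gP.lipschitz_of_finite_increments[OF SE F this]
  obtain L where L: "\<And>p q. p \<in> carrier (Z \<times>\<times> G) \<Longrightarrow> q \<in> carrier (Z \<times>\<times> G) \<Longrightarrow>
    gE.len (inv\<^bsub>E\<^esub> (F p) \<otimes>\<^bsub>E\<^esub> F q) \<le> L * gP.len (inv\<^bsub>Z \<times>\<times> G\<^esub> p \<otimes>\<^bsub>Z \<times>\<times> G\<^esub> q)" by blast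
  have "finite ((\<lambda>e. inv\<^bsub>Z \<times>\<times> G\<^esub> (f e) \<otimes>\<^bsub>Z \<times>\<times> G\<^esub> f (e \<otimes>\<^bsub>E\<^esub> x)) ` carrier E)"
    if x: "x \<in> carrier E" for x
  proof -
    \<comment> \<open>If right multiplication by \<open>x\<close> changes the
      \<open>Z\<close>-coordinate by \<open>w\<close>, then \<open>x = i w \<otimes> d\<close> with
      \<open>d\<close> an increment of \<open>s\<close> along \<open>\<pi> x\<close>. So
      \<open>i w\<close> lies in the finite set \<open>D\<close>.\<close>
    define D where "D = (\<lambda>d. x \<otimes>\<^bsub>E\<^esub> inv\<^bsub>E\<^esub> d) ` (\<lambda>g. inv\<^bsub>E\<^esub> (s g) \<otimes>\<^bsub>E\<^esub> s (g \<otimes>\<^bsub>G\<^esub> \<pi> x)) ` carrier G"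
    have "(\<lambda>e. inv\<^bsub>Z \<times>\<times> G\<^esub> (f e) \<otimes>\<^bsub>Z \<times>\<times> G\<^esub> f (e \<otimes>\<^bsub>E\<^esub> x)) ` carrier E \<subseteq> {w \<in> carrier Z. i w \<in> D} \<times> {\<pi> x}"
    proof (rule image_subsetI)
      fix e assume e: "e \<in> carrier E"
      have ex: "e \<otimes>\<^bsub>E\<^esub> x \<in> carrier E" using e x by simp
      obtain z g where zg: "f e = (z, g)" by (cases "f e")
      obtain z' g' where zg': "f (e \<otimes>\<^bsub>E\<^esub> x) = (z', g')" by (cases "f (e \<otimes>\<^bsub>E\<^esub> x)")
      have c: "z \<in> carrier Z" "g \<in> carrier G" "z' \<in> carrier Z" "g' \<in> carrier G"
        using Ff(2)[OF e] Ff(2)[OF ex] zg zg' by auto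
      have eqs: "e = i z \<otimes>\<^bsub>E\<^esub> s g" "e \<otimes>\<^bsub>E\<^esub> x = i z' \<otimes>\<^bsub>E\<^esub> s g'"
        using Ff(1)[OF e] Ff(1)[OF ex] zg zg' by (auto simp: F_def)
      have g: "g = \<pi> e" "g' = g \<otimes>\<^bsub>G\<^esub> \<pi> x" using f\<pi>[OF e] f\<pi>[OF ex] zg zg' e x by auto
      define w where "w = inv\<^bsub>Z\<^esub> z \<otimes>\<^bsub>Z\<^esub> z'"
      have w: "w \<in> carrier Z" using c by (simp add: w_def)
      let ?d = "inv\<^bsub>E\<^esub> (s g) \<otimes>\<^bsub>E\<^esub> s g'"
      have d: "?d \<in> carrier E" using c sc by simp
      have "x = inv\<^bsub>E\<^esub> e \<otimes>\<^bsub>E\<^esub> (e \<otimes>\<^bsub>E\<^esub> x)" using e x by (simp add: E.m_assoc[symmetric])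
      also have "\<dots> = i w \<otimes>\<^bsub>E\<^esub> ?d"
        using inv_i_mult_mult[OF c(1,3) sc[OF c(2)] sc[OF c(4)]] eqs(2) eqs(1)[symmetric] by (simp add: w_def)
      finally have "x \<otimes>\<^bsub>E\<^esub> inv\<^bsub>E\<^esub> ?d = i w \<otimes>\<^bsub>E\<^esub> ?d \<otimes>\<^bsub>E\<^esub> inv\<^bsub>E\<^esub> ?d" by simp
      also have "\<dots> = i w" using w d by (simp only: E.m_assoc i.hom_closed E.inv_closed E.r_inv E.r_one)
      finally have "i w \<in> D" using c(2) unfolding D_def g(2) by force
      moreover have "inv\<^bsub>G\<^esub> g \<otimes>\<^bsub>G\<^esub> g' = \<pi> x" using g e x by (simp add: G.m_assoc[symmetric])
      ultimately show "inv\<^bsub>Z \<times>\<times> G\<^esub> (f e) \<otimes>\<^bsub>Z \<times>\<times> G\<^esub> f (e \<otimes>\<^bsub>E\<^esub> x) \<in> {w \<in> carrier Z. i w \<in> D} \<times> {\<pi> x}"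
        using c w by (simp add: zg zg' inv_DirProd[OF Z.is_group G.is_group] w_def)
    qed
    moreover have "finite D" unfolding D_def using x by (intro finite_imageI fin) simp
    then have "finite ({w \<in> carrier Z. i w \<in> D} \<times> {\<pi> x})"
      by (intro finite_cartesian_product finite_i_preimage) simp_all
    ultimately show ?thesis by (rule finite_subset)
  qed
  from gE.lipschitz_of_finite_increments[OF SP _ this] Ff(2)
  obtain M where M: "\<And>e e'. e \<in> carrier E \<Longrightarrow> e' \<in> carrier E \<Longrightarrow>
    gP.len (inv\<^bsub>Z \<times>\<times> G\<^esub> (f e) \<otimes>\<^bsub>Z \<times>\<times> G\<^esub> f e') \<le> M * gE.len (inv\<^bsub>E\<^esub> e \<otimes>\<^bsub>E\<^esub> e')" by blast
  define dE where "dE = (\<lambda>g h. real (gE.len (inv\<^bsub>E\<^esub> g \<otimes>\<^bsub>E\<^esub> h)))"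
  define dP where "dP = (\<lambda>g h. real (gP.len (inv\<^bsub>Z \<times>\<times> G\<^esub> g \<otimes>\<^bsub>Z \<times>\<times> G\<^esub> h)))"
  define dG where "dG = (\<lambda>g h. real (gG.len (inv\<^bsub>G\<^esub> g \<otimes>\<^bsub>G\<^esub> h)))"
  \<comment> \<open>\<open>L\<close> controls \<open>F\<close> and \<open>M\<close> its inverse
    \<open>f\<close>; the summand 1 secures \<open>1 \<le> k\<close>. The same number serves as
    multiplicative and as additive constant.\<close>
  define k where "k = 1 + real L + real M"
  have "quasi_isometry (carrier E) dE (carrier (Z \<times>\<times> G)) dP f"
    unfolding quasi_isometry_def
  proof (intro conjI exI[of _ k] ballI)
    show "f \<in> carrier E \<rightarrow> carrier (Z \<times>\<times> G)" using Ff by blast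
    show "1 \<le> k" "0 \<le> k" by (simp_all add: k_def)
    fix e e' assume e: "e \<in> carrier E" "e' \<in> carrier E"
    have "dP (f e) (f e') \<le> real M * dE e e'"
      using M[OF e] by (simp add: dP_def dE_def flip: of_nat_mult)
    also have "\<dots> \<le> k * dE e e'" by (intro mult_right_mono) (auto simp: k_def dE_def)
    finally show "dP (f e) (f e') \<le> k * dE e e' + k" using \<open>0 \<le> k\<close> by simp
    have "dE e e' \<le> real L * dP (f e) (f e')"
      using L[OF Ff(2)[OF e(1)] Ff(2)[OF e(2)]] Ff(1)[OF e(1)] Ff(1)[OF e(2)]
      by (simp add: dP_def dE_def flip: of_nat_mult)
    also have "\<dots> \<le> k * dP (f e) (f e')" by (intro mult_right_mono) (auto simp: k_def dP_def)
    finally have "dE e e' / k \<le> dP (f e) (f e')"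
      using \<open>1 \<le> k\<close> by (simp add: divide_le_eq mult.commute)
    then show "dE e e' / k - k \<le> dP (f e) (f e')" using \<open>0 \<le> k\<close> by simp
  next
    fix p assume p: "p \<in> carrier (Z \<times>\<times> G)"
    have "dP (f (F p)) p = 0"
      using p by (simp add: fF[OF p] dP_def gP.len_one gP.l_inv del: carrier_DirProd one_DirProd)
    then show "\<exists>x\<in>carrier E. dP (f x) p \<le> k" using F p by (intro bexI[of _ "F p"]) (auto simp: k_def)
  qed
  moreover have "bdd_above ((\<lambda>h. dG (\<pi> h) (snd (f h))) ` carrier E)"
    unfolding bdd_above_def by (intro exI[of _ 0]) (auto simp: dG_def f\<pi> gG.len_one)
  moreover have "word_metric E dE" "word_metric (Z \<times>\<times> G) dP" "word_metric G dG"
    unfolding dE_def dP_def dG_def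
    by (rule gE.word_metric_len gP.word_metric_len gG.word_metric_len)+
  ultimately show ?thesis unfolding qi_trivial_def by blast
qed

end

section \<open>Extensions of finite order and virtually trivial extensions\<close>

text \<open>Serves to bound the index of a subgroup by the number of values of an invariant that
  determines the coset.\<close>

lemma finite_image_factor:
  assumes "finite (\<kappa> ` A)" "\<And>x y. x \<in> A \<Longrightarrow> y \<in> A \<Longrightarrow> \<kappa> x = \<kappa> y \<Longrightarrow> F x = F y"
  shows "finite (F ` A)"
proof -
  have "F ` A \<subseteq> (\<lambda>k. F (inv_into A \<kappa> k)) ` \<kappa> ` A"
  proof
    fix y assume "y \<in> F ` A"
    then obtain x where x: "x \<in> A" "y = F x" by blast
    then have "F (inv_into A \<kappa> (\<kappa> x)) = F x"
      by (intro assms(2)) (auto simp: inv_into_into f_inv_into_f)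
    then show "y \<in> (\<lambda>k. F (inv_into A \<kappa> k)) ` \<kappa> ` A" using x by force
  qed
  then show ?thesis using assms(1) finite_subset by blast
qed

context central_extension
begin

text \<open>
  By \<open>finite_order_euler_class_iff\<close>, such a \<open>\<psi>\<close> exists for some \<open>n\<close> if and only if the Euler class has
  finite order.
\<close>

definition power_retract :: "nat \<Rightarrow> ('e \<Rightarrow> 'z) \<Rightarrow> bool" where
  "power_retract n \<psi> \<longleftrightarrow> n > 0 \<and> \<psi> \<in> hom E Z \<and> (\<forall>z\<in>carrier Z. \<psi> (i z) = z [^]\<^bsub>Z\<^esub> n)"

text \<open>Multiplying a lift by the image of \<open>inv w\<close> divides its value under \<psi>
  by \<open>w [^] n\<close>, so each lift can be moved until that value is one of finitely many
  representatives modulo n-th powers.\<close>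

lemma power_retract_section:
  assumes "power_retract n \<psi>" "finitely_generated Z"
  obtains s where "s \<in> sections E G \<pi>" "finite ((\<lambda>g. \<psi> (s g)) ` carrier G)"
proof -
  have n: "n > 0" and \<psi>: "\<psi> \<in> hom E Z" "\<And>z. z \<in> carrier Z \<Longrightarrow> \<psi> (i z) = z [^]\<^bsub>Z\<^esub> n"
    using assms(1) by (auto simp: power_retract_def)
  interpret \<psi>: group_hom E Z \<psi> using \<psi>(1) by unfold_locales
  obtain F where F: "finite F" "F \<subseteq> carrier Z"
    "\<And>a. a \<in> carrier Z \<Longrightarrow> \<exists>w\<in>carrier Z. \<exists>f\<in>F. a = w [^]\<^bsub>Z\<^esub> n \<otimes>\<^bsub>Z\<^esub> f"
    using Z.finite_power_representatives[OF assms(2) n] by blast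
  obtain t where t: "t \<in> sections E G \<pi>" by (rule section_exists)
  have "\<exists>e\<in>carrier E. \<pi> e = g \<and> \<psi> e \<in> F" if g: "g \<in> carrier G" for g
  proof -
    have tg: "t g \<in> carrier E" "\<pi> (t g) = g" using section_closed[OF t g] section_proj[OF t g] .
    obtain w f where wf: "w \<in> carrier Z" "f \<in> F" "\<psi> (t g) = w [^]\<^bsub>Z\<^esub> n \<otimes>\<^bsub>Z\<^esub> f"
      using F(3)[OF \<psi>.hom_closed[OF tg(1)]] by blast
    have fc: "f \<in> carrier Z" using wf F by blast
    have "\<psi> (i (inv\<^bsub>Z\<^esub> w) \<otimes>\<^bsub>E\<^esub> t g) = inv\<^bsub>Z\<^esub> (w [^]\<^bsub>Z\<^esub> n) \<otimes>\<^bsub>Z\<^esub> (w [^]\<^bsub>Z\<^esub> n \<otimes>\<^bsub>Z\<^esub> f)"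
      using wf(1) tg(1) \<psi>(2)[of "inv\<^bsub>Z\<^esub> w"] \<psi>.hom_mult[OF i.hom_closed[OF Z.inv_closed[OF wf(1)]] tg(1)] wf(3)
      by (simp add: Z.nat_pow_inv del: i.hom_inv)
    also have "\<dots> = f" using wf(1) fc by (simp add: Z.m_assoc[symmetric])
    finally show ?thesis using wf(1,2) tg g
      by (intro bexI[of _ "i (inv\<^bsub>Z\<^esub> w) \<otimes>\<^bsub>E\<^esub> t g"]) simp_all
  qed
  then obtain s where s: "\<And>g. g \<in> carrier G \<Longrightarrow> s g \<in> carrier E \<and> \<pi> (s g) = g \<and> \<psi> (s g) \<in> F" by metis
  show ?thesis
  proof
    show "s \<in> sections E G \<pi>" using s by (auto simp: sections_def)
    show "finite ((\<lambda>g. \<psi> (s g)) ` carrier G)" using s F(1) by (intro finite_subset[OF _ F(1)]) auto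
  qed
qed

text \<open>An increment of \<open>s\<close> along \<open>x\<close> lies over \<open>x\<close>,
  hence equals \<open>i z \<otimes> s x\<close> for some \<open>z\<close>. Applying \<psi> expresses
  \<open>z [^] n\<close> through the values of \<psi> at \<open>s g\<close>,
  \<open>s (g \<otimes> x)\<close> and \<open>s x\<close>; these are finitely many, and so are the
  n-th roots of each result.\<close>

lemma power_retract_imp_lipschitz_section:
  assumes "power_retract n \<psi>" "finitely_generated Z"
  obtains s where "lipschitz_section s"
proof -
  have n: "n > 0" and \<psi>: "\<psi> \<in> hom E Z" "\<And>z. z \<in> carrier Z \<Longrightarrow> \<psi> (i z) = z [^]\<^bsub>Z\<^esub> n"
    using assms(1) by (auto simp: power_retract_def)
  interpret \<psi>: group_hom E Z \<psi> using \<psi>(1) by unfold_locales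
  obtain s where s: "s \<in> sections E G \<pi>" and fin: "finite ((\<lambda>g. \<psi> (s g)) ` carrier G)"
    using power_retract_section[OF assms] .
  have "finite ((\<lambda>g. inv\<^bsub>E\<^esub> (s g) \<otimes>\<^bsub>E\<^esub> s (g \<otimes>\<^bsub>G\<^esub> x)) ` carrier G)" if x: "x \<in> carrier G" for x
  proof (rule finite_subset)
    define Q where "Q = (\<lambda>(a, b). inv\<^bsub>Z\<^esub> a \<otimes>\<^bsub>Z\<^esub> b \<otimes>\<^bsub>Z\<^esub> inv\<^bsub>Z\<^esub> (\<psi> (s x))) `
      ((\<lambda>g. \<psi> (s g)) ` carrier G \<times> (\<lambda>g. \<psi> (s g)) ` carrier G)"
    have "finite Q" unfolding Q_def by (rule finite_imageI[OF finite_cartesian_product[OF fin fin]])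
    then show "finite ((\<lambda>z. i z \<otimes>\<^bsub>E\<^esub> s x) ` {z \<in> carrier Z. z [^]\<^bsub>Z\<^esub> n \<in> Q})"
      using Z.finite_nat_pow_eq[OF assms(2) n] by blast
    show "(\<lambda>g. inv\<^bsub>E\<^esub> (s g) \<otimes>\<^bsub>E\<^esub> s (g \<otimes>\<^bsub>G\<^esub> x)) ` carrier G \<subseteq>
        (\<lambda>z. i z \<otimes>\<^bsub>E\<^esub> s x) ` {z \<in> carrier Z. z [^]\<^bsub>Z\<^esub> n \<in> Q}"
    proof (rule image_subsetI)
      fix g assume g: "g \<in> carrier G"
      let ?d = "inv\<^bsub>E\<^esub> (s g) \<otimes>\<^bsub>E\<^esub> s (g \<otimes>\<^bsub>G\<^esub> x)"
      have sc: "s g \<in> carrier E" "s (g \<otimes>\<^bsub>G\<^esub> x) \<in> carrier E" "s x \<in> carrier E"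
        using s g x by (auto simp: section_closed)
      have "\<pi> ?d = \<pi> (s x)" using sc g x s by (simp add: section_proj G.m_assoc[symmetric])
      then obtain z where z: "z \<in> carrier Z" "?d = i z \<otimes>\<^bsub>E\<^esub> s x"
        using same_fiberE[of ?d "s x"] sc by auto
      have "inv\<^bsub>Z\<^esub> (\<psi> (s g)) \<otimes>\<^bsub>Z\<^esub> \<psi> (s (g \<otimes>\<^bsub>G\<^esub> x)) = \<psi> ?d" using sc by simp
      also have "\<dots> = z [^]\<^bsub>Z\<^esub> n \<otimes>\<^bsub>Z\<^esub> \<psi> (s x)"
        unfolding z(2) using sc z(1) by (simp add: \<psi>(2))
      finally have "inv\<^bsub>Z\<^esub> (\<psi> (s g)) \<otimes>\<^bsub>Z\<^esub> \<psi> (s (g \<otimes>\<^bsub>G\<^esub> x)) \<otimes>\<^bsub>Z\<^esub> inv\<^bsub>Z\<^esub> (\<psi> (s x)) = z [^]\<^bsub>Z\<^esub> n"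
        using sc z by (simp add: Z.m_assoc)
      then have "z [^]\<^bsub>Z\<^esub> n \<in> Q"
        unfolding Q_def using g x
        by (intro image_eqI[of _ _ "(\<psi> (s g), \<psi> (s (g \<otimes>\<^bsub>G\<^esub> x)))"]) auto
      then show "?d \<in> (\<lambda>z. i z \<otimes>\<^bsub>E\<^esub> s x) ` {z \<in> carrier Z. z [^]\<^bsub>Z\<^esub> n \<in> Q}"
        using z by blast
    qed
  qed
  then show ?thesis using that[of s] s by (simp add: lipschitz_section_def)
qed

text \<open>The trivialization provides a multiplicative section \<sigma> over \<open>G'\<close>.
  Write \<open>g\<close> as \<open>a \<otimes> r g\<close> with \<open>a\<close> in
  \<open>G'\<close> and \<open>r g\<close> a fixed representative of its right coset, and lift the
  factors by \<sigma> and by an arbitrary section \<open>t\<close>. In an increment along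
  \<open>x\<close> only \<sigma> of \<open>inv a \<otimes> b\<close> survives, and this argument
  equals \<open>r g \<otimes> x \<otimes> inv (r (g \<otimes> x))\<close>; thus the increment
  depends on two cosets only, of which there are finitely many.\<close>

lemma virtually_trivial_imp_lipschitz_section:
  assumes "virtually_trivial Z E G i \<pi>"
  obtains s where "lipschitz_section s"
proof -
  obtain G' where G': "subgroup G' G" "finite (rcosets\<^bsub>G\<^esub> G')"
    and triv: "trivial_extension Z (E\<lparr>carrier := {e \<in> carrier E. \<pi> e \<in> G'}\<rparr>) (G\<lparr>carrier := G'\<rparr>) i \<pi>"
    using assms unfolding virtually_trivial_def by blast
  interpret G': subgroup G' G by fact
  define E' where "E' = {e \<in> carrier E. \<pi> e \<in> G'}"
  obtain \<Phi> where \<Phi>: "\<Phi> \<in> iso (E\<lparr>carrier := E'\<rparr>) (Z \<times>\<times> (G\<lparr>carrier := G'\<rparr>))"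
    and snd\<Phi>: "\<And>e. e \<in> E' \<Longrightarrow> snd (\<Phi> e) = \<pi> e"
    using triv unfolding trivial_extension_def E'_def by auto
  have hom\<Phi>: "\<Phi> (a \<otimes>\<^bsub>E\<^esub> b) = \<Phi> a \<otimes>\<^bsub>Z \<times>\<times> (G\<lparr>carrier := G'\<rparr>)\<^esub> \<Phi> b" if "a \<in> E'" "b \<in> E'" for a b
    using \<Phi> that by (auto simp: iso_def hom_def)
  have bij: "bij_betw \<Phi> E' (carrier Z \<times> G')" using \<Phi> by (auto simp: iso_def)
  define \<sigma> where "\<sigma> a = inv_into E' \<Phi> (\<one>\<^bsub>Z\<^esub>, a)" for a
  have \<sigma>: "\<sigma> a \<in> E'" "\<Phi> (\<sigma> a) = (\<one>\<^bsub>Z\<^esub>, a)" if "a \<in> G'" for a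
  proof -
    have "(\<one>\<^bsub>Z\<^esub>, a) \<in> \<Phi> ` E'" using bij that by (auto simp: bij_betw_def)
    then show "\<sigma> a \<in> E'" "\<Phi> (\<sigma> a) = (\<one>\<^bsub>Z\<^esub>, a)"
      unfolding \<sigma>_def by (auto simp: inv_into_into f_inv_into_f)
  qed
  have \<sigma>\<pi>: "\<pi> (\<sigma> a) = a" if "a \<in> G'" for a using snd\<Phi>[OF \<sigma>(1)[OF that]] \<sigma>(2)[OF that] by simp
  have \<sigma>E: "\<sigma> a \<in> carrier E" if "a \<in> G'" for a using \<sigma>(1)[OF that] by (simp add: E'_def)
  have \<sigma>_mult: "\<sigma> (a \<otimes>\<^bsub>G\<^esub> b) = \<sigma> a \<otimes>\<^bsub>E\<^esub> \<sigma> b" if "a \<in> G'" "b \<in> G'" for a b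
  proof (rule inj_onD[of \<Phi> E'])
    show "inj_on \<Phi> E'" using bij by (simp add: bij_betw_def)
    show "\<sigma> a \<otimes>\<^bsub>E\<^esub> \<sigma> b \<in> E'" using that \<sigma>E \<sigma>\<pi> by (simp add: E'_def)
    show "\<sigma> (a \<otimes>\<^bsub>G\<^esub> b) \<in> E'" using that \<sigma>(1) by simp
    show "\<Phi> (\<sigma> (a \<otimes>\<^bsub>G\<^esub> b)) = \<Phi> (\<sigma> a \<otimes>\<^bsub>E\<^esub> \<sigma> b)"
      using that \<sigma> by (simp add: hom\<Phi>)
  qed
  define rep where "rep c = (SOME g. g \<in> c)" for c :: "'g set"
  define r where "r g = rep (G' #>\<^bsub>G\<^esub> g)" for g
  have r: "r g \<in> G' #>\<^bsub>G\<^esub> g" if "g \<in> carrier G" for g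
    unfolding r_def rep_def using G.rcos_self[OF that G'(1)] by (rule someI)
  have rc: "r g \<in> carrier G" if g: "g \<in> carrier G" for g
    using r[OF g] G.r_coset_subset_G[OF G'.subset g] by blast
  have ra: "g \<otimes>\<^bsub>G\<^esub> inv\<^bsub>G\<^esub> (r g) \<in> G'" if g: "g \<in> carrier G" for g
  proof -
    have "r g \<otimes>\<^bsub>G\<^esub> inv\<^bsub>G\<^esub> g \<in> G'" using G'.rcos_module_imp[OF G.is_group g r[OF g]] .
    then have "inv\<^bsub>G\<^esub> (r g \<otimes>\<^bsub>G\<^esub> inv\<^bsub>G\<^esub> g) \<in> G'" by simp
    then show ?thesis using g rc[OF g] by (simp add: G.inv_mult_group)
  qed
  obtain t where t: "t \<in> sections E G \<pi>" by (rule section_exists)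
  define s where "s g = \<sigma> (g \<otimes>\<^bsub>G\<^esub> inv\<^bsub>G\<^esub> (r g)) \<otimes>\<^bsub>E\<^esub> t (r g)" for g
  have sE: "s g \<in> carrier E" "\<pi> (s g) = g" if g: "g \<in> carrier G" for g
    using g rc[OF g] ra[OF g] \<sigma>E \<sigma>\<pi> section_closed[OF t] section_proj[OF t]
    by (auto simp: s_def G.m_assoc)
  then have "s \<in> sections E G \<pi>" by (auto simp: sections_def)
  moreover have "finite ((\<lambda>g. inv\<^bsub>E\<^esub> (s g) \<otimes>\<^bsub>E\<^esub> s (g \<otimes>\<^bsub>G\<^esub> x)) ` carrier G)" if x: "x \<in> carrier G" for x
  proof (rule finite_subset)
    let ?K = "\<lambda>(c, d). inv\<^bsub>E\<^esub> (t (rep c)) \<otimes>\<^bsub>E\<^esub> \<sigma> (rep c \<otimes>\<^bsub>G\<^esub> x \<otimes>\<^bsub>G\<^esub> inv\<^bsub>G\<^esub> (rep d)) \<otimes>\<^bsub>E\<^esub> t (rep d)"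
    show "finite (?K ` ((rcosets\<^bsub>G\<^esub> G') \<times> (rcosets\<^bsub>G\<^esub> G')))"
      using G'(2) by (intro finite_imageI finite_cartesian_product)
    show "(\<lambda>g. inv\<^bsub>E\<^esub> (s g) \<otimes>\<^bsub>E\<^esub> s (g \<otimes>\<^bsub>G\<^esub> x)) ` carrier G \<subseteq> ?K ` ((rcosets\<^bsub>G\<^esub> G') \<times> (rcosets\<^bsub>G\<^esub> G'))"
    proof (rule image_subsetI)
      fix g assume g: "g \<in> carrier G"
      let ?h = "g \<otimes>\<^bsub>G\<^esub> x"
      define a where "a = g \<otimes>\<^bsub>G\<^esub> inv\<^bsub>G\<^esub> (r g)"
      define b where "b = ?h \<otimes>\<^bsub>G\<^esub> inv\<^bsub>G\<^esub> (r ?h)"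
      have h: "?h \<in> carrier G" using g x by simp
      have ab: "a \<in> G'" "b \<in> G'" using ra[OF g] ra[OF h] by (auto simp: a_def b_def)
      have "\<sigma> b = \<sigma> (a \<otimes>\<^bsub>G\<^esub> (inv\<^bsub>G\<^esub> a \<otimes>\<^bsub>G\<^esub> b))" using ab by (simp add: G.m_assoc[symmetric])
      also have "\<dots> = \<sigma> a \<otimes>\<^bsub>E\<^esub> \<sigma> (inv\<^bsub>G\<^esub> a \<otimes>\<^bsub>G\<^esub> b)" using ab by (intro \<sigma>_mult) auto
      finally have \<sigma>b: "\<sigma> b = \<sigma> a \<otimes>\<^bsub>E\<^esub> \<sigma> (inv\<^bsub>G\<^esub> a \<otimes>\<^bsub>G\<^esub> b)" .
      have "inv\<^bsub>G\<^esub> a \<otimes>\<^bsub>G\<^esub> b = r g \<otimes>\<^bsub>G\<^esub> (inv\<^bsub>G\<^esub> g \<otimes>\<^bsub>G\<^esub> (g \<otimes>\<^bsub>G\<^esub> (x \<otimes>\<^bsub>G\<^esub> inv\<^bsub>G\<^esub> (r ?h))))"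
        using g x rc[OF g] rc[OF h] by (simp add: a_def b_def G.inv_mult_group G.m_assoc)
      also have "\<dots> = r g \<otimes>\<^bsub>G\<^esub> x \<otimes>\<^bsub>G\<^esub> inv\<^bsub>G\<^esub> (r ?h)"
        using g x rc[OF g] rc[OF h] by (simp add: G.m_assoc) (simp add: G.m_assoc[symmetric])
      finally have ab': "inv\<^bsub>G\<^esub> a \<otimes>\<^bsub>G\<^esub> b = r g \<otimes>\<^bsub>G\<^esub> x \<otimes>\<^bsub>G\<^esub> inv\<^bsub>G\<^esub> (r ?h)" .
      let ?c = "\<sigma> (inv\<^bsub>G\<^esub> a \<otimes>\<^bsub>G\<^esub> b)"
      have cl: "\<sigma> a \<in> carrier E" "?c \<in> carrier E" "t (r g) \<in> carrier E" "t (r ?h) \<in> carrier E"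
        using ab \<sigma>E rc[OF g] rc[OF h] section_closed[OF t] by auto
      have "inv\<^bsub>E\<^esub> (s g) \<otimes>\<^bsub>E\<^esub> s ?h =
          inv\<^bsub>E\<^esub> (t (r g)) \<otimes>\<^bsub>E\<^esub> (inv\<^bsub>E\<^esub> (\<sigma> a) \<otimes>\<^bsub>E\<^esub> (\<sigma> a \<otimes>\<^bsub>E\<^esub> (?c \<otimes>\<^bsub>E\<^esub> t (r ?h))))"
        using cl \<sigma>b unfolding s_def a_def[symmetric] b_def[symmetric]
        by (simp add: E.inv_mult_group E.m_assoc)
      also have "inv\<^bsub>E\<^esub> (\<sigma> a) \<otimes>\<^bsub>E\<^esub> (\<sigma> a \<otimes>\<^bsub>E\<^esub> (?c \<otimes>\<^bsub>E\<^esub> t (r ?h))) = ?c \<otimes>\<^bsub>E\<^esub> t (r ?h)"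
        using cl by (simp add: E.m_assoc[symmetric])
      finally have "inv\<^bsub>E\<^esub> (s g) \<otimes>\<^bsub>E\<^esub> s ?h = ?K (G' #>\<^bsub>G\<^esub> g, G' #>\<^bsub>G\<^esub> ?h)"
        using cl by (simp add: ab' r_def E.m_assoc)
      then show "inv\<^bsub>E\<^esub> (s g) \<otimes>\<^bsub>E\<^esub> s ?h \<in> ?K ` ((rcosets\<^bsub>G\<^esub> G') \<times> (rcosets\<^bsub>G\<^esub> G'))"
        using G.rcosetsI[OF G'.subset g] G.rcosetsI[OF G'.subset h] by blast
    qed
  qed
  ultimately show ?thesis using that[of s] by (simp add: lipschitz_section_def)
qed

text \<open>The \<open>n\<close>-th root of \<open>\<psi>\<close> trivializes the extension over the image of \<open>\<psi>\<^sup>-\<^sup>1(Z\<^sup>n)\<close>.\<close>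

lemma power_retract_imp_virtually_trivial:
  assumes "power_retract n \<psi>" "finitely_generated Z" "torsion_free Z"
  shows "virtually_trivial Z E G i \<pi>"
proof -
  have n: "n > 0" and \<psi>: "\<psi> \<in> hom E Z" "\<And>z. z \<in> carrier Z \<Longrightarrow> \<psi> (i z) = z [^]\<^bsub>Z\<^esub> n"
    using assms(1) by (auto simp: power_retract_def)
  interpret \<psi>: group_hom E Z \<psi> using \<psi>(1) by unfold_locales
  define P where "P = (\<lambda>w. w [^]\<^bsub>Z\<^esub> n) ` carrier Z"
  have P: "subgroup P Z"
  proof (rule Z.subgroupI)
    fix a assume "a \<in> P"
    then obtain w where "w \<in> carrier Z" "a = w [^]\<^bsub>Z\<^esub> n" by (auto simp: P_def)
    then show "inv\<^bsub>Z\<^esub> a \<in> P" unfolding P_def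
      by (intro image_eqI[of _ _ "inv\<^bsub>Z\<^esub> w"]) (auto simp: Z.nat_pow_inv)
  next
    fix a b assume "a \<in> P" "b \<in> P"
    then obtain w v where "w \<in> carrier Z" "a = w [^]\<^bsub>Z\<^esub> n" "v \<in> carrier Z" "b = v [^]\<^bsub>Z\<^esub> n"
      by (auto simp: P_def)
    then show "a \<otimes>\<^bsub>Z\<^esub> b \<in> P" unfolding P_def
      by (intro image_eqI[of _ _ "w \<otimes>\<^bsub>Z\<^esub> v"]) (auto simp: Z.nat_pow_distrib)
  qed (auto simp: P_def)
  interpret P: subgroup P Z by fact
  have root_unique: "w = v" if "w \<in> carrier Z" "v \<in> carrier Z" "w [^]\<^bsub>Z\<^esub> n = v [^]\<^bsub>Z\<^esub> n" for w v
  proof -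
    have "(w \<otimes>\<^bsub>Z\<^esub> inv\<^bsub>Z\<^esub> v) [^]\<^bsub>Z\<^esub> n = \<one>\<^bsub>Z\<^esub>"
      using that by (simp add: Z.nat_pow_distrib Z.nat_pow_inv)
    then have "w \<otimes>\<^bsub>Z\<^esub> inv\<^bsub>Z\<^esub> v = \<one>\<^bsub>Z\<^esub>" using assms(3) n that by (auto simp: torsion_free_def)
    then show ?thesis using that by (metis Z.inv_closed Z.inv_equality Z.inv_inv)
  qed
  define E' where "E' = {e \<in> carrier E. \<psi> e \<in> P}"
  have E': "subgroup E' E"
    by (rule E.subgroupI) (auto simp: E'_def intro!: exI[of _ "\<one>\<^bsub>E\<^esub>"])
  define G' where "G' = \<pi> ` E'"
  have G': "subgroup G' G" unfolding G'_def by (rule \<pi>.subgroup_img_is_subgroup[OF E'])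
  interpret G': subgroup G' G by fact
  have i_E': "i z \<in> E'" if "z \<in> carrier Z" for z
    using that by (auto simp: E'_def \<psi>(2) P_def)
  \<comment> \<open>\<open>E'\<close> contains the whole image of \<open>Z\<close>, so it is
    saturated: it is the full preimage of its image \<open>G'\<close>, as
    \<open>virtually_trivial\<close> demands.\<close>
  have E'_eq: "{e \<in> carrier E. \<pi> e \<in> G'} = E'"
  proof (intro equalityI subsetI)
    fix e assume "e \<in> {e \<in> carrier E. \<pi> e \<in> G'}"
    then obtain e' where e: "e \<in> carrier E" "e' \<in> E'" "\<pi> e = \<pi> e'" by (auto simp: G'_def)
    moreover have "e' \<in> carrier E" using e(2) by (simp add: E'_def)
    ultimately obtain z where "z \<in> carrier Z" "e = i z \<otimes>\<^bsub>E\<^esub> e'" using same_fiberE by metis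
    then show "e \<in> E'" using i_E' e(2) subgroup.m_closed[OF E'] by simp
  qed (auto simp: E'_def G'_def)
  \<comment> \<open>Without torsion an n-th root is unique. Uniqueness makes the root well defined,
    multiplicative, and equal to \<open>z\<close> at \<open>i z\<close>.\<close>
  define \<rho> where "\<rho> e = (THE w. w \<in> carrier Z \<and> w [^]\<^bsub>Z\<^esub> n = \<psi> e)" for e
  have \<rho>_eq: "\<rho> e = w" if "w \<in> carrier Z" "w [^]\<^bsub>Z\<^esub> n = \<psi> e" for e w
    unfolding \<rho>_def by (rule the_equality) (use that root_unique in auto)
  have \<rho>: "\<rho> e \<in> carrier Z \<and> \<rho> e [^]\<^bsub>Z\<^esub> n = \<psi> e" if e: "e \<in> E'" for e
  proof -
    obtain w where "w \<in> carrier Z" "w [^]\<^bsub>Z\<^esub> n = \<psi> e" using e by (auto simp: E'_def P_def)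
    then show ?thesis using \<rho>_eq by blast
  qed
  have \<rho>_mult: "\<rho> (a \<otimes>\<^bsub>E\<^esub> b) = \<rho> a \<otimes>\<^bsub>Z\<^esub> \<rho> b" if "a \<in> E'" "b \<in> E'" for a b
    using \<rho>[OF that(1)] \<rho>[OF that(2)] that
    by (intro \<rho>_eq) (auto simp: Z.nat_pow_distrib E'_def)
  have \<rho>_i: "\<rho> (i z) = z" if "z \<in> carrier Z" for z
    using that by (intro \<rho>_eq) (auto simp: \<psi>(2))
  define \<Phi> where "\<Phi> e = (\<rho> e, \<pi> e)" for e
  have inj: "inj_on \<Phi> E'"
  proof (rule inj_onI)
    fix a b assume ab: "a \<in> E'" "b \<in> E'" "\<Phi> a = \<Phi> b"
    have c: "a \<in> carrier E" "b \<in> carrier E" using ab by (auto simp: E'_def)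
    obtain z where z: "z \<in> carrier Z" "a = i z \<otimes>\<^bsub>E\<^esub> b"
      using same_fiberE[OF c] ab(3) by (auto simp: \<Phi>_def)
    have "\<rho> a = z \<otimes>\<^bsub>Z\<^esub> \<rho> b" using \<rho>_mult[OF i_E'[OF z(1)] ab(2)] z \<rho>_i by simp
    then have "z \<otimes>\<^bsub>Z\<^esub> \<rho> b = \<rho> b" using ab(3) by (simp add: \<Phi>_def)
    then have "z = \<one>\<^bsub>Z\<^esub>" using z \<rho>[OF ab(2)] by (simp add: Z.r_cancel_one')
    then show "a = b" using z c by simp
  qed
  have surj: "\<Phi> ` E' = carrier Z \<times> G'"
  proof (intro equalityI subsetI)
    fix p assume "p \<in> carrier Z \<times> G'"
    then obtain z e where ze: "p = (z, \<pi> e)" "z \<in> carrier Z" "e \<in> E'" by (auto simp: G'_def)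
    define w where "w = z \<otimes>\<^bsub>Z\<^esub> inv\<^bsub>Z\<^esub> (\<rho> e)"
    have w: "w \<in> carrier Z" "w \<otimes>\<^bsub>Z\<^esub> \<rho> e = z" using ze \<rho>[OF ze(3)] by (auto simp: w_def Z.m_assoc)
    have "e \<in> carrier E" using ze by (simp add: E'_def)
    then have "\<Phi> (i w \<otimes>\<^bsub>E\<^esub> e) = p"
      using \<rho>_mult[OF i_E'[OF w(1)] ze(3)] w ze by (simp add: \<Phi>_def \<rho>_i)
    moreover have "i w \<otimes>\<^bsub>E\<^esub> e \<in> E'" using subgroup.m_closed[OF E' i_E'[OF w(1)] ze(3)] .
    ultimately show "p \<in> \<Phi> ` E'" by force
  qed (use \<rho> in \<open>auto simp: \<Phi>_def G'_def\<close>)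
  have "\<Phi> \<in> iso (E\<lparr>carrier := E'\<rparr>) (Z \<times>\<times> (G\<lparr>carrier := G'\<rparr>))"
    unfolding iso_def
  proof (intro CollectI conjI homI)
    show "bij_betw \<Phi> (carrier (E\<lparr>carrier := E'\<rparr>)) (carrier (Z \<times>\<times> (G\<lparr>carrier := G'\<rparr>)))"
      using inj surj by (simp add: bij_betw_def)
    show "\<Phi> a \<in> carrier (Z \<times>\<times> (G\<lparr>carrier := G'\<rparr>))" if "a \<in> carrier (E\<lparr>carrier := E'\<rparr>)" for a
      using surj that by auto
    show "\<Phi> (a \<otimes>\<^bsub>E\<lparr>carrier := E'\<rparr>\<^esub> b) = \<Phi> a \<otimes>\<^bsub>Z \<times>\<times> (G\<lparr>carrier := G'\<rparr>)\<^esub> \<Phi> b"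
      if "a \<in> carrier (E\<lparr>carrier := E'\<rparr>)" "b \<in> carrier (E\<lparr>carrier := E'\<rparr>)" for a b
      using that \<rho>_mult by (simp add: \<Phi>_def E'_def)
  qed
  then have "trivial_extension Z (E\<lparr>carrier := E'\<rparr>) (G\<lparr>carrier := G'\<rparr>) i \<pi>"
    unfolding trivial_extension_def by (rule bexI[rotated]) (auto simp: \<Phi>_def \<rho>_i)
  moreover have "finite (rcosets\<^bsub>G\<^esub> G')"
  proof -
    obtain s where s: "s \<in> sections E G \<pi>" and fin: "finite ((\<lambda>g. \<psi> (s g)) ` carrier G)"
      using power_retract_section[OF assms(1,2)] .
    \<comment> \<open>Equal values of \<psi> at \<open>s g\<close> and \<open>s h\<close> place
      \<open>s g \<otimes> inv (s h)\<close> in the kernel of \<psi>, which lies in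
      \<open>E'\<close>; so \<open>g\<close> and \<open>h\<close> share a right coset of
      \<open>G'\<close>.\<close>
    have "finite ((\<lambda>g. G' #>\<^bsub>G\<^esub> g) ` carrier G)"
    proof (rule finite_image_factor[OF fin])
      fix g h assume gh: "g \<in> carrier G" "h \<in> carrier G" "\<psi> (s g) = \<psi> (s h)"
      have sc: "s g \<in> carrier E" "s h \<in> carrier E" using section_closed[OF s] gh by auto
      have "s g \<otimes>\<^bsub>E\<^esub> inv\<^bsub>E\<^esub> (s h) \<in> E'" using sc gh(3) by (simp add: E'_def)
      moreover have "\<pi> (s g \<otimes>\<^bsub>E\<^esub> inv\<^bsub>E\<^esub> (s h)) = g \<otimes>\<^bsub>G\<^esub> inv\<^bsub>G\<^esub> h"
        using sc gh section_proj[OF s] by simp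
      ultimately have "g \<otimes>\<^bsub>G\<^esub> inv\<^bsub>G\<^esub> h \<in> G'" unfolding G'_def by force
      then have "g \<in> G' #>\<^bsub>G\<^esub> h" using G'.rcos_module_rev[OF G.is_group gh(2,1)] by simp
      then show "G' #>\<^bsub>G\<^esub> g = G' #>\<^bsub>G\<^esub> h" using G.repr_independence[OF _ gh(2) G'] by simp
    qed
    moreover have "rcosets\<^bsub>G\<^esub> G' = (\<lambda>g. G' #>\<^bsub>G\<^esub> g) ` carrier G" by (auto simp: RCOSETS_def)
    ultimately show ?thesis by simp
  qed
  ultimately show ?thesis unfolding virtually_trivial_def using G' E'_eq by auto
qed

end

section \<open>The Euler class\<close>

lemma comm_group_real: "comm_group (add_monoid real_ring)"
proof (rule comm_groupI)
  fix x assume "x \<in> carrier (add_monoid real_ring)"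
  show "\<exists>y\<in>carrier (add_monoid real_ring). y \<otimes>\<^bsub>add_monoid real_ring\<^esub> x = \<one>\<^bsub>add_monoid real_ring\<^esub>"
    by (intro bexI[of _ "- x"]) (simp_all add: real_ring_def)
qed (simp_all add: real_ring_def)

lemma (in group) hom_derived_eq_one:
  assumes "comm_group W" "\<Psi> \<in> hom G W" "x \<in> derived G (carrier G)"
  shows "\<Psi> x = \<one>\<^bsub>W\<^esub>"
proof -
  interpret W: comm_group W by fact
  interpret \<Psi>: group_hom G W \<Psi> using assms(2) by unfold_locales
  have "derived_set G (carrier G) \<subseteq> kernel G W \<Psi>"
  proof
    fix x assume "x \<in> derived_set G (carrier G)"
    then obtain a b where ab: "a \<in> carrier G" "b \<in> carrier G" "x = a \<otimes> b \<otimes> inv a \<otimes> inv b" by blast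
    then have "\<Psi> x = \<Psi> a \<otimes>\<^bsub>W\<^esub> \<Psi> b \<otimes>\<^bsub>W\<^esub> (inv\<^bsub>W\<^esub> (\<Psi> a) \<otimes>\<^bsub>W\<^esub> inv\<^bsub>W\<^esub> (\<Psi> b))"
      by (simp add: W.m_assoc)
    also have "\<dots> = \<one>\<^bsub>W\<^esub>" using ab by (simp flip: W.inv_mult)
    finally show "x \<in> kernel G W \<Psi>" using ab by (simp add: kernel_def)
  qed
  from generate_subgroup_incl[OF this \<Psi>.subgroup_kernel] assms(3)
  show ?thesis by (auto simp: derived_def kernel_def)
qed

context central_extension
begin

section \<open>The cocycle of a section, and extending homomorphisms from \<open>Z\<close> to
  \<open>E\<close>\<close>

abbreviation \<omega> :: "('g \<Rightarrow> 'e) \<Rightarrow> 'g \<times> 'g \<Rightarrow> 'z" where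
  "\<omega> \<equiv> section_cocycle Z E G i"

lemma i_section_cocycle:
  assumes "s \<in> sections E G \<pi>" "g \<in> carrier G" "h \<in> carrier G"
  shows "\<omega> s (g, h) \<in> carrier Z"
    and "i (\<omega> s (g, h)) = s g \<otimes>\<^bsub>E\<^esub> s h \<otimes>\<^bsub>E\<^esub> inv\<^bsub>E\<^esub> (s (g \<otimes>\<^bsub>G\<^esub> h))"
    and "s g \<otimes>\<^bsub>E\<^esub> s h = i (\<omega> s (g, h)) \<otimes>\<^bsub>E\<^esub> s (g \<otimes>\<^bsub>G\<^esub> h)"
proof -
  let ?x = "s g \<otimes>\<^bsub>E\<^esub> s h \<otimes>\<^bsub>E\<^esub> inv\<^bsub>E\<^esub> (s (g \<otimes>\<^bsub>G\<^esub> h))"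
  have sc: "s g \<in> carrier E" "s h \<in> carrier E" "s (g \<otimes>\<^bsub>G\<^esub> h) \<in> carrier E"
    using assms section_closed by auto
  have "?x \<in> kernel E G \<pi>" using assms sc by (simp add: kernel_def section_proj)
  then have x: "?x \<in> i ` carrier Z" using exact by simp
  have eq: "\<omega> s (g, h) = inv_into (carrier Z) i ?x"
    using assms by (simp add: section_cocycle_def)
  show "\<omega> s (g, h) \<in> carrier Z" unfolding eq using x by (rule inv_into_into)
  show i\<omega>: "i (\<omega> s (g, h)) = ?x" unfolding eq using x by (rule f_inv_into_f)
  show "s g \<otimes>\<^bsub>E\<^esub> s h = i (\<omega> s (g, h)) \<otimes>\<^bsub>E\<^esub> s (g \<otimes>\<^bsub>G\<^esub> h)"
    unfolding i\<omega> using sc by (simp add: E.m_assoc)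
qed

text \<open>Associativity of \<open>s g \<otimes> s h \<otimes> s k\<close>: both bracketings are
  brought to the form \<open>i z \<otimes> s (g \<otimes> h \<otimes> k)\<close>, whose coordinate
  \<open>z\<close> is unique.\<close>

lemma section_cocycle_in_cocycles2:
  assumes s: "s \<in> sections E G \<pi>"
  shows "\<omega> s \<in> cocycles2 G Z"
proof -
  note \<omega> = i_section_cocycle[OF s]
  have sc: "s g \<in> carrier E" if "g \<in> carrier G" for g using section_closed[OF s that] .
  have "\<omega> s (h, k) \<otimes>\<^bsub>Z\<^esub> \<omega> s (g, h \<otimes>\<^bsub>G\<^esub> k) = \<omega> s (g \<otimes>\<^bsub>G\<^esub> h, k) \<otimes>\<^bsub>Z\<^esub> \<omega> s (g, h)"
    if g: "g \<in> carrier G" and h: "h \<in> carrier G" and k: "k \<in> carrier G" for g h k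
  proof -
    have gh: "g \<otimes>\<^bsub>G\<^esub> h \<in> carrier G" and hk: "h \<otimes>\<^bsub>G\<^esub> k \<in> carrier G"
      and ghk: "g \<otimes>\<^bsub>G\<^esub> h \<otimes>\<^bsub>G\<^esub> k \<in> carrier G" using g h k by auto
    have "s g \<otimes>\<^bsub>E\<^esub> (s h \<otimes>\<^bsub>E\<^esub> s k) = (i \<one>\<^bsub>Z\<^esub> \<otimes>\<^bsub>E\<^esub> s g) \<otimes>\<^bsub>E\<^esub> (i (\<omega> s (h, k)) \<otimes>\<^bsub>E\<^esub> s (h \<otimes>\<^bsub>G\<^esub> k))"
      using \<omega>(3)[OF h k] sc g by simp
    also have "\<dots> = i (\<omega> s (h, k)) \<otimes>\<^bsub>E\<^esub> (s g \<otimes>\<^bsub>E\<^esub> s (h \<otimes>\<^bsub>G\<^esub> k))"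
      using \<omega>(1)[OF h k] sc[OF g] sc[OF hk] by (subst i_mult_mult) auto
    also have "\<dots> = i (\<omega> s (h, k) \<otimes>\<^bsub>Z\<^esub> \<omega> s (g, h \<otimes>\<^bsub>G\<^esub> k)) \<otimes>\<^bsub>E\<^esub> s (g \<otimes>\<^bsub>G\<^esub> h \<otimes>\<^bsub>G\<^esub> k)"
      using \<omega>(3)[OF g hk] \<omega>(1)[OF h k] \<omega>(1)[OF g hk] sc[OF ghk] g h k
      by (simp add: E.m_assoc G.m_assoc)
    finally have 1: "s g \<otimes>\<^bsub>E\<^esub> (s h \<otimes>\<^bsub>E\<^esub> s k) =
      i (\<omega> s (h, k) \<otimes>\<^bsub>Z\<^esub> \<omega> s (g, h \<otimes>\<^bsub>G\<^esub> k)) \<otimes>\<^bsub>E\<^esub> s (g \<otimes>\<^bsub>G\<^esub> h \<otimes>\<^bsub>G\<^esub> k)" .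
    have "(s g \<otimes>\<^bsub>E\<^esub> s h) \<otimes>\<^bsub>E\<^esub> s k = i (\<omega> s (g, h)) \<otimes>\<^bsub>E\<^esub> (s (g \<otimes>\<^bsub>G\<^esub> h) \<otimes>\<^bsub>E\<^esub> s k)"
      using \<omega>(3)[OF g h] \<omega>(1)[OF g h] sc[OF gh] sc[OF k] by (simp add: E.m_assoc)
    also have "\<dots> = i (\<omega> s (g, h) \<otimes>\<^bsub>Z\<^esub> \<omega> s (g \<otimes>\<^bsub>G\<^esub> h, k)) \<otimes>\<^bsub>E\<^esub> s (g \<otimes>\<^bsub>G\<^esub> h \<otimes>\<^bsub>G\<^esub> k)"
      using \<omega>(3)[OF gh k] \<omega>(1)[OF g h] \<omega>(1)[OF gh k] sc[OF ghk] by (simp add: E.m_assoc)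
    finally have "i (\<omega> s (h, k) \<otimes>\<^bsub>Z\<^esub> \<omega> s (g, h \<otimes>\<^bsub>G\<^esub> k)) \<otimes>\<^bsub>E\<^esub> s (g \<otimes>\<^bsub>G\<^esub> h \<otimes>\<^bsub>G\<^esub> k) =
      i (\<omega> s (g, h) \<otimes>\<^bsub>Z\<^esub> \<omega> s (g \<otimes>\<^bsub>G\<^esub> h, k)) \<otimes>\<^bsub>E\<^esub> s (g \<otimes>\<^bsub>G\<^esub> h \<otimes>\<^bsub>G\<^esub> k)"
      using 1 sc g h k by (simp add: E.m_assoc)
    from section_decomp_unique[OF s _ _ ghk ghk this]
    have "\<omega> s (h, k) \<otimes>\<^bsub>Z\<^esub> \<omega> s (g, h \<otimes>\<^bsub>G\<^esub> k) = \<omega> s (g, h) \<otimes>\<^bsub>Z\<^esub> \<omega> s (g \<otimes>\<^bsub>G\<^esub> h, k)"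
      using \<omega>(1) g h k by simp
    then show ?thesis using \<omega>(1)[OF g h] \<omega>(1)[OF gh k] by (simp add: Z.m_comm)
  qed
  then show ?thesis
    using \<omega>(1) by (auto simp: cocycles2_def section_cocycle_def)
qed

text \<open>In the coordinates \<open>i z \<otimes> s g\<close> put \<Psi> equal to
  \<open>\<alpha> z \<otimes> \<phi> g\<close>; the coboundary relation cancels the cocycle that
  arises in a product. The target \<open>W\<close> is general because the lemma is applied both to
  the reals, for characters, and to \<open>Z\<close> itself, for power maps.\<close>

lemma extend_hom_of_coboundary:
  assumes s: "s \<in> sections E G \<pi>" and W: "comm_group W" and \<alpha>: "\<alpha> \<in> hom Z W"
    and \<phi>: "\<And>g. g \<in> carrier G \<Longrightarrow> \<phi> g \<in> carrier W"
    and coboundary: "\<And>g h. g \<in> carrier G \<Longrightarrow> h \<in> carrier G \<Longrightarrow>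
      \<alpha> (\<omega> s (g, h)) = \<phi> h \<otimes>\<^bsub>W\<^esub> inv\<^bsub>W\<^esub> (\<phi> (g \<otimes>\<^bsub>G\<^esub> h)) \<otimes>\<^bsub>W\<^esub> \<phi> g"
  obtains \<Psi> where "\<Psi> \<in> hom E W" "\<And>z. z \<in> carrier Z \<Longrightarrow> \<Psi> (i z) = \<alpha> z"
proof -
  interpret W: comm_group W by fact
  interpret \<alpha>: group_hom Z W \<alpha> using \<alpha> by unfold_locales
  have sc: "s g \<in> carrier E" if "g \<in> carrier G" for g using section_closed[OF s that] .
  have "\<exists>z. z \<in> carrier Z \<and> e = i z \<otimes>\<^bsub>E\<^esub> s (\<pi> e)" if "e \<in> carrier E" for e
    using section_decomp[OF s that] by metis
  then obtain \<zeta> where \<zeta>: "\<And>e. e \<in> carrier E \<Longrightarrow> \<zeta> e \<in> carrier Z"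
      "\<And>e. e \<in> carrier E \<Longrightarrow> e = i (\<zeta> e) \<otimes>\<^bsub>E\<^esub> s (\<pi> e)" by metis
  have \<zeta>_eq: "\<zeta> (i z \<otimes>\<^bsub>E\<^esub> s g) = z" if "z \<in> carrier Z" "g \<in> carrier G" for z g
  proof -
    have c: "i z \<otimes>\<^bsub>E\<^esub> s g \<in> carrier E" using that sc by simp
    have "i (\<zeta> (i z \<otimes>\<^bsub>E\<^esub> s g)) \<otimes>\<^bsub>E\<^esub> s (\<pi> (i z \<otimes>\<^bsub>E\<^esub> s g)) = i z \<otimes>\<^bsub>E\<^esub> s g"
      using \<zeta>(2)[OF c] by simp
    from section_decomp_unique[OF s _ _ _ _ this] show ?thesis using \<zeta>(1)[OF c] c that by simp
  qed
  define \<Psi> where "\<Psi> e = \<alpha> (\<zeta> e) \<otimes>\<^bsub>W\<^esub> \<phi> (\<pi> e)" for e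
  have \<Psi>: "\<Psi> (i z \<otimes>\<^bsub>E\<^esub> s g) = \<alpha> z \<otimes>\<^bsub>W\<^esub> \<phi> g" if "z \<in> carrier Z" "g \<in> carrier G" for z g
    using that sc \<zeta>_eq[OF that] section_proj[OF s] by (simp add: \<Psi>_def)
  have hom: "\<Psi> \<in> hom E W"
  proof (rule homI)
    fix x y assume xy: "x \<in> carrier E" "y \<in> carrier E"
    show "\<Psi> x \<in> carrier W" using xy(1) \<zeta>(1) \<phi> by (simp add: \<Psi>_def)
    define g h where "g = \<pi> x" and "h = \<pi> y"
    have gh: "g \<in> carrier G" "h \<in> carrier G" using xy by (auto simp: g_def h_def)
    let ?w = "\<omega> s (g, h)"
    have w: "?w \<in> carrier Z" using i_section_cocycle(1)[OF s gh] .
    have "x \<otimes>\<^bsub>E\<^esub> y = (i (\<zeta> x) \<otimes>\<^bsub>E\<^esub> s g) \<otimes>\<^bsub>E\<^esub> (i (\<zeta> y) \<otimes>\<^bsub>E\<^esub> s h)"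
      using \<zeta>(2)[OF xy(1)] \<zeta>(2)[OF xy(2)] by (simp add: g_def h_def)
    also have "\<dots> = i (\<zeta> x \<otimes>\<^bsub>Z\<^esub> \<zeta> y) \<otimes>\<^bsub>E\<^esub> (s g \<otimes>\<^bsub>E\<^esub> s h)"
      using \<zeta>(1) xy sc gh by (intro i_mult_mult) auto
    also have "\<dots> = i (\<zeta> x \<otimes>\<^bsub>Z\<^esub> \<zeta> y \<otimes>\<^bsub>Z\<^esub> ?w) \<otimes>\<^bsub>E\<^esub> s (g \<otimes>\<^bsub>G\<^esub> h)"
      using i_section_cocycle(3)[OF s gh] \<zeta>(1) xy sc gh w by (simp add: E.m_assoc)
    finally have prod: "x \<otimes>\<^bsub>E\<^esub> y = i (\<zeta> x \<otimes>\<^bsub>Z\<^esub> \<zeta> y \<otimes>\<^bsub>Z\<^esub> ?w) \<otimes>\<^bsub>E\<^esub> s (g \<otimes>\<^bsub>G\<^esub> h)" .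
    have "\<Psi> (x \<otimes>\<^bsub>E\<^esub> y) = \<alpha> (\<zeta> x \<otimes>\<^bsub>Z\<^esub> \<zeta> y \<otimes>\<^bsub>Z\<^esub> ?w) \<otimes>\<^bsub>W\<^esub> \<phi> (g \<otimes>\<^bsub>G\<^esub> h)"
      unfolding prod using \<zeta>(1) xy gh w by (intro \<Psi> Z.m_closed G.m_closed)
    also have "\<dots> = \<alpha> (\<zeta> x) \<otimes>\<^bsub>W\<^esub> \<alpha> (\<zeta> y) \<otimes>\<^bsub>W\<^esub> (\<phi> h \<otimes>\<^bsub>W\<^esub> inv\<^bsub>W\<^esub> (\<phi> (g \<otimes>\<^bsub>G\<^esub> h)) \<otimes>\<^bsub>W\<^esub> \<phi> g) \<otimes>\<^bsub>W\<^esub> \<phi> (g \<otimes>\<^bsub>G\<^esub> h)"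
      using \<zeta>(1) xy w coboundary[OF gh] by simp
    also have "\<dots> = \<alpha> (\<zeta> x) \<otimes>\<^bsub>W\<^esub> \<phi> g \<otimes>\<^bsub>W\<^esub> (\<alpha> (\<zeta> y) \<otimes>\<^bsub>W\<^esub> \<phi> h) \<otimes>\<^bsub>W\<^esub> (inv\<^bsub>W\<^esub> (\<phi> (g \<otimes>\<^bsub>G\<^esub> h)) \<otimes>\<^bsub>W\<^esub> \<phi> (g \<otimes>\<^bsub>G\<^esub> h))"
      using \<zeta>(1) xy gh \<phi> by (simp add: W.m_ac del: W.l_inv)
    also have "\<dots> = \<Psi> x \<otimes>\<^bsub>W\<^esub> \<Psi> y"
      using \<zeta>(1) xy gh \<phi> by (simp add: \<Psi>_def g_def h_def)
    finally show "\<Psi> (x \<otimes>\<^bsub>E\<^esub> y) = \<Psi> x \<otimes>\<^bsub>W\<^esub> \<Psi> y" .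
  qed
  interpret \<Psi>: group_hom E W \<Psi> using hom by unfold_locales
  have "\<Psi> (i z) = \<alpha> z" if z: "z \<in> carrier Z" for z
  proof -
    \<comment> \<open>The section need not send 1 to 1, so \<open>i z\<close> has coordinate
      \<open>z \<otimes> u\<close> rather than \<open>z\<close>. The correction disappears because
      \<Psi> of the identity is \<open>\<alpha> u \<otimes> \<phi> \<one>\<close>, which is
      trivial.\<close>
    obtain u where u: "u \<in> carrier Z" "\<one>\<^bsub>E\<^esub> = i u \<otimes>\<^bsub>E\<^esub> s \<one>\<^bsub>G\<^esub>"
      using section_decomp[OF s E.one_closed] by auto
    have "i z = i (z \<otimes>\<^bsub>Z\<^esub> u) \<otimes>\<^bsub>E\<^esub> s \<one>\<^bsub>G\<^esub>"
      using z u sc[OF G.one_closed] by (metis E.m_assoc E.r_one i.hom_closed i.hom_mult)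
    then have "\<Psi> (i z) = \<alpha> z \<otimes>\<^bsub>W\<^esub> (\<alpha> u \<otimes>\<^bsub>W\<^esub> \<phi> \<one>\<^bsub>G\<^esub>)"
      using \<Psi>[of "z \<otimes>\<^bsub>Z\<^esub> u" "\<one>\<^bsub>G\<^esub>"] z u \<phi> by (simp add: W.m_assoc)
    also have "\<alpha> u \<otimes>\<^bsub>W\<^esub> \<phi> \<one>\<^bsub>G\<^esub> = \<one>\<^bsub>W\<^esub>"
      using \<Psi>[OF u(1) G.one_closed] u(2) \<Psi>.hom_one by simp
    finally show ?thesis using z by simp
  qed
  then show ?thesis using that hom by blast
qed

section \<open>The group of cocycles and its subgroup of coboundaries\<close>

lemma subgroup_cocycles2:
  "subgroup (cocycles2 G Z) (product_group (carrier G \<times> carrier G) (\<lambda>_. Z))" (is "subgroup _ ?P")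
proof -
  interpret P: group ?P by (rule product_group) (rule Z.is_group)
  have inv: "inv\<^bsub>?P\<^esub> \<alpha> = (\<lambda>x\<in>carrier G \<times> carrier G. inv\<^bsub>Z\<^esub> (\<alpha> x))"
    if "\<alpha> \<in> cocycles2 G Z" for \<alpha>
    using that by (intro inv_product_group) (auto simp: cocycles2_def Z.is_group)
  show ?thesis
  proof (rule P.subgroupI)
    show "cocycles2 G Z \<subseteq> carrier ?P" by (auto simp: cocycles2_def)
    have "(\<lambda>x\<in>carrier G \<times> carrier G. \<one>\<^bsub>Z\<^esub>) \<in> cocycles2 G Z" by (simp add: cocycles2_def)
    then show "cocycles2 G Z \<noteq> {}" by blast
  next
    fix \<alpha> assume \<alpha>: "\<alpha> \<in> cocycles2 G Z"
    then have c: "\<alpha> (g, h) \<in> carrier Z" if "g \<in> carrier G" "h \<in> carrier G" for g h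
      using that by (auto simp: cocycles2_def)
    show "inv\<^bsub>?P\<^esub> \<alpha> \<in> cocycles2 G Z"
      using \<alpha> c by (auto simp: inv cocycles2_def simp flip: Z.inv_mult)
  next
    fix \<alpha> \<beta> assume \<alpha>: "\<alpha> \<in> cocycles2 G Z" and \<beta>: "\<beta> \<in> cocycles2 G Z"
    have c: "\<gamma> (g, h) \<in> carrier Z" if "g \<in> carrier G" "h \<in> carrier G" "\<gamma> \<in> cocycles2 G Z" for g h \<gamma>
      using that by (auto simp: cocycles2_def)
    have coc: "\<gamma> (h, k) \<otimes>\<^bsub>Z\<^esub> \<gamma> (g, h \<otimes>\<^bsub>G\<^esub> k) = \<gamma> (g \<otimes>\<^bsub>G\<^esub> h, k) \<otimes>\<^bsub>Z\<^esub> \<gamma> (g, h)"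
      if "g \<in> carrier G" "h \<in> carrier G" "k \<in> carrier G" "\<gamma> \<in> cocycles2 G Z" for g h k \<gamma>
      using that by (auto simp: cocycles2_def)
    have "(\<alpha> (h, k) \<otimes>\<^bsub>Z\<^esub> \<beta> (h, k)) \<otimes>\<^bsub>Z\<^esub> (\<alpha> (g, h \<otimes>\<^bsub>G\<^esub> k) \<otimes>\<^bsub>Z\<^esub> \<beta> (g, h \<otimes>\<^bsub>G\<^esub> k)) =
        (\<alpha> (g \<otimes>\<^bsub>G\<^esub> h, k) \<otimes>\<^bsub>Z\<^esub> \<beta> (g \<otimes>\<^bsub>G\<^esub> h, k)) \<otimes>\<^bsub>Z\<^esub> (\<alpha> (g, h) \<otimes>\<^bsub>Z\<^esub> \<beta> (g, h))"
      if gh: "g \<in> carrier G" "h \<in> carrier G" and k: "k \<in> carrier G" for g h k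
    proof -
      have swap: "(a \<otimes>\<^bsub>Z\<^esub> b) \<otimes>\<^bsub>Z\<^esub> (a' \<otimes>\<^bsub>Z\<^esub> b') = (a \<otimes>\<^bsub>Z\<^esub> a') \<otimes>\<^bsub>Z\<^esub> (b \<otimes>\<^bsub>Z\<^esub> b')"
        if "a \<in> carrier Z" "b \<in> carrier Z" "a' \<in> carrier Z" "b' \<in> carrier Z" for a b a' b'
        using that by (simp add: Z.m_ac)
      have "(\<alpha> (h, k) \<otimes>\<^bsub>Z\<^esub> \<beta> (h, k)) \<otimes>\<^bsub>Z\<^esub> (\<alpha> (g, h \<otimes>\<^bsub>G\<^esub> k) \<otimes>\<^bsub>Z\<^esub> \<beta> (g, h \<otimes>\<^bsub>G\<^esub> k)) =
          (\<alpha> (h, k) \<otimes>\<^bsub>Z\<^esub> \<alpha> (g, h \<otimes>\<^bsub>G\<^esub> k)) \<otimes>\<^bsub>Z\<^esub> (\<beta> (h, k) \<otimes>\<^bsub>Z\<^esub> \<beta> (g, h \<otimes>\<^bsub>G\<^esub> k))"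
        using gh k \<alpha> \<beta> c by (intro swap) auto
      also have "\<dots> = (\<alpha> (g \<otimes>\<^bsub>G\<^esub> h, k) \<otimes>\<^bsub>Z\<^esub> \<alpha> (g, h)) \<otimes>\<^bsub>Z\<^esub> (\<beta> (g \<otimes>\<^bsub>G\<^esub> h, k) \<otimes>\<^bsub>Z\<^esub> \<beta> (g, h))"
        by (simp only: coc[OF gh k \<alpha>] coc[OF gh k \<beta>])
      also have "\<dots> = (\<alpha> (g \<otimes>\<^bsub>G\<^esub> h, k) \<otimes>\<^bsub>Z\<^esub> \<beta> (g \<otimes>\<^bsub>G\<^esub> h, k)) \<otimes>\<^bsub>Z\<^esub> (\<alpha> (g, h) \<otimes>\<^bsub>Z\<^esub> \<beta> (g, h))"
        using gh k \<alpha> \<beta> c by (intro swap) auto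
      finally show ?thesis .
    qed
    then show "\<alpha> \<otimes>\<^bsub>?P\<^esub> \<beta> \<in> cocycles2 G Z"
      using c[OF _ _ \<alpha>] c[OF _ _ \<beta>] by (auto simp: cocycles2_def)
  qed
qed

lemma cocycle_group2_simps [simp]:
  "carrier (cocycle_group2 G Z) = cocycles2 G Z"
  "\<alpha> \<otimes>\<^bsub>cocycle_group2 G Z\<^esub> \<beta> = (\<lambda>x\<in>carrier G \<times> carrier G. \<alpha> x \<otimes>\<^bsub>Z\<^esub> \<beta> x)"
  "\<one>\<^bsub>cocycle_group2 G Z\<^esub> = (\<lambda>x\<in>carrier G \<times> carrier G. \<one>\<^bsub>Z\<^esub>)"
  by (simp_all add: cocycle_group2_def)

lemma cocycles2_closed: "\<alpha> \<in> cocycles2 G Z \<Longrightarrow> g \<in> carrier G \<Longrightarrow> h \<in> carrier G \<Longrightarrow> \<alpha> (g, h) \<in> carrier Z"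
  by (auto simp: cocycles2_def)

lemma comm_group_cocycle_group2: "comm_group (cocycle_group2 G Z)"
proof (rule group.group_comm_groupI)
  interpret P: group "product_group (carrier G \<times> carrier G) (\<lambda>_. Z)"
    by (rule product_group) (rule Z.is_group)
  show "group (cocycle_group2 G Z)"
    unfolding cocycle_group2_def by (rule P.subgroup_imp_group[OF subgroup_cocycles2])
  show "\<alpha> \<otimes>\<^bsub>cocycle_group2 G Z\<^esub> \<beta> = \<beta> \<otimes>\<^bsub>cocycle_group2 G Z\<^esub> \<alpha>"
    if "\<alpha> \<in> carrier (cocycle_group2 G Z)" "\<beta> \<in> carrier (cocycle_group2 G Z)" for \<alpha> \<beta>
    using that by (auto intro!: restrict_ext Z.m_comm simp: cocycles2_closed)
qed

lemma cocycle_group2_pow: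
  fixes n :: nat
  assumes "\<alpha> \<in> cocycles2 G Z"
  shows "\<alpha> [^]\<^bsub>cocycle_group2 G Z\<^esub> n = (\<lambda>x\<in>carrier G \<times> carrier G. \<alpha> x [^]\<^bsub>Z\<^esub> n)"
  by (induction n) (auto intro!: restrict_ext)

definition \<delta> :: "('g \<Rightarrow> 'z) \<Rightarrow> 'g \<times> 'g \<Rightarrow> 'z" where
  "\<delta> \<phi> = (\<lambda>(g, h)\<in>carrier G \<times> carrier G. \<phi> h \<otimes>\<^bsub>Z\<^esub> inv\<^bsub>Z\<^esub> (\<phi> (g \<otimes>\<^bsub>G\<^esub> h)) \<otimes>\<^bsub>Z\<^esub> \<phi> g)"

text \<open>\<delta> reads its cochain on the carrier only, so restriction is harmless and cochains
  that are not extensional can serve as witnesses.\<close>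

lemma coboundaries2_iff: "\<alpha> \<in> coboundaries2 G Z \<longleftrightarrow> (\<exists>\<phi>\<in>carrier G \<rightarrow> carrier Z. \<alpha> = \<delta> \<phi>)"
proof
  assume "\<exists>\<phi>\<in>carrier G \<rightarrow> carrier Z. \<alpha> = \<delta> \<phi>"
  then obtain \<phi> where \<phi>: "\<phi> \<in> carrier G \<rightarrow> carrier Z" "\<alpha> = \<delta> \<phi>" by blast
  then have "\<alpha> = \<delta> (restrict \<phi> (carrier G))"
    by (auto simp: \<delta>_def intro!: restrict_ext)
  moreover have "restrict \<phi> (carrier G) \<in> carrier G \<rightarrow>\<^sub>E carrier Z" using \<phi>(1) by auto
  ultimately show "\<alpha> \<in> coboundaries2 G Z"
    unfolding coboundaries2_def \<delta>_def by (rule image_eqI)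
qed (auto simp: coboundaries2_def \<delta>_def)

lemma \<delta>_apply [simp]:
  "g \<in> carrier G \<Longrightarrow> h \<in> carrier G \<Longrightarrow> \<delta> \<phi> (g, h) = \<phi> h \<otimes>\<^bsub>Z\<^esub> inv\<^bsub>Z\<^esub> (\<phi> (g \<otimes>\<^bsub>G\<^esub> h)) \<otimes>\<^bsub>Z\<^esub> \<phi> g"
  by (simp add: \<delta>_def)

lemma \<delta>_cocycle:
  assumes "\<phi> \<in> carrier G \<rightarrow> carrier Z"
  shows "\<delta> \<phi> \<in> cocycles2 G Z"
proof -
  have c: "\<phi> g \<in> carrier Z" if "g \<in> carrier G" for g using assms that by auto
  have "\<delta> \<phi> (h, k) \<otimes>\<^bsub>Z\<^esub> \<delta> \<phi> (g, h \<otimes>\<^bsub>G\<^esub> k) = \<delta> \<phi> (g \<otimes>\<^bsub>G\<^esub> h, k) \<otimes>\<^bsub>Z\<^esub> \<delta> \<phi> (g, h)"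
    if gh: "g \<in> carrier G" "h \<in> carrier G" "k \<in> carrier G" for g h k
  proof -
    have cancel: "(x \<otimes>\<^bsub>Z\<^esub> inv\<^bsub>Z\<^esub> u \<otimes>\<^bsub>Z\<^esub> y) \<otimes>\<^bsub>Z\<^esub> (u \<otimes>\<^bsub>Z\<^esub> v \<otimes>\<^bsub>Z\<^esub> w) = x \<otimes>\<^bsub>Z\<^esub> y \<otimes>\<^bsub>Z\<^esub> v \<otimes>\<^bsub>Z\<^esub> w"
      if "x \<in> carrier Z" "u \<in> carrier Z" "y \<in> carrier Z" "v \<in> carrier Z" "w \<in> carrier Z" for x u y v w
    proof -
      have "(x \<otimes>\<^bsub>Z\<^esub> inv\<^bsub>Z\<^esub> u \<otimes>\<^bsub>Z\<^esub> y) \<otimes>\<^bsub>Z\<^esub> (u \<otimes>\<^bsub>Z\<^esub> v \<otimes>\<^bsub>Z\<^esub> w) = (inv\<^bsub>Z\<^esub> u \<otimes>\<^bsub>Z\<^esub> u) \<otimes>\<^bsub>Z\<^esub> (x \<otimes>\<^bsub>Z\<^esub> y \<otimes>\<^bsub>Z\<^esub> v \<otimes>\<^bsub>Z\<^esub> w)"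
        using that by (simp only: Z.m_ac Z.inv_closed Z.m_closed)
      then show ?thesis using that by simp
    qed
    let ?u = "\<phi> (g \<otimes>\<^bsub>G\<^esub> h)" and ?v = "\<phi> (h \<otimes>\<^bsub>G\<^esub> k)" and ?w = "inv\<^bsub>Z\<^esub> (\<phi> (g \<otimes>\<^bsub>G\<^esub> h \<otimes>\<^bsub>G\<^esub> k))"
    have "\<delta> \<phi> (g \<otimes>\<^bsub>G\<^esub> h, k) \<otimes>\<^bsub>Z\<^esub> \<delta> \<phi> (g, h) =
      (\<phi> h \<otimes>\<^bsub>Z\<^esub> inv\<^bsub>Z\<^esub> ?u \<otimes>\<^bsub>Z\<^esub> \<phi> g) \<otimes>\<^bsub>Z\<^esub> (?u \<otimes>\<^bsub>Z\<^esub> ?w \<otimes>\<^bsub>Z\<^esub> \<phi> k)"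
      using gh c by (simp add: Z.m_ac)
    also have "\<dots> = \<phi> h \<otimes>\<^bsub>Z\<^esub> \<phi> g \<otimes>\<^bsub>Z\<^esub> ?w \<otimes>\<^bsub>Z\<^esub> \<phi> k" using gh c by (intro cancel) auto
    also have "\<dots> = \<phi> k \<otimes>\<^bsub>Z\<^esub> \<phi> h \<otimes>\<^bsub>Z\<^esub> ?w \<otimes>\<^bsub>Z\<^esub> \<phi> g" using gh c by (simp add: Z.m_ac)
    also have "\<dots> = (\<phi> k \<otimes>\<^bsub>Z\<^esub> inv\<^bsub>Z\<^esub> ?v \<otimes>\<^bsub>Z\<^esub> \<phi> h) \<otimes>\<^bsub>Z\<^esub> (?v \<otimes>\<^bsub>Z\<^esub> ?w \<otimes>\<^bsub>Z\<^esub> \<phi> g)"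
      using gh c by (intro cancel[symmetric]) auto
    also have "\<dots> = \<delta> \<phi> (h, k) \<otimes>\<^bsub>Z\<^esub> \<delta> \<phi> (g, h \<otimes>\<^bsub>G\<^esub> k)"
      using gh c by (simp add: G.m_assoc)
    finally show ?thesis by (rule sym)
  qed
  then show ?thesis using c by (auto simp: cocycles2_def \<delta>_def)
qed

lemma \<delta>_mult:
  assumes "\<phi> \<in> carrier G \<rightarrow> carrier Z" "\<phi>' \<in> carrier G \<rightarrow> carrier Z"
  shows "\<delta> \<phi> \<otimes>\<^bsub>cocycle_group2 G Z\<^esub> \<delta> \<phi>' = \<delta> (\<lambda>g. \<phi> g \<otimes>\<^bsub>Z\<^esub> \<phi>' g)"
proof -
  have c: "\<phi> g \<in> carrier Z" "\<phi>' g \<in> carrier Z" if "g \<in> carrier G" for g using assms that by auto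
  show ?thesis
    by (auto simp: \<delta>_def c Z.inv_mult Z.m_ac intro!: restrict_ext)
qed

lemma normal_coboundaries2: "coboundaries2 G Z \<lhd> cocycle_group2 G Z"
proof -
  interpret C: comm_group "cocycle_group2 G Z" by (rule comm_group_cocycle_group2)
  have one: "\<delta> (\<lambda>g. \<one>\<^bsub>Z\<^esub>) = \<one>\<^bsub>cocycle_group2 G Z\<^esub>"
    by (auto simp: \<delta>_def intro!: restrict_ext)
  have "subgroup (coboundaries2 G Z) (cocycle_group2 G Z)"
  proof (rule C.subgroupI)
    show "coboundaries2 G Z \<subseteq> carrier (cocycle_group2 G Z)"
      using \<delta>_cocycle by (auto simp: coboundaries2_iff)
    have "\<delta> (\<lambda>g. \<one>\<^bsub>Z\<^esub>) \<in> coboundaries2 G Z" unfolding coboundaries2_iff by blast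
    then show "coboundaries2 G Z \<noteq> {}" by blast
  next
    fix \<alpha> assume "\<alpha> \<in> coboundaries2 G Z"
    then obtain \<phi> where \<phi>: "\<phi> \<in> carrier G \<rightarrow> carrier Z" "\<alpha> = \<delta> \<phi>" by (auto simp: coboundaries2_iff)
    have \<psi>: "(\<lambda>g. inv\<^bsub>Z\<^esub> (\<phi> g)) \<in> carrier G \<rightarrow> carrier Z" using \<phi>(1) by auto
    have "\<delta> (\<lambda>g. inv\<^bsub>Z\<^esub> (\<phi> g)) \<otimes>\<^bsub>cocycle_group2 G Z\<^esub> \<delta> \<phi> = \<delta> (\<lambda>g. inv\<^bsub>Z\<^esub> (\<phi> g) \<otimes>\<^bsub>Z\<^esub> \<phi> g)"
      by (rule \<delta>_mult[OF \<psi> \<phi>(1)])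
    also have "\<dots> = \<delta> (\<lambda>g. \<one>\<^bsub>Z\<^esub>)" unfolding \<delta>_def using \<phi>(1) by (intro restrict_ext) (auto simp: Pi_iff)
    finally have "inv\<^bsub>cocycle_group2 G Z\<^esub> \<alpha> = \<delta> (\<lambda>g. inv\<^bsub>Z\<^esub> (\<phi> g))"
      using \<phi> \<psi> \<delta>_cocycle one by (intro C.inv_equality) (simp_all del: cocycle_group2_simps(2,3))
    then show "inv\<^bsub>cocycle_group2 G Z\<^esub> \<alpha> \<in> coboundaries2 G Z" using \<psi> by (auto simp: coboundaries2_iff)
  next
    fix \<alpha> \<beta> assume "\<alpha> \<in> coboundaries2 G Z" "\<beta> \<in> coboundaries2 G Z"
    then obtain \<phi> \<psi> where "\<phi> \<in> carrier G \<rightarrow> carrier Z" "\<alpha> = \<delta> \<phi>" "\<psi> \<in> carrier G \<rightarrow> carrier Z" "\<beta> = \<delta> \<psi>"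
      by (auto simp: coboundaries2_iff)
    then show "\<alpha> \<otimes>\<^bsub>cocycle_group2 G Z\<^esub> \<beta> \<in> coboundaries2 G Z"
      unfolding coboundaries2_iff by (intro bexI[of _ "\<lambda>g. \<phi> g \<otimes>\<^bsub>Z\<^esub> \<psi> g"]) (auto simp only: \<delta>_mult Pi_iff Z.m_closed)
  qed
  then show ?thesis by (rule C.subgroup_imp_normal)
qed

text \<open>The two sections differ pointwise by a cochain with values in \<open>Z\<close>; its
  coboundary relates their cocycles, because central factors can be collected in front.\<close>

lemma section_cocycle_cohomologous:
  assumes s: "s \<in> sections E G \<pi>" and t: "t \<in> sections E G \<pi>"
  shows "coboundaries2 G Z #>\<^bsub>cocycle_group2 G Z\<^esub> \<omega> s = coboundaries2 G Z #>\<^bsub>cocycle_group2 G Z\<^esub> \<omega> t"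
proof -
  interpret C: comm_group "cocycle_group2 G Z" by (rule comm_group_cocycle_group2)
  interpret B: normal "coboundaries2 G Z" "cocycle_group2 G Z" by (rule normal_coboundaries2)
  have "\<exists>z. z \<in> carrier Z \<and> s g = i z \<otimes>\<^bsub>E\<^esub> t g" if g: "g \<in> carrier G" for g
    using section_decomp[OF t section_closed[OF s g]] section_proj[OF s g] by metis
  then obtain \<phi> where \<phi>: "\<And>g. g \<in> carrier G \<Longrightarrow> \<phi> g \<in> carrier Z"
      "\<And>g. g \<in> carrier G \<Longrightarrow> s g = i (\<phi> g) \<otimes>\<^bsub>E\<^esub> t g" by metis
  have tc: "t g \<in> carrier E" if "g \<in> carrier G" for g using section_closed[OF t that] .
  have "\<omega> s (g, h) = \<delta> \<phi> (g, h) \<otimes>\<^bsub>Z\<^esub> \<omega> t (g, h)" if g: "g \<in> carrier G" and h: "h \<in> carrier G" for g h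
  proof -
    have gh: "g \<otimes>\<^bsub>G\<^esub> h \<in> carrier G" using g h by simp
    note ws = i_section_cocycle[OF s g h] and wt = i_section_cocycle[OF t g h]
    have "i (\<omega> s (g, h) \<otimes>\<^bsub>Z\<^esub> \<phi> (g \<otimes>\<^bsub>G\<^esub> h)) \<otimes>\<^bsub>E\<^esub> t (g \<otimes>\<^bsub>G\<^esub> h) = s g \<otimes>\<^bsub>E\<^esub> s h"
      using ws \<phi>[OF gh] tc[OF gh] by (simp add: E.m_assoc)
    also have "\<dots> = i (\<phi> g \<otimes>\<^bsub>Z\<^esub> \<phi> h) \<otimes>\<^bsub>E\<^esub> (t g \<otimes>\<^bsub>E\<^esub> t h)"
      unfolding \<phi>(2)[OF g] \<phi>(2)[OF h] using g h \<phi>(1) tc by (intro i_mult_mult) auto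
    also have "\<dots> = i (\<phi> g \<otimes>\<^bsub>Z\<^esub> \<phi> h \<otimes>\<^bsub>Z\<^esub> \<omega> t (g, h)) \<otimes>\<^bsub>E\<^esub> t (g \<otimes>\<^bsub>G\<^esub> h)"
      unfolding wt(3) using wt(1) \<phi>(1) g h tc[OF gh] by (simp add: E.m_assoc)
    finally have "i (\<omega> s (g, h) \<otimes>\<^bsub>Z\<^esub> \<phi> (g \<otimes>\<^bsub>G\<^esub> h)) \<otimes>\<^bsub>E\<^esub> t (g \<otimes>\<^bsub>G\<^esub> h) =
        i (\<phi> g \<otimes>\<^bsub>Z\<^esub> \<phi> h \<otimes>\<^bsub>Z\<^esub> \<omega> t (g, h)) \<otimes>\<^bsub>E\<^esub> t (g \<otimes>\<^bsub>G\<^esub> h)" .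
    from section_decomp_unique[OF t _ _ gh gh this]
    have e: "\<omega> s (g, h) \<otimes>\<^bsub>Z\<^esub> \<phi> (g \<otimes>\<^bsub>G\<^esub> h) = \<phi> g \<otimes>\<^bsub>Z\<^esub> \<phi> h \<otimes>\<^bsub>Z\<^esub> \<omega> t (g, h)"
      using ws(1) wt(1) \<phi>(1) g h gh by simp
    have "\<omega> s (g, h) = \<omega> s (g, h) \<otimes>\<^bsub>Z\<^esub> \<phi> (g \<otimes>\<^bsub>G\<^esub> h) \<otimes>\<^bsub>Z\<^esub> inv\<^bsub>Z\<^esub> (\<phi> (g \<otimes>\<^bsub>G\<^esub> h))"
      using ws(1) \<phi>(1)[OF gh] by (simp add: Z.m_assoc)
    also have "\<dots> = \<delta> \<phi> (g, h) \<otimes>\<^bsub>Z\<^esub> \<omega> t (g, h)"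
      unfolding e using g h \<phi>(1) wt(1) by (simp add: Z.m_ac)
    finally show ?thesis .
  qed
  then have "\<omega> s = \<delta> \<phi> \<otimes>\<^bsub>cocycle_group2 G Z\<^esub> \<omega> t"
    by (auto simp: fun_eq_iff section_cocycle_def)
  moreover have "\<delta> \<phi> \<in> coboundaries2 G Z" using \<phi>(1) by (auto simp: coboundaries2_iff)
  ultimately have "\<omega> s \<in> coboundaries2 G Z #>\<^bsub>cocycle_group2 G Z\<^esub> \<omega> t"
    unfolding r_coset_def by blast
  then show ?thesis
    using C.repr_independence[OF _ _ B.subgroup_axioms] section_cocycle_in_cocycles2[OF t] by simp
qed

section \<open>The Euler class and its order\<close>

lemma euler_class_eq:
  assumes "s \<in> sections E G \<pi>"
  shows "euler_class Z E G i \<pi> = coboundaries2 G Z #>\<^bsub>cocycle_group2 G Z\<^esub> \<omega> s"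
  unfolding euler_class_def
proof (rule the_equality)
  fix \<epsilon> assume "\<exists>t\<in>sections E G \<pi>. \<epsilon> = coboundaries2 G Z #>\<^bsub>cocycle_group2 G Z\<^esub> \<omega> t"
  then obtain t where t: "t \<in> sections E G \<pi>" and \<epsilon>: "\<epsilon> = coboundaries2 G Z #>\<^bsub>cocycle_group2 G Z\<^esub> \<omega> t" ..
  show "\<epsilon> = coboundaries2 G Z #>\<^bsub>cocycle_group2 G Z\<^esub> \<omega> s"
    unfolding \<epsilon> by (rule section_cocycle_cohomologous[OF t assms])
qed (use assms in blast)

text \<open>The two sides correspond for each positive \<open>n\<close>. If the n-th power of the
  cocycle is the coboundary of \<phi>, then \<phi> is the datum that extends the n-th power map of
  \<open>Z\<close> to \<open>E\<close>. Conversely, applying \<psi> to the relation defining the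
  cocycle shows that its n-th power is the coboundary of \<psi> composed with
  \<open>s\<close>.\<close>

lemma finite_order_euler_class_iff:
  "finite_order (H2_cohom G Z) (euler_class Z E G i \<pi>) \<longleftrightarrow> (\<exists>n \<psi>. power_retract n \<psi>)"
proof -
  interpret C: comm_group "cocycle_group2 G Z" by (rule comm_group_cocycle_group2)
  interpret B: normal "coboundaries2 G Z" "cocycle_group2 G Z" by (rule normal_coboundaries2)
  obtain s where s: "s \<in> sections E G \<pi>" by (rule section_exists)
  have \<omega>: "\<omega> s \<in> cocycles2 G Z" by (rule section_cocycle_in_cocycles2[OF s])
  have pow: "(euler_class Z E G i \<pi>) [^]\<^bsub>H2_cohom G Z\<^esub> n = \<one>\<^bsub>H2_cohom G Z\<^esub> \<longleftrightarrow>
      \<omega> s [^]\<^bsub>cocycle_group2 G Z\<^esub> n \<in> coboundaries2 G Z" for n :: nat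
  proof -
    have c: "\<omega> s [^]\<^bsub>cocycle_group2 G Z\<^esub> n \<in> carrier (cocycle_group2 G Z)"
      using \<omega> by (intro C.nat_pow_closed) simp
    have "(euler_class Z E G i \<pi>) [^]\<^bsub>H2_cohom G Z\<^esub> n =
        coboundaries2 G Z #>\<^bsub>cocycle_group2 G Z\<^esub> (\<omega> s [^]\<^bsub>cocycle_group2 G Z\<^esub> n)"
      unfolding euler_class_eq[OF s] H2_cohom_def using \<omega> by (intro B.FactGroup_pow) simp
    then show ?thesis
      using C.coset_join1[OF _ c B.subgroup_axioms] C.coset_join2[OF c B.subgroup_axioms]
      by (auto simp: H2_cohom_def)
  qed
  have "(\<omega> s [^]\<^bsub>cocycle_group2 G Z\<^esub> n \<in> coboundaries2 G Z) \<longleftrightarrow> (\<exists>\<psi>. power_retract n \<psi>)"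
    if n: "n > 0" for n :: nat
  proof
    assume "\<omega> s [^]\<^bsub>cocycle_group2 G Z\<^esub> n \<in> coboundaries2 G Z"
    then obtain \<phi> where \<phi>: "\<phi> \<in> carrier G \<rightarrow> carrier Z" "\<omega> s [^]\<^bsub>cocycle_group2 G Z\<^esub> n = \<delta> \<phi>"
      by (auto simp: coboundaries2_iff)
    have "\<omega> s (g, h) [^]\<^bsub>Z\<^esub> n = \<phi> h \<otimes>\<^bsub>Z\<^esub> inv\<^bsub>Z\<^esub> (\<phi> (g \<otimes>\<^bsub>G\<^esub> h)) \<otimes>\<^bsub>Z\<^esub> \<phi> g"
      if "g \<in> carrier G" "h \<in> carrier G" for g h
      using fun_cong[OF \<phi>(2), of "(g, h)"] that \<omega> by (simp add: cocycle_group2_pow)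
    moreover have "(\<lambda>z. z [^]\<^bsub>Z\<^esub> n) \<in> hom Z Z" by (auto simp: hom_def Z.nat_pow_distrib)
    ultimately obtain \<psi> where "\<psi> \<in> hom E Z" "\<And>z. z \<in> carrier Z \<Longrightarrow> \<psi> (i z) = z [^]\<^bsub>Z\<^esub> n"
      using extend_hom_of_coboundary[OF s Z.comm_group_axioms, of "\<lambda>z. z [^]\<^bsub>Z\<^esub> n" \<phi>] \<phi>(1) by blast
    then show "\<exists>\<psi>. power_retract n \<psi>" using n by (auto simp: power_retract_def)
  next
    assume "\<exists>\<psi>. power_retract n \<psi>"
    then obtain \<psi> where \<psi>: "\<psi> \<in> hom E Z" "\<And>z. z \<in> carrier Z \<Longrightarrow> \<psi> (i z) = z [^]\<^bsub>Z\<^esub> n"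
      by (auto simp: power_retract_def)
    interpret \<psi>: group_hom E Z \<psi> using \<psi>(1) by unfold_locales
    have "\<omega> s (g, h) [^]\<^bsub>Z\<^esub> n = \<delta> (\<lambda>g. \<psi> (s g)) (g, h)" if "g \<in> carrier G" "h \<in> carrier G" for g h
    proof -
      have sc: "s g \<in> carrier E" "s h \<in> carrier E" "s (g \<otimes>\<^bsub>G\<^esub> h) \<in> carrier E"
        using that section_closed[OF s] by auto
      have "\<omega> s (g, h) [^]\<^bsub>Z\<^esub> n = \<psi> (i (\<omega> s (g, h)))" using i_section_cocycle(1)[OF s that] \<psi>(2) by simp
      also have "\<dots> = \<delta> (\<lambda>g. \<psi> (s g)) (g, h)"
        unfolding i_section_cocycle(2)[OF s that] using that sc by (simp add: Z.m_ac)
      finally show ?thesis .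
    qed
    then have "\<omega> s [^]\<^bsub>cocycle_group2 G Z\<^esub> n = \<delta> (\<lambda>g. \<psi> (s g))"
      using \<omega> by (auto simp: cocycle_group2_pow \<delta>_def fun_eq_iff)
    then show "\<omega> s [^]\<^bsub>cocycle_group2 G Z\<^esub> n \<in> coboundaries2 G Z"
      unfolding coboundaries2_iff using section_closed[OF s] by (intro bexI[of _ "\<lambda>g. \<psi> (s g)"]) auto
  qed
  then show ?thesis unfolding finite_order_def pow power_retract_def by blast
qed

section \<open>Property (*) and Lipschitz sections\<close>

text \<open>The cochain obtained from \<open>property_star\<close> is real even though \<chi> is
  integral. A real extension of \<chi> to \<open>E\<close> is enough: its target is abelian, so it
  kills commutators, and the integers embed in the reals.\<close>

lemma character_vanishes_on_derived:
  assumes "property_star TYPE('a) G" "lipschitz_section s" "\<chi> \<in> hom Z integer_group"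
    and "z \<in> carrier Z" "i z \<in> derived E (carrier E)"
  shows "\<chi> z = 0"
proof -
  have s: "s \<in> sections E G \<pi>"
    and fin: "\<And>x. x \<in> carrier G \<Longrightarrow> finite ((\<lambda>g. inv\<^bsub>E\<^esub> (s g) \<otimes>\<^bsub>E\<^esub> s (g \<otimes>\<^bsub>G\<^esub> x)) ` carrier G)"
    using assms(2) by (auto simp: lipschitz_section_def)
  have \<chi>: "\<chi> (a \<otimes>\<^bsub>Z\<^esub> b) = \<chi> a + \<chi> b" if "a \<in> carrier Z" "b \<in> carrier Z" for a b
    using assms(3) that by (auto simp: hom_def)
  define c where "c x = real_of_int (\<chi> (\<omega> s x))" for x
  note \<omega> = i_section_cocycle[OF s]
  have "real_cocycle2 G c"
    unfolding real_cocycle2_def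
  proof (intro ballI)
    fix g h k assume ghk: "g \<in> carrier G" "h \<in> carrier G" "k \<in> carrier G"
    then have "\<omega> s (h, k) \<otimes>\<^bsub>Z\<^esub> \<omega> s (g, h \<otimes>\<^bsub>G\<^esub> k) = \<omega> s (g \<otimes>\<^bsub>G\<^esub> h, k) \<otimes>\<^bsub>Z\<^esub> \<omega> s (g, h)"
      using section_cocycle_in_cocycles2[OF s] by (auto simp: cocycles2_def)
    then have "\<chi> (\<omega> s (h, k)) + \<chi> (\<omega> s (g, h \<otimes>\<^bsub>G\<^esub> k)) = \<chi> (\<omega> s (g \<otimes>\<^bsub>G\<^esub> h, k)) + \<chi> (\<omega> s (g, h))"
      using ghk \<omega>(1) by (simp flip: \<chi>)
    then show "c (h, k) + c (g, h \<otimes>\<^bsub>G\<^esub> k) = c (g \<otimes>\<^bsub>G\<^esub> h, k) + c (g, h)"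
      unfolding c_def by linarith
  qed
  moreover have "\<exists>B. \<forall>g\<in>carrier G. \<bar>c (g, h)\<bar> \<le> B" if h: "h \<in> carrier G" for h
  proof -
    \<comment> \<open>By centrality the cocycle value can be rotated into \<open>s h\<close> times
      the inverse of the increment of \<open>s\<close> from \<open>g\<close> to
      \<open>g \<otimes> h\<close>. For fixed \<open>h\<close> the increments are finitely many,
      hence so are the values of the cocycle.\<close>
    define D where "D = (\<lambda>d. s h \<otimes>\<^bsub>E\<^esub> inv\<^bsub>E\<^esub> d) ` (\<lambda>g. inv\<^bsub>E\<^esub> (s g) \<otimes>\<^bsub>E\<^esub> s (g \<otimes>\<^bsub>G\<^esub> h)) ` carrier G"
    have "finite D" unfolding D_def using fin[OF h] by (rule finite_imageI)
    have "\<omega> s (g, h) \<in> {z \<in> carrier Z. i z \<in> D}" if g: "g \<in> carrier G" for g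
    proof -
      have sc: "s g \<in> carrier E" "s h \<in> carrier E" "s (g \<otimes>\<^bsub>G\<^esub> h) \<in> carrier E"
        using g h section_closed[OF s] by auto
      have "i (\<omega> s (g, h)) = s g \<otimes>\<^bsub>E\<^esub> (s h \<otimes>\<^bsub>E\<^esub> inv\<^bsub>E\<^esub> (s (g \<otimes>\<^bsub>G\<^esub> h)))"
        using \<omega>(2)[OF g h] sc by (simp add: E.m_assoc)
      from central_conj[OF \<omega>(1)[OF g h] _ _ this]
      have "i (\<omega> s (g, h)) = s h \<otimes>\<^bsub>E\<^esub> inv\<^bsub>E\<^esub> (inv\<^bsub>E\<^esub> (s g) \<otimes>\<^bsub>E\<^esub> s (g \<otimes>\<^bsub>G\<^esub> h))"
        using sc by (simp add: E.inv_mult_group E.m_assoc)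
      then have "i (\<omega> s (g, h)) \<in> D" unfolding D_def using g by blast
      then show ?thesis using \<omega>(1)[OF g h] by blast
    qed
    then have "finite ((\<lambda>g. \<bar>c (g, h)\<bar>) ` carrier G)"
      by (intro finite_subset[OF _ finite_imageI[OF finite_i_preimage[OF \<open>finite D\<close>], of "\<lambda>z. \<bar>real_of_int (\<chi> z)\<bar>"]])
         (force simp: c_def)
    then show ?thesis by (intro exI[of _ "Max ((\<lambda>g. \<bar>c (g, h)\<bar>) ` carrier G)"]) auto
  qed
  ultimately obtain \<phi> where \<phi>: "\<And>g h. g \<in> carrier G \<Longrightarrow> h \<in> carrier G \<Longrightarrow> c (g, h) = \<phi> h - \<phi> (g \<otimes>\<^bsub>G\<^esub> h) + \<phi> g"
    using property_star_coboundary[OF G.is_group assms(1)] by metis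
  let ?R = "add_monoid real_ring"
  interpret R: comm_group ?R by (rule comm_group_real)
  have R: "carrier ?R = UNIV" "a \<otimes>\<^bsub>?R\<^esub> b = a + b" "\<one>\<^bsub>?R\<^esub> = 0" for a b
    by (simp_all add: real_ring_def)
  have inv: "inv\<^bsub>?R\<^esub> a = - a" for a by (rule R.inv_equality) (simp_all add: real_ring_def)
  have "(\<lambda>z. real_of_int (\<chi> z)) \<in> hom Z ?R"
    by (rule homI) (simp_all add: real_ring_def \<chi>)
  from extend_hom_of_coboundary[OF s R.comm_group_axioms this, of \<phi>]
  obtain \<Psi> where \<Psi>: "\<Psi> \<in> hom E ?R" "\<And>z. z \<in> carrier Z \<Longrightarrow> \<Psi> (i z) = real_of_int (\<chi> z)"
    using \<phi> unfolding R inv c_def by (auto simp: algebra_simps)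
  have "\<Psi> (i z) = 0" using E.hom_derived_eq_one[OF R.comm_group_axioms \<Psi>(1) assms(5)] R by simp
  then show ?thesis using \<Psi>(2)[OF assms(4)] by simp
qed

text \<open>
  Characters of \<open>Z\<close> show that \<open>Z \<inter> [E, E]\<close> is torsion, of some exponent \<open>N\<close>. The \<open>N\<close>-th power map of \<open>Z\<close>
  thus factors through the abelianization of \<open>E\<close>, from where a further power of it extends.
\<close>

lemma lipschitz_section_imp_power_retract:
  assumes "property_star TYPE('a) G" "lipschitz_section s" "finitely_generated Z" "finitely_generated G"
  obtains n \<psi> where "power_retract n \<psi>"
proof -
  define D where "D = derived E (carrier E)"
  interpret D: normal D E unfolding D_def by (rule E.derived_self_is_normal)
  interpret Q: comm_group "E Mod D" unfolding D_def by (rule E.derived_quot_is_comm_group)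
  define q where "q e = D #>\<^bsub>E\<^esub> e" for e
  interpret q: group_hom E "E Mod D" q
    using D.r_coset_hom_Mod unfolding q_def by unfold_locales
  have q_surj: "q ` carrier E = carrier (E Mod D)" by (simp add: q_def carrier_FactGroup)
  have q_eq: "q x = q y \<Longrightarrow> x \<otimes>\<^bsub>E\<^esub> inv\<^bsub>E\<^esub> y \<in> D" if "x \<in> carrier E" "y \<in> carrier E" for x y
    unfolding q_def using that E.rcos_self[OF that(1) D.subgroup_axioms] D.rcos_module_imp[OF E.is_group that(2)] by metis
  obtain N :: nat where N: "N > 0"
    "\<And>a (n::nat). a \<in> carrier Z \<Longrightarrow> n > 0 \<Longrightarrow> a [^]\<^bsub>Z\<^esub> n = \<one>\<^bsub>Z\<^esub> \<Longrightarrow> a [^]\<^bsub>Z\<^esub> N = \<one>\<^bsub>Z\<^esub>"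
    using Z.torsion_exponent[OF assms(3)] by metis
  have torsion: "z [^]\<^bsub>Z\<^esub> N = \<one>\<^bsub>Z\<^esub>" if z: "z \<in> carrier Z" "i z \<in> D" for z
  proof (rule ccontr)
    assume "z [^]\<^bsub>Z\<^esub> N \<noteq> \<one>\<^bsub>Z\<^esub>"
    then have "z [^]\<^bsub>Z\<^esub> n \<noteq> \<one>\<^bsub>Z\<^esub>" if "n > 0" for n :: nat using N(2)[OF z(1) that] by blast
    then obtain \<chi> where "\<chi> \<in> hom Z integer_group" "\<chi> z \<noteq> 0"
      using Z.nontorsion_character[OF assms(3) z(1)] by metis
    then show False
      using character_vanishes_on_derived[OF assms(1,2) _ z(1)] z(2) unfolding D_def by blast
  qed
  define A where "A = q ` i ` carrier Z"
  have A: "subgroup A (E Mod D)"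
    unfolding A_def by (intro q.subgroup_img_is_subgroup i.subgroup_img_is_subgroup Z.subgroup_self)
  \<comment> \<open>The choice does not affect \<open>h\<close>: two preimages of the same element
    differ by some \<open>y\<close> with \<open>i y\<close> in \<open>D\<close>, and the exponent
    \<open>N\<close> annihilates such \<open>y\<close> by \<open>torsion\<close>.\<close>
  define h where "h a = (SOME z. z \<in> carrier Z \<and> q (i z) = a) [^]\<^bsub>Z\<^esub> N" for a
  have h: "h (q (i z)) = z [^]\<^bsub>Z\<^esub> N" if z: "z \<in> carrier Z" for z
  proof -
    define y where "y = (SOME y. y \<in> carrier Z \<and> q (i y) = q (i z))"
    have y: "y \<in> carrier Z \<and> q (i y) = q (i z)"
      unfolding y_def by (rule someI[of _ z]) (use z in simp)
    then have "i (y \<otimes>\<^bsub>Z\<^esub> inv\<^bsub>Z\<^esub> z) \<in> D" using q_eq[of "i y" "i z"] z by simp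
    then have "(y \<otimes>\<^bsub>Z\<^esub> inv\<^bsub>Z\<^esub> z) [^]\<^bsub>Z\<^esub> N = \<one>\<^bsub>Z\<^esub>" using y z by (intro torsion) auto
    then have "y [^]\<^bsub>Z\<^esub> N \<otimes>\<^bsub>Z\<^esub> inv\<^bsub>Z\<^esub> (z [^]\<^bsub>Z\<^esub> N) = \<one>\<^bsub>Z\<^esub>"
      using y z by (simp add: Z.nat_pow_distrib Z.nat_pow_inv)
    then have "y [^]\<^bsub>Z\<^esub> N = z [^]\<^bsub>Z\<^esub> N"
      using y z by (metis Z.inv_closed Z.inv_equality Z.inv_inv Z.nat_pow_closed)
    then show ?thesis by (simp add: h_def y_def)
  qed
  have "h \<in> hom ((E Mod D)\<lparr>carrier := A\<rparr>) Z"
  proof (rule homI)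
    fix a b assume "a \<in> carrier ((E Mod D)\<lparr>carrier := A\<rparr>)" "b \<in> carrier ((E Mod D)\<lparr>carrier := A\<rparr>)"
    then obtain y z where yz: "y \<in> carrier Z" "z \<in> carrier Z" "a = q (i y)" "b = q (i z)"
      by (auto simp: A_def)
    show "h a \<in> carrier Z" using yz h by simp
    have "a \<otimes>\<^bsub>(E Mod D)\<lparr>carrier := A\<rparr>\<^esub> b = q (i (y \<otimes>\<^bsub>Z\<^esub> z))"
      using yz q.hom_mult[of "i y" "i z"] by simp
    then show "h (a \<otimes>\<^bsub>(E Mod D)\<lparr>carrier := A\<rparr>\<^esub> b) = h a \<otimes>\<^bsub>Z\<^esub> h b"
      using yz by (simp add: h Z.nat_pow_distrib del: i.hom_mult)
  qed
  moreover have "finitely_generated (E Mod D)"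
  proof -
    obtain S where S: "finite S" "S \<subseteq> carrier E" "generate E S = carrier E"
      using finitely_generated_E[OF assms(3,4)] by (auto simp: finitely_generated_def)
    then have "generate (E Mod D) (q ` S) = carrier (E Mod D)"
      using q.generate_img[OF S(2)] q_surj by simp
    moreover have "q ` S \<subseteq> carrier (E Mod D)" using S(2) q.hom_closed by blast
    ultimately show ?thesis using S(1) unfolding finitely_generated_def by blast
  qed
  ultimately obtain n :: nat and h' where h': "n > 0" "h' \<in> hom (E Mod D) Z"
      "\<And>a. a \<in> A \<Longrightarrow> h' a = h a [^]\<^bsub>Z\<^esub> n"
    using Q.extend_hom_up_to_power[OF _ A Z.comm_group_axioms] by metis
  have "h' \<circ> q \<in> hom E Z" using hom_compose[OF q.homh h'(2)] .
  moreover have "(h' \<circ> q) (i z) = z [^]\<^bsub>Z\<^esub> (N * n)" if z: "z \<in> carrier Z" for z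
  proof -
    have "q (i z) \<in> A" using z by (auto simp: A_def)
    then show ?thesis using z h'(3) by (simp add: h Z.nat_pow_pow)
  qed
  ultimately have "power_retract (N * n) (h' \<circ> q)" using N(1) h'(1) by (simp add: power_retract_def)
  then show ?thesis by (rule that)
qed

end

theorem theorem5p15:
  fixes G :: "'g monoid" and Z :: "'z monoid" and E :: "'e monoid"
    and i :: "'z \<Rightarrow> 'e" and \<pi> :: "'e \<Rightarrow> 'g"
  assumes "group G" and "finitely_generated G" and "property_star TYPE('a) G"
    and "comm_group Z" and "finitely_generated Z"
    and "central_extension Z E G i \<pi>"
  shows "(qi_trivial Z E G \<pi> \<longleftrightarrow> finite_order (H2_cohom G Z) (euler_class Z E G i \<pi>)) \<and>
         (torsion_free Z \<longrightarrow> (qi_trivial Z E G \<pi> \<longleftrightarrow> virtually_trivial Z E G i \<pi>))"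
proof -
  interpret central_extension Z E G i \<pi> by fact
  have qi: "qi_trivial Z E G \<pi> \<longleftrightarrow> (\<exists>s. lipschitz_section s)"
    using qi_trivial_imp_lipschitz_section lipschitz_section_imp_qi_trivial assms(2,5) by metis
  have retract: "(\<exists>s. lipschitz_section s) \<longleftrightarrow> (\<exists>n \<psi>. power_retract n \<psi>)"
    using lipschitz_section_imp_power_retract[OF assms(3) _ assms(5,2)]
      power_retract_imp_lipschitz_section[OF _ assms(5)] by metis
  have "(\<exists>s. lipschitz_section s) \<longleftrightarrow> virtually_trivial Z E G i \<pi>" if "torsion_free Z"
    using retract virtually_trivial_imp_lipschitz_section
      power_retract_imp_virtually_trivial[OF _ assms(5) that] by metis
  then show ?thesis using qi retract finite_order_euler_class_iff by simp
qed

end
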